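(* Let $\rho:\mathsf T^d\to \mathsf{SO}(V)$ be a faithful representation with $d\ge 3$. Then there exists a one-dimensional subgroup $\mathsf H\subseteq \mathsf T^d$ such that the induced representation $\bar\rho:\mathsf T^d/\mathsf H\to \mathsf{SO}(V^{\mathsf H})$ on the fixed-point set $V^{\mathsf H}$ of $\mathsf H$ is faithful and isomorphic to a product representation $$\bar\rho_1\oplus\bar\rho_2:\mathsf S^1\times \mathsf T^{d-2}\to \mathsf{SO}(V_1)\oplus\mathsf{SO}(V_2),$$ where $\bar\rho_1$ has the second factor $\mathsf T^{d-2}$ in its kernel and $\bar\rho_2$ has the first factor $\mathsf S^1$ in its kernel.
   Context: $\mathsf T^d$ is the $d$-dimensional torus and $V$ is a finite-dimensional real Euclidean vector space. Subgroups are closed; the one-dimensional subgroup $\mathsf H$ need not be connected. "Isomorphic to a product representation" means that there is an isomorphism $\mathsf T^d/\mathsf H\cong \mathsf S^1\times\mathsf T^{d-2}$ and an orthogonal invariant decomposition $V^{\mathsf H}=V_1\oplus V_2$ under which $\bar\rho$ corresponds to $\bar\rho_1\oplus\bar\rho_2$. *)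

theory Defs
  imports
    "HOL-Analysis.Analysis"
    "HOL-Algebra.Bij"
    "HOL-Algebra.Product_Groups"
    "Jordan_Normal_Form.Determinant"
begin

subsection \<open>Tori\<close>

definition circle_group :: "complex monoid" where
  "circle_group = \<lparr>carrier = sphere 0 1, mult = (*), one = 1\<rparr>"

definition circle_topology :: "complex topology" where
  "circle_topology = top_of_set (sphere 0 1)"

definition torus :: "nat \<Rightarrow> (nat \<Rightarrow> complex) monoid" where
  "torus d = product_group {..<d} (\<lambda>_. circle_group)"

definition torus_topology :: "nat \<Rightarrow> (nat \<Rightarrow> complex) topology" where
  "torus_topology d = product_topology (\<lambda>_. circle_topology) {..<d}"

lemma comm_group_circle_group: "comm_group circle_group"
proof (rule comm_groupI)
  fix x assume "x \<in> carrier circle_group"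
  then have "inverse x \<in> carrier circle_group" "inverse x \<otimes>\<^bsub>circle_group\<^esub> x = \<one>\<^bsub>circle_group\<^esub>"
    by (auto simp: circle_group_def norm_inverse intro!: left_inverse)
  then show "\<exists>y\<in>carrier circle_group. y \<otimes>\<^bsub>circle_group\<^esub> x = \<one>\<^bsub>circle_group\<^esub>" by blast
qed (auto simp: circle_group_def norm_mult)

lemma comm_group_torus: "comm_group (torus d)"
proof (rule group.group_comm_groupI)
  show "Group.group (torus d)"
    unfolding torus_def
    by (intro product_group comm_group.axioms(2)[OF comm_group_circle_group])
qed (simp add: torus_def circle_group_def mult.commute)

lemma topspace_circle_topology: "topspace circle_topology = carrier circle_group"
  by (simp add: circle_topology_def circle_group_def)

lemma topspace_torus_topology: "topspace (torus_topology d) = carrier (torus d)"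
  by (simp add: torus_topology_def torus_def topspace_circle_topology)

subsection \<open>Dimension of a subgroup, quotients\<close>

text \<open>A closed subgroup of a torus is a Lie group; its dimension is that of the underlying
  manifold.  It is Hausdorff and second countable because the torus is, so only the charts
  are required here.  No connectedness is imposed.\<close>

definition locally_Euclidean :: "nat \<Rightarrow> 'a topology \<Rightarrow> bool" where
  "locally_Euclidean n X \<longleftrightarrow>
     (\<forall>x\<in>topspace X. \<exists>U. openin X U \<and> x \<in> U \<and> subtopology X U homeomorphic_space Euclidean_space n)"

definition closed_subgroup :: "('a, 'c) monoid_scheme \<Rightarrow> 'a topology \<Rightarrow> 'a set \<Rightarrow> bool" where
  "closed_subgroup G X H \<longleftrightarrow> subgroup H G \<and> closedin X H"

definition quotient_topology ::
  "('a, 'c) monoid_scheme \<Rightarrow> 'a topology \<Rightarrow> 'a set \<Rightarrow> 'a set topology" where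
  "quotient_topology G X H =
     topology (\<lambda>\<U>. \<U> \<subseteq> carrier (G Mod H) \<and> openin X {g \<in> topspace X. H #>\<^bsub>G\<^esub> g \<in> \<U>})"

lemma openin_quotient_topology:
  "openin (quotient_topology G X H) \<U> \<longleftrightarrow>
     \<U> \<subseteq> carrier (G Mod H) \<and> openin X {g \<in> topspace X. H #>\<^bsub>G\<^esub> g \<in> \<U>}"
proof -
  let ?p = "\<lambda>\<U>. {g \<in> topspace X. H #>\<^bsub>G\<^esub> g \<in> \<U>}"
  have Int: "?p (S \<inter> T) = ?p S \<inter> ?p T" for S T by auto
  have Un: "?p (\<Union>\<K>) = \<Union> (?p ` \<K>)" for \<K> by auto
  have "istopology (\<lambda>\<U>. \<U> \<subseteq> carrier (G Mod H) \<and> openin X (?p \<U>))"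
    unfolding istopology_def Int Un by (blast intro: openin_Int openin_Union)
  then show ?thesis
    by (simp add: quotient_topology_def topology_inverse')
qed

lemma quotient_map_quotient_topology:
  assumes "topspace X = carrier G"
  shows "quotient_map X (quotient_topology G X H) (\<lambda>g. H #>\<^bsub>G\<^esub> g)"
proof -
  have "openin (quotient_topology G X H) (carrier (G Mod H))"
  proof -
    have "{g \<in> topspace X. H #>\<^bsub>G\<^esub> g \<in> carrier (G Mod H)} = topspace X"
      using assms by (auto simp: carrier_FactGroup)
    then show ?thesis by (simp add: openin_quotient_topology)
  qed
  then have "topspace (quotient_topology G X H) = carrier (G Mod H)"
    by (meson openin_quotient_topology openin_subset openin_topspace subset_antisym)
  then show ?thesis
    by (auto simp: quotient_map_def openin_quotient_topology carrier_FactGroup assms)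
qed

subsection \<open>The special orthogonal group of a subspace\<close>

definition orthonormal_basis :: "'a::euclidean_space set \<Rightarrow> 'a list \<Rightarrow> bool" where
  "orthonormal_basis W bs \<longleftrightarrow> distinct bs \<and> pairwise real_inner_class.orthogonal (set bs) \<and>
     (\<forall>b\<in>set bs. norm b = 1) \<and> span (set bs) = W"

definition matrix_wrt :: "'a::euclidean_space list \<Rightarrow> ('a \<Rightarrow> 'a) \<Rightarrow> real mat" where
  "matrix_wrt bs f = mat (length bs) (length bs) (\<lambda>(i, j). inner (bs ! i) (f (bs ! j)))"

text \<open>The choice is harmless, see \<open>det_on_eq\<close> below.\<close>

definition det_on :: "'a::euclidean_space set \<Rightarrow> ('a \<Rightarrow> 'a) \<Rightarrow> real" where
  "det_on W f = Determinant.det (matrix_wrt (SOME bs. orthonormal_basis W bs) f)"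

text \<open>Endomorphisms of \<open>W\<close> are extensional functions, so that a linear map of \<open>W\<close> is represented
  by exactly one function on the ambient type.\<close>

definition SO :: "'a::euclidean_space set \<Rightarrow> ('a \<Rightarrow> 'a) monoid" where
  "SO W = BijGroup W \<lparr>carrier := {f \<in> Bij W.
     (\<forall>x\<in>W. \<forall>y\<in>W. f (x + y) = f x + f y) \<and>
     (\<forall>c. \<forall>x\<in>W. f (c *\<^sub>R x) = c *\<^sub>R f x) \<and>
     (\<forall>x\<in>W. \<forall>y\<in>W. inner (f x) (f y) = inner x y) \<and>
     det_on W f = 1}\<rparr>"

text \<open>Pointwise convergence on \<open>W\<close>; since \<open>W\<close> is finite-dimensional, this is the usual topology.\<close>

definition SO_topology :: "'a::euclidean_space set \<Rightarrow> ('a \<Rightarrow> 'a) topology" where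
  "SO_topology W = subtopology (product_topology (\<lambda>_. euclidean) W) (carrier (SO W))"

lemma orthonormal_basis_exists:
  assumes "subspace W"
  shows "\<exists>bs. orthonormal_basis W bs"
proof -
  obtain B where B: "pairwise real_inner_class.orthogonal B" "\<And>x. x \<in> B \<Longrightarrow> norm x = 1" "independent B" "span B = W"
    using orthonormal_basis_subspace[OF assms] by metis
  obtain bs where "set bs = B" "distinct bs"
    using finite_distinct_list[OF independent_imp_finite[OF B(3)]] by blast
  with B show ?thesis by (auto simp: orthonormal_basis_def)
qed

lemma orthonormal_basis_inner:
  assumes "orthonormal_basis W bs" "i < length bs" "j < length bs"
  shows "inner (bs ! i) (bs ! j) = (if i = j then 1 else 0)"
  using assms
  by (auto simp: orthonormal_basis_def pairwise_def real_inner_class.orthogonal_def nth_eq_iff_index_eq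
      norm_eq_1)

lemma orthonormal_basis_independent:
  assumes "orthonormal_basis W bs"
  shows "independent (set bs)"
  using assms pairwise_orthogonal_independent[of "set bs"]
  by (force simp: orthonormal_basis_def)

lemma orthonormal_basis_length:
  assumes "orthonormal_basis W bs"
  shows "length bs = dim W"
  using dim_eq_card_independent[OF orthonormal_basis_independent[OF assms]] assms
  by (auto simp: orthonormal_basis_def distinct_card)

lemma orthonormal_basis_expand:
  assumes bs: "orthonormal_basis W bs" and x: "x \<in> W"
  shows "x = (\<Sum>i<length bs. inner (bs ! i) x *\<^sub>R (bs ! i))"
proof -
  let ?y = "x - (\<Sum>i<length bs. inner (bs ! i) x *\<^sub>R (bs ! i))"
  have "x \<in> span (set bs)" using bs x by (simp add: orthonormal_basis_def)
  then have y: "?y \<in> span (set bs)"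
    by (intro span_diff span_sum span_scale) (assumption, rule span_base, simp)
  have "inner (bs ! j) ?y = 0" if j: "j < length bs" for j
  proof -
    have "(\<Sum>i<length bs. inner (bs ! i) x * inner (bs ! j) (bs ! i))
        = (\<Sum>i<length bs. if i = j then inner (bs ! i) x else 0)"
      by (rule sum.cong) (auto simp: orthonormal_basis_inner[OF bs j])
    also have "\<dots> = inner (bs ! j) x" using j by simp
    finally show ?thesis by (simp only: inner_diff_right inner_sum_right inner_scaleR_right diff_self)
  qed
  then have "inner b ?y = 0" if "b \<in> set bs" for b
    using that unfolding in_set_conv_nth by blast
  then have "\<And>b. b \<in> set bs \<Longrightarrow> real_inner_class.orthogonal ?y b"
    by (simp only: real_inner_class.orthogonal_def inner_commute[of ?y])
  then have "real_inner_class.orthogonal ?y ?y" by (rule orthogonal_to_span[OF y])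
  then have "?y = 0" by (simp only: orthogonal_self)
  then show ?thesis by (rule right_minus_eq[THEN iffD1])
qed

text \<open>Independence of the determinant from the chosen orthonormal basis.\<close>

lemma det_on_eq:
  fixes f :: "'a::euclidean_space \<Rightarrow> 'a"
  assumes bs: "orthonormal_basis W bs" and f: "f ` W \<subseteq> W"
    and add: "\<And>x y. x \<in> W \<Longrightarrow> y \<in> W \<Longrightarrow> f (x + y) = f x + f y"
    and scale: "\<And>c x. x \<in> W \<Longrightarrow> f (c *\<^sub>R x) = c *\<^sub>R f x"
  shows "det_on W f = Determinant.det (matrix_wrt bs f)"
proof -
  have W: "subspace W" using bs by (metis orthonormal_basis_def subspace_span)
  define cs where "cs = (SOME bs. orthonormal_basis W bs)"
  have cs: "orthonormal_basis W cs"
    unfolding cs_def using orthonormal_basis_exists[OF W] by (rule someI_ex)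
  define n where "n = length bs"
  have n: "length bs = n" "length cs = n"
    using bs cs by (simp_all add: n_def orthonormal_basis_length)
  have inW: "bs ! i \<in> W" "cs ! i \<in> W" if "i < n" for i
    using that bs cs n by (metis nth_mem orthonormal_basis_def span_base)+
  have f_sum: "f (\<Sum>i\<in>I. c i *\<^sub>R x i) = (\<Sum>i\<in>I. c i *\<^sub>R f (x i))"
    if "finite I" "\<And>i. i \<in> I \<Longrightarrow> x i \<in> W" for I :: "nat set" and c x
    using that
  proof (induction I rule: finite_induct)
    case empty
    show ?case using scale[of 0 0] W by (simp add: subspace_0)
  next
    case (insert i I)
    then show ?case
      by (simp add: add scale W subspace_scale subspace_sum)
  qed
  define P where "P = mat n n (\<lambda>(i, j). inner (bs ! i) (cs ! j))"
  have P: "P \<in> carrier_mat n n" by (simp add: P_def)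
  have M: "matrix_wrt cs f \<in> carrier_mat n n" by (simp add: matrix_wrt_def n)
  have PT: "P * transpose_mat P = 1\<^sub>m n"
  proof (rule eq_matI)
    fix i j assume "i < dim_row (1\<^sub>m n :: real mat)" "j < dim_col (1\<^sub>m n :: real mat)"
    then have ij: "i < n" "j < n" by auto
    have "inner (bs ! i) (bs ! j) = (\<Sum>k<n. inner (bs ! i) (cs ! k) * inner (bs ! j) (cs ! k))"
      by (subst orthonormal_basis_expand[OF cs inW(1)[OF ij(2)]])
        (simp add: inner_sum_right n inner_commute mult.commute)
    with ij show "(P * transpose_mat P) $$ (i, j) = 1\<^sub>m n $$ (i, j)"
      by (simp add: P_def scalar_prod_def orthonormal_basis_inner[OF bs] n lessThan_atLeast0)
  qed (auto simp: P_def)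
  have "matrix_wrt bs f = P * matrix_wrt cs f * transpose_mat P"
  proof (rule eq_matI)
    fix i j assume "i < dim_row (P * matrix_wrt cs f * transpose_mat P)"
      "j < dim_col (P * matrix_wrt cs f * transpose_mat P)"
    then have ij: "i < n" "j < n" by (auto simp: P_def)
    have "f (bs ! j) = f (\<Sum>l<n. inner (cs ! l) (bs ! j) *\<^sub>R (cs ! l))"
      using arg_cong[OF orthonormal_basis_expand[OF cs inW(1)[OF ij(2)]], of f] by (simp only: n)
    also have "\<dots> = (\<Sum>l<n. inner (cs ! l) (bs ! j) *\<^sub>R f (cs ! l))"
      by (rule f_sum) (auto simp: inW)
    also have "\<dots> = (\<Sum>l<n. inner (cs ! l) (bs ! j) *\<^sub>R
        (\<Sum>k<n. inner (cs ! k) (f (cs ! l)) *\<^sub>R (cs ! k)))"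
    proof (rule sum.cong)
      fix l assume "l \<in> {..<n}"
      then have "f (cs ! l) \<in> W" using f inW by auto
      from orthonormal_basis_expand[OF cs this]
      show "inner (cs ! l) (bs ! j) *\<^sub>R f (cs ! l) = inner (cs ! l) (bs ! j) *\<^sub>R
          (\<Sum>k<n. inner (cs ! k) (f (cs ! l)) *\<^sub>R (cs ! k))"
        by (simp add: n)
    qed simp
    finally have "inner (bs ! i) (f (bs ! j)) = (\<Sum>l<n. (\<Sum>k<n.
        inner (bs ! i) (cs ! k) * inner (cs ! k) (f (cs ! l))) * inner (bs ! j) (cs ! l))"
      by (simp add: inner_sum_right sum_distrib_left sum_distrib_right inner_commute mult_ac)
    with ij show "matrix_wrt bs f $$ (i, j) = (P * matrix_wrt cs f * transpose_mat P) $$ (i, j)"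
      by (simp add: P_def matrix_wrt_def scalar_prod_def n lessThan_atLeast0)
  qed (auto simp: P_def matrix_wrt_def n)
  then have "Determinant.det (matrix_wrt bs f)
      = Determinant.det P * Determinant.det (matrix_wrt cs f) * Determinant.det (transpose_mat P)"
    using P M by (simp add: det_mult[where n = n])
  also have "\<dots> = Determinant.det (P * transpose_mat P) * Determinant.det (matrix_wrt cs f)"
    using P by (simp add: det_mult[where n = n])
  finally show ?thesis by (simp add: PT det_on_def cs_def)
qed

subsection \<open>Representations\<close>

definition SO_representation ::
  "('g, 'c) monoid_scheme \<Rightarrow> 'g topology \<Rightarrow> 'a::euclidean_space set \<Rightarrow> ('g \<Rightarrow> 'a \<Rightarrow> 'a) \<Rightarrow> bool" where
  "SO_representation G X W \<rho> \<longleftrightarrow> \<rho> \<in> hom G (SO W) \<and> continuous_map X (SO_topology W) \<rho>"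

definition faithful_representation ::
  "('g, 'c) monoid_scheme \<Rightarrow> 'g topology \<Rightarrow> 'a::euclidean_space set \<Rightarrow> ('g \<Rightarrow> 'a \<Rightarrow> 'a) \<Rightarrow> bool" where
  "faithful_representation G X W \<rho> \<longleftrightarrow> SO_representation G X W \<rho> \<and> inj_on \<rho> (carrier G)"

definition fixed_space :: "('g \<Rightarrow> 'a \<Rightarrow> 'a) \<Rightarrow> 'g set \<Rightarrow> 'a::euclidean_space set" where
  "fixed_space \<rho> H = {v. \<forall>h\<in>H. \<rho> h v = v}"

text \<open>\<open>the_elem\<close> selects the common restriction of all \<open>\<rho> g\<close> with \<open>g\<close> in the coset \<open>C\<close>;
  see \<open>induced_representation_coset\<close>.\<close>

definition induced_representation ::
  "('g \<Rightarrow> 'a \<Rightarrow> 'a) \<Rightarrow> 'g set \<Rightarrow> 'g set \<Rightarrow> 'a::euclidean_space \<Rightarrow> 'a" where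
  "induced_representation \<rho> H C = the_elem ((\<lambda>g. restrict (\<rho> g) (fixed_space \<rho> H)) ` C)"

lemma induced_representation_coset:
  fixes \<rho> :: "(nat \<Rightarrow> complex) \<Rightarrow> 'a::euclidean_space \<Rightarrow> 'a"
  assumes \<rho>: "\<rho> \<in> hom (torus d) (SO UNIV)" and H: "subgroup H (torus d)"
    and g: "g \<in> carrier (torus d)"
  shows "induced_representation \<rho> H (H #>\<^bsub>torus d\<^esub> g) = restrict (\<rho> g) (fixed_space \<rho> H)"
proof -
  interpret comm_group "torus d" by (rule comm_group_torus)
  have HG: "h \<in> carrier (torus d)" if "h \<in> H" for h
    using subgroup.mem_carrier[OF H that] .
  have Bij: "\<rho> x \<in> Bij UNIV" if "x \<in> carrier (torus d)" for x
    using hom_in_carrier[OF \<rho> that] by (simp add: SO_def)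
  have "restrict (\<rho> (h \<otimes>\<^bsub>torus d\<^esub> g)) (fixed_space \<rho> H) = restrict (\<rho> g) (fixed_space \<rho> H)"
    if h: "h \<in> H" for h
  proof (rule restrict_ext)
    fix v assume "v \<in> fixed_space \<rho> H"
    then have v: "\<rho> h v = v" using h by (simp add: fixed_space_def)
    have "\<rho> (h \<otimes>\<^bsub>torus d\<^esub> g) v = \<rho> (g \<otimes>\<^bsub>torus d\<^esub> h) v"
      using HG[OF h] g by (simp add: m_comm)
    also have "\<dots> = \<rho> g (\<rho> h v)"
      using hom_mult[OF \<rho> g HG[OF h]] Bij[OF g] Bij[OF HG[OF h]]
      by (simp add: SO_def BijGroup_def compose_def)
    finally show "\<rho> (h \<otimes>\<^bsub>torus d\<^esub> g) v = \<rho> g v" by (simp add: v)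
  qed
  moreover have "H \<noteq> {}" using subgroup.one_closed[OF H] by blast
  moreover have "(\<lambda>g. restrict (\<rho> g) (fixed_space \<rho> H)) ` (H #>\<^bsub>torus d\<^esub> g)
      = (\<lambda>h. restrict (\<rho> (h \<otimes>\<^bsub>torus d\<^esub> g)) (fixed_space \<rho> H)) ` H"
    unfolding r_coset_def by blast
  ultimately have "(\<lambda>g. restrict (\<rho> g) (fixed_space \<rho> H)) ` (H #>\<^bsub>torus d\<^esub> g)
      = {restrict (\<rho> g) (fixed_space \<rho> H)}"
    by (simp add: image_constant_conv)
  then show ?thesis by (simp add: induced_representation_def)
qed

definition topological_group_iso ::
  "('g, 'c) monoid_scheme \<Rightarrow> 'g topology \<Rightarrow> ('h, 'd) monoid_scheme \<Rightarrow> 'h topology \<Rightarrow> ('g \<Rightarrow> 'h) \<Rightarrow> bool" where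
  "topological_group_iso G X K Y \<phi> \<longleftrightarrow> \<phi> \<in> iso G K \<and> homeomorphic_map X Y \<phi>"

definition orthogonal_decomposition ::
  "'a::euclidean_space set \<Rightarrow> 'a set \<Rightarrow> 'a set \<Rightarrow> bool" where
  "orthogonal_decomposition W V1 V2 \<longleftrightarrow> subspace V1 \<and> subspace V2 \<and>
     (\<forall>x\<in>V1. \<forall>y\<in>V2. real_inner_class.orthogonal x y) \<and> W = {x + y | x y. x \<in> V1 \<and> y \<in> V2}"

end

theory Submission
  imports Defs
begin

no_notation Matrix.scalar_prod (infix "\<bullet>" 70)

text \<open>The weights of a representation of \<open>T\<^sup>d\<close> form a finite set \<open>S = - S\<close> in the lattice of integer
vectors, and the representation is faithful only if \<open>S\<close> spans the real vector space of rank \<open>d\<close>.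
Let \<open>q\<close> and \<open>f\<^sub>1, \<dots>, f\<^sub>d\<^sub>-\<^sub>2\<close> be linearly independent weights and let \<open>H\<close> be the
common kernel of their characters.  Then \<open>H\<close> is a closed subgroup of dimension one, and the
characters identify the quotient by \<open>H\<close> with \<open>S\<^sup>1 \<times> T\<^sup>d\<^sup>-\<^sup>2\<close>.  The weights of the fixed
space of \<open>H\<close> are the elements of \<open>S\<close> in the integral span of \<open>q, f\<^sub>1, \<dots>, f\<^sub>d\<^sub>-\<^sub>2\<close>
(\<open>character_factors\<close>), so the induced representation is faithful.  It is a product
representation if every such weight is a multiple of \<open>q\<close> or an integral combination of the
\<open>f\<^sub>j\<close>.  The theorem is therefore reduced to the combinatorial statement
\<open>exists_split_sublattice\<close> that \<open>q\<close> and \<open>f\<close> can be chosen with this property.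

This is an integral relative of the Sylvester-Gallai theorem and of its generalization to higher
dimensions by Motzkin and Hansen: a finite spanning set of points has a hyperplane in which all
points but one lie in a subspace of codimension one.  Integrality allows a short proof.  Among the
lattices generated by bases contained in \<open>S\<close> choose a minimal one and discard the elements
of \<open>S\<close> outside of it.  Afterwards any two bases generate the same lattice, so that every linear
functional that vanishes on a hyperplane spanned by elements of \<open>S\<close> takes at most one nonzero
absolute value on \<open>S\<close> (\<open>exists_minimal_lattice\<close>).

Call a subspace spanned by elements of \<open>S\<close> a flat.  Take a connected flat of maximal dimension
below \<open>d\<close>.  If it is not a hyperplane then adding any further element disconnects it, so each
element is isolated over the flat, and induction on the codimension applies
(\<open>exists_flat_with_isolated_element\<close>).  If it is a connected hyperplane \<open>U\<close>, then every
coordinate functional on \<open>U\<close>, extended to the whole space, takes at most two values on the elements of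
\<open>S\<close> on one side of \<open>U\<close>.  Hence each coordinate functional cuts
these elements into at most two parts.  In a smallest part every coordinate
linked to the cutting one is constant, and connectedness of \<open>U\<close> propagates this to all coordinates.  So the part is a single element modulo the subspace
over which \<open>U\<close> is connected, and this element is isolated (\<open>isolated_element\<close>).

The weights are found by diagonalizing the commuting symmetric maps
\<open>\<rho>(g) + \<rho>(g)\<^sup>-\<^sup>1\<close>; a joint eigenvector lies in an invariant subspace of dimension at most
two, on which the torus acts through a character (\<open>exists_weight\<close>).  Determinants are one
because every element of a torus is a square (\<open>restrict_in_SO\<close>).\<close>

section \<open>Integral spans and unimodular configurations\<close>

definition int_span :: "'v::real_vector set \<Rightarrow> 'v set" where
  "int_span B = {\<Sum>b\<in>B. of_int (n b) *\<^sub>R b | n :: 'v \<Rightarrow> int. True}"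

lemma int_spanI: "x = (\<Sum>b\<in>B. of_int (n b) *\<^sub>R b) \<Longrightarrow> x \<in> int_span B"
  by (auto simp: int_span_def)

lemma int_span_base: "finite B \<Longrightarrow> b \<in> B \<Longrightarrow> b \<in> int_span B"
  unfolding int_span_def
  by (rule CollectI, rule exI[of _ "\<lambda>x. if x = b then 1 else 0"])
     (simp add: if_distrib[of "\<lambda>x. of_int x *\<^sub>R _"] if_distribR sum.delta' cong: if_cong)

lemma int_span_0: "0 \<in> int_span B"
  unfolding int_span_def by (rule CollectI, rule exI[of _ "\<lambda>_. 0"]) simp

lemma int_span_add: "x \<in> int_span B \<Longrightarrow> y \<in> int_span B \<Longrightarrow> x + y \<in> int_span B"
proof -
  assume "x \<in> int_span B" "y \<in> int_span B"
  then obtain n m where "x = (\<Sum>b\<in>B. of_int (n b) *\<^sub>R b)" "y = (\<Sum>b\<in>B. of_int (m b) *\<^sub>R b)"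
    by (auto simp: int_span_def)
  then have "x + y = (\<Sum>b\<in>B. of_int (n b + m b) *\<^sub>R b)"
    by (simp add: sum.distrib scaleR_add_left)
  then show ?thesis by (rule int_spanI)
qed

lemma int_span_scale: "x \<in> int_span B \<Longrightarrow> of_int k *\<^sub>R x \<in> int_span B"
proof -
  assume "x \<in> int_span B"
  then obtain n where "x = (\<Sum>b\<in>B. of_int (n b) *\<^sub>R b)"
    by (auto simp: int_span_def)
  then have "of_int k *\<^sub>R x = (\<Sum>b\<in>B. of_int (k * n b) *\<^sub>R b)"
    by (simp add: scaleR_sum_right)
  then show ?thesis by (rule int_spanI)
qed

lemma int_span_uminus: "x \<in> int_span B \<Longrightarrow> - x \<in> int_span B"
  using int_span_scale[of x B "-1"] by simp

lemma int_span_sum: "(\<And>i. i \<in> I \<Longrightarrow> f i \<in> int_span B) \<Longrightarrow> sum f I \<in> int_span B"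
  by (induction I rule: infinite_finite_induct) (auto simp: int_span_0 int_span_add)

lemma int_span_mono_gen: "B' \<subseteq> int_span B \<Longrightarrow> int_span B' \<subseteq> int_span B"
  by (auto simp: int_span_def[of B'] intro!: int_span_sum int_span_scale)

lemma int_span_subset_span: "int_span B \<subseteq> span B"
  by (auto simp: int_span_def intro!: span_sum span_scale intro: span_base)

lemma int_span_insert:
  assumes "finite B" "q \<notin> B" "x \<in> int_span (insert q B)"
  obtains k y where "y \<in> int_span B" "x = of_int k *\<^sub>R q + y"
proof -
  obtain n where "x = (\<Sum>b\<in>insert q B. of_int (n b) *\<^sub>R b)" using assms(3) by (auto simp: int_span_def)
  then have "x = of_int (n q) *\<^sub>R q + (\<Sum>b\<in>B. of_int (n b) *\<^sub>R b)" using assms by simp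
  then show ?thesis using that[OF int_spanI[OF refl]] by blast
qed

text \<open>The premise says that the elements of \<open>S\<close> in the kernel of \<open>y\<close> span a hyperplane.  This is
total unimodularity of \<open>S\<close> in a form that refers to no basis and passes to contractions.\<close>

definition unimodular :: "'v::euclidean_space set \<Rightarrow> bool" where
  "unimodular S \<longleftrightarrow> (\<forall>y. \<forall>b\<in>S. y \<bullet> b \<noteq> 0 \<longrightarrow> S \<subseteq> span (insert b {x\<in>S. y \<bullet> x = 0}) \<longrightarrow>
     (\<forall>t\<in>S. y \<bullet> t \<noteq> 0 \<longrightarrow> \<bar>y \<bullet> t\<bar> = \<bar>y \<bullet> b\<bar>))"

lemma inner_zero_on_span:
  fixes y :: "'v::euclidean_space"
  assumes "x \<in> span K" "\<And>k. k \<in> K \<Longrightarrow> y \<bullet> k = 0"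
  shows "y \<bullet> x = 0"
  using assms(1)
  by (induction rule: span_induct_alt) (simp_all add: assms inner_add_right)

text \<open>Only finitely many bases are contained in \<open>S\<close>, so some basis \<open>B\<close> generates a minimal lattice.
Every basis inside this lattice then generates all of it.  Given a basis \<open>C\<close> of the kernel of a
functional, extend it by \<open>b\<close> or by \<open>t\<close>: both extensions generate the same lattice, so the values
of the functional at \<open>b\<close> and \<open>t\<close> are integral multiples of each other.\<close>

lemma exists_minimal_lattice:
  fixes S :: "'v::euclidean_space set"
  assumes fin: "finite S"
  obtains B where "B \<subseteq> S" "independent B" "span B = span S" "unimodular (S \<inter> int_span B)"
proof -
  define BB where "BB = {B. B \<subseteq> S \<and> independent B \<and> span B = span S}"
  obtain B0 where "B0 \<subseteq> S" "independent B0" "S \<subseteq> span B0"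
    using maximal_independent_subset by blast
  then have "B0 \<in> BB" unfolding BB_def
    using span_minimal[of S "span B0"] span_mono[of B0 S] by auto
  moreover have "finite BB" using fin by (simp add: BB_def)
  ultimately obtain L where L: "L \<in> int_span ` BB" "\<And>L'. L' \<in> int_span ` BB \<Longrightarrow> L' \<subseteq> L \<Longrightarrow> L' = L"
    using finite_has_minimal[of "int_span ` BB"] by (metis empty_iff finite_imageI imageI)
  then obtain B where B: "B \<in> BB" "L = int_span B" by blast
  have finsub: "finite X" if "X \<subseteq> S" for X using that fin finite_subset by blast
  have BS: "B \<subseteq> S" "independent B" "span B = span S" using B(1) by (auto simp: BB_def)
  define S' where "S' = S \<inter> int_span B"
  have S'B: "B \<subseteq> S'" using BS finsub by (auto simp: S'_def int_span_base)
  have spanS': "span S' = span S"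
    using S'B BS(3) span_mono[of B S'] span_mono[of S' S] by (auto simp: S'_def)
  have key: "\<exists>n::int. y \<bullet> t = of_int n * (y \<bullet> b)"
    if b: "b \<in> S'" "y \<bullet> b \<noteq> 0" and gen: "S' \<subseteq> span (insert b {x\<in>S'. y \<bullet> x = 0})"
      and t: "t \<in> S'" for y b t
  proof -
    let ?K = "{x\<in>S'. y \<bullet> x = 0}"
    obtain C where C: "C \<subseteq> ?K" "independent C" "?K \<subseteq> span C"
      using maximal_independent_subset by blast
    have bC: "b \<notin> span C" using inner_zero_on_span[of b C y] C(1) b(2) by auto
    have ind: "independent (insert b C)" using C(2) bC by (simp add: independent_insert)
    have "?K \<subseteq> span (insert b C)" using C(3) span_mono[of C "insert b C"] by blast
    then have "insert b ?K \<subseteq> span (insert b C)" by (simp add: span_base)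
    then have "span (insert b ?K) \<subseteq> span (insert b C)" by (simp add: span_minimal)
    then have "S' \<subseteq> span (insert b C)" using gen by simp
    then have "span S' \<subseteq> span (insert b C)" by (simp add: span_minimal)
    moreover have sub: "insert b C \<subseteq> S'" using b C by auto
    ultimately have "insert b C \<in> BB" unfolding BB_def
      using ind spanS' span_mono[OF sub] by (auto simp: S'_def)
    moreover have "int_span (insert b C) \<subseteq> int_span B"
      using sub by (intro int_span_mono_gen) (auto simp: S'_def)
    ultimately have "int_span (insert b C) = int_span B" using L(2) B(2) by blast
    with t have "t \<in> int_span (insert b C)" by (simp add: S'_def)
    moreover have "finite C" "b \<notin> C" using C(1) bC fin finsub[of C] by (auto simp: S'_def span_base)
    ultimately obtain k z where k: "z \<in> int_span C" "t = of_int k *\<^sub>R b + z"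
      using int_span_insert by blast
    have "y \<bullet> z = 0" using k(1) int_span_subset_span[of C] C(1) inner_zero_on_span[of z C y] by auto
    then show ?thesis using k by (auto simp: inner_add_right)
  qed
  have "unimodular S'" unfolding unimodular_def
  proof (intro allI ballI impI)
    fix y b t
    assume b: "b \<in> S'" "y \<bullet> b \<noteq> 0" and gen: "S' \<subseteq> span (insert b {x\<in>S'. y \<bullet> x = 0})"
      and t: "t \<in> S'" "y \<bullet> t \<noteq> 0"
    let ?K = "{x\<in>S'. y \<bullet> x = 0}"
    obtain c where c: "t - c *\<^sub>R b \<in> span ?K" using gen t by (auto simp: span_insert)
    have "y \<bullet> (t - c *\<^sub>R b) = 0" using inner_zero_on_span[OF c] by auto
    then have c0: "c \<noteq> 0" using t(2) by (auto simp: inner_diff_right)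
    have tk: "t - c *\<^sub>R b \<in> span (insert t ?K)" using c span_mono[of ?K "insert t ?K"] by blast
    have "c *\<^sub>R b \<in> span (insert t ?K)" using span_diff[OF span_base tk, of t] by simp
    from span_scale[OF this, of "1/c"] have "b \<in> span (insert t ?K)" using c0 by simp
    then have "insert b ?K \<subseteq> span (insert t ?K)" using span_superset[of "insert t ?K"] by auto
    then have gen': "S' \<subseteq> span (insert t ?K)" using gen span_minimal subspace_span by blast
    obtain n m where nm: "y \<bullet> t = of_int n * (y \<bullet> b)" "y \<bullet> b = of_int m * (y \<bullet> t)"
      using key[OF b gen t(1)] key[OF t gen' b(1)] by blast
    then have "y \<bullet> t = of_int (n * m) * (y \<bullet> t)" by simp
    then have "real_of_int (n * m) = 1" using t(2) by (metis mult_cancel_right1)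
    then have "n * m = 1" by linarith
    then have "\<bar>n\<bar> = 1" by (metis abs_mult abs_1 zmult_eq_1_iff abs_minus_cancel)
    then have "\<bar>real_of_int n\<bar> = 1" by linarith
    then show "\<bar>y \<bullet> t\<bar> = \<bar>y \<bullet> b\<bar>" using nm(1) by (simp add: abs_mult)
  qed
  then show ?thesis using that[of B] BS by (simp add: S'_def)
qed

section \<open>Flats, relative connectedness and dual systems\<close>

definition flat :: "'v::euclidean_space set \<Rightarrow> 'v set \<Rightarrow> bool" where
  "flat S T \<longleftrightarrow> span (S \<inter> T) = T"

text \<open>Connectedness of the matroid obtained from \<open>T\<close> by contracting \<open>T0\<close>: no splitting of \<open>T\<close>
into a direct sum modulo \<open>T0\<close> respects \<open>S\<close>.  Working relative to \<open>T0\<close> replaces the passage to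
quotient spaces.\<close>

definition connected_over :: "'v::euclidean_space set \<Rightarrow> 'v set \<Rightarrow> 'v set \<Rightarrow> bool" where
  "connected_over S T0 T \<longleftrightarrow> (\<forall>T1 T2. subspace T1 \<longrightarrow> subspace T2 \<longrightarrow> T1 \<inter> T2 = T0 \<longrightarrow>
     S \<inter> T \<subseteq> T1 \<union> T2 \<longrightarrow> T \<subseteq> T1 \<or> T \<subseteq> T2)"

text \<open>A basis \<open>B \<subseteq> S\<close> of \<open>U\<close> modulo \<open>T0\<close> together with vectors \<open>z b\<close> that represent its
coordinate functionals.\<close>

definition dual_system ::
  "'v::euclidean_space set \<Rightarrow> 'v set \<Rightarrow> 'v set \<Rightarrow> 'v set \<Rightarrow> ('v \<Rightarrow> 'v) \<Rightarrow> bool" where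
  "dual_system S T0 U B z \<longleftrightarrow> finite B \<and> B \<subseteq> S \<inter> U \<and> U = span (T0 \<union> B) \<and>
     (\<forall>b\<in>B. \<forall>x\<in>T0. z b \<bullet> x = 0) \<and> (\<forall>b\<in>B. \<forall>b'\<in>B. z b \<bullet> b' = (if b = b' then 1 else 0))"

lemma flat_subspace: "flat S T \<Longrightarrow> subspace T"
  by (metis flat_def subspace_span)

lemma span_insertE:
  assumes "x \<in> span (insert a V)" "subspace V"
  obtains c y where "y \<in> V" "x = y + c *\<^sub>R a"
proof -
  from assms obtain c where "x - c *\<^sub>R a \<in> V"
    unfolding span_insert by (auto simp: span_eq_iff[THEN iffD2])
  then show ?thesis using that[of "x - c *\<^sub>R a" c] by simp
qed

text \<open>A minimal \<open>B\<close> with \<open>U\<close> in the span of \<open>T0 \<union> B\<close> is independent modulo \<open>T0\<close>; the functional \<open>z b\<close> is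
the normalized component of \<open>b\<close> orthogonal to the span of \<open>T0\<close> and the other elements.\<close>

lemma exists_dual_system:
  fixes S :: "'v::euclidean_space set"
  assumes fin: "finite S" and U: "flat S U" and T0: "subspace T0" "T0 \<subseteq> U"
  shows "\<exists>B z. dual_system S T0 U B z"
proof -
  define CC where "CC = {B. B \<subseteq> S \<inter> U \<and> U \<subseteq> span (T0 \<union> B)}"
  have "finite CC" using fin by (simp add: CC_def)
  moreover have "S \<inter> U \<in> CC" using U span_mono[of "S \<inter> U" "T0 \<union> S \<inter> U"] by (auto simp: CC_def flat_def)
  ultimately obtain B where B: "B \<in> CC" "\<And>B'. B' \<in> CC \<Longrightarrow> B' \<subseteq> B \<Longrightarrow> B' = B"
    using finite_has_minimal[of CC] by (metis empty_iff)
  have BS: "B \<subseteq> S \<inter> U" "U \<subseteq> span (T0 \<union> B)" using B(1) by (auto simp: CC_def)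
  have sU: "subspace U" using U by (rule flat_subspace)
  have Uspan: "U = span (T0 \<union> B)" using BS T0 sU span_minimal[of "T0 \<union> B" U] by auto
  have ex: "\<exists>w. w \<bullet> b = 1 \<and> (\<forall>x\<in>span (T0 \<union> (B - {b})). w \<bullet> x = 0)" if b: "b \<in> B" for b
  proof -
    have nb: "b \<notin> span (T0 \<union> (B - {b}))"
    proof
      assume "b \<in> span (T0 \<union> (B - {b}))"
      then have "T0 \<union> B \<subseteq> span (T0 \<union> (B - {b}))"
        using span_superset[of "T0 \<union> (B - {b})"] by auto
      then have "U \<subseteq> span (T0 \<union> (B - {b}))" unfolding Uspan by (simp add: span_minimal)
      then have "B - {b} \<in> CC" using BS by (auto simp: CC_def)
      then show False using B(2)[of "B - {b}"] b by auto
    qed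
    obtain y w where yw: "y \<in> span (T0 \<union> (B - {b}))"
      "\<And>x. x \<in> span (T0 \<union> (B - {b})) \<Longrightarrow> real_inner_class.orthogonal w x" "b = y + w"
      using orthogonal_subspace_decomp_exists by blast
    have "w \<noteq> 0" using nb yw by auto
    moreover have "w \<bullet> y = 0" using yw by (auto simp: real_inner_class.orthogonal_def)
    ultimately have "w \<bullet> b = w \<bullet> w" "w \<bullet> w \<noteq> 0" using yw by (auto simp: inner_add_right)
    then show ?thesis using yw(2)
      by (intro exI[of _ "w /\<^sub>R (w \<bullet> w)"]) (auto simp: real_inner_class.orthogonal_def)
  qed
  define z where "z b = (SOME w. w \<bullet> b = 1 \<and> (\<forall>x\<in>span (T0 \<union> (B - {b})). w \<bullet> x = 0))" for b
  have z: "z b \<bullet> b = 1" "\<And>x. x \<in> span (T0 \<union> (B - {b})) \<Longrightarrow> z b \<bullet> x = 0" if "b \<in> B" for b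
    using someI_ex[OF ex[OF that]] by (auto simp: z_def)
  have "finite B" using BS fin finite_subset by blast
  then have "dual_system S T0 U B z"
    unfolding dual_system_def using BS(1) Uspan z by (auto intro: span_base)
  then show ?thesis by blast
qed

lemma dual_system_expand:
  assumes D: "dual_system S T0 U B z" and T0: "subspace T0" and x: "x \<in> U"
  shows "x - (\<Sum>b\<in>B. (z b \<bullet> x) *\<^sub>R b) \<in> T0"
proof -
  have D': "finite B" "U = span (T0 \<union> B)" "\<And>b x. b \<in> B \<Longrightarrow> x \<in> T0 \<Longrightarrow> z b \<bullet> x = 0"
    "\<And>b b'. b \<in> B \<Longrightarrow> b' \<in> B \<Longrightarrow> z b \<bullet> b' = (if b = b' then 1 else 0)"
    using D unfolding dual_system_def by auto
  have "x \<in> span (T0 \<union> B)" using x D' by simp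
  then show ?thesis
  proof (induction rule: span_induct_alt)
    case base
    show ?case using T0 by (simp add: subspace_0)
  next
    case (step c x y)
    have *: "x - (\<Sum>b\<in>B. (z b \<bullet> x) *\<^sub>R b) \<in> T0"
    proof (cases "x \<in> T0")
      case True
      then show ?thesis using D'(3) by simp
    next
      case False
      then have xB: "x \<in> B" using step by auto
      have "(\<Sum>b\<in>B. (z b \<bullet> x) *\<^sub>R b) = (\<Sum>b\<in>B. if b = x then b else 0)"
        by (rule sum.cong) (auto simp: D'(4) xB)
      also have "\<dots> = x" using D'(1) xB by simp
      finally show ?thesis using T0 by (simp add: subspace_0)
    qed
    have "c *\<^sub>R x + y - (\<Sum>b\<in>B. (z b \<bullet> (c *\<^sub>R x + y)) *\<^sub>R b)
      = c *\<^sub>R (x - (\<Sum>b\<in>B. (z b \<bullet> x) *\<^sub>R b)) + (y - (\<Sum>b\<in>B. (z b \<bullet> y) *\<^sub>R b))"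
      by (simp add: inner_add_right scaleR_add_left sum.distrib scaleR_diff_right scaleR_sum_right)
    then show ?case using * step.IH T0 by (simp only: subspace_add subspace_scale)
  qed
qed

lemma dual_system_mem_span:
  assumes D: "dual_system S T0 U B z" and T0: "subspace T0" and x: "x \<in> U"
    and P: "\<And>b. b \<in> B \<Longrightarrow> b \<notin> P \<Longrightarrow> z b \<bullet> x = 0"
  shows "x \<in> span (T0 \<union> P)"
proof -
  have "x - (\<Sum>b\<in>B. (z b \<bullet> x) *\<^sub>R b) \<in> span (T0 \<union> P)"
    using dual_system_expand[OF D T0 x] by (simp add: span_base)
  moreover have "(\<Sum>b\<in>B. (z b \<bullet> x) *\<^sub>R b) \<in> span (T0 \<union> P)"
  proof (rule span_sum)
    fix b assume "b \<in> B"
    then show "(z b \<bullet> x) *\<^sub>R b \<in> span (T0 \<union> P)"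
      using P[of b] by (cases "b \<in> P") (auto intro: span_scale span_base span_zero)
  qed
  ultimately show ?thesis using span_add by fastforce
qed

lemma dual_system_kills:
  assumes D: "dual_system S T0 U B z" and "i \<in> B" "i \<notin> P" "P \<subseteq> B" and x: "x \<in> span (T0 \<union> P)"
  shows "z i \<bullet> x = 0"
proof (rule inner_zero_on_span[OF x])
  have D': "\<forall>x\<in>T0. z i \<bullet> x = 0" "\<forall>b'\<in>B. z i \<bullet> b' = (if i = b' then 1 else 0)"
    using D \<open>i \<in> B\<close> unfolding dual_system_def by blast+
  fix k assume "k \<in> T0 \<union> P"
  then consider "k \<in> T0" | "k \<in> B" "k \<noteq> i" using assms(3,4) by blast
  then show "z i \<bullet> k = 0" using D' by cases auto
qed

text \<open>Steinitz exchange.  A coordinate functional \<open>z m\<close> with \<open>z m \<bullet> x = 0\<close> is not changed at all; the walk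
argument below depends on this.\<close>

lemma dual_system_exchange:
  fixes z :: "'v::euclidean_space \<Rightarrow> 'v"
  assumes D: "dual_system S T0 U B z" and T0: "subspace T0" "T0 \<subseteq> U" and U: "subspace U"
    and j: "j \<in> B" and x: "x \<in> S \<inter> U" "z j \<bullet> x \<noteq> 0"
  shows "dual_system S T0 U (insert x (B - {j}))
    (\<lambda>m. if m = x then z j /\<^sub>R (z j \<bullet> x) else z m - ((z m \<bullet> x) / (z j \<bullet> x)) *\<^sub>R z j)"
    "x \<notin> B - {j}"
proof -
  have D': "finite B" "B \<subseteq> S \<inter> U" "U = span (T0 \<union> B)" "\<And>b x. b \<in> B \<Longrightarrow> x \<in> T0 \<Longrightarrow> z b \<bullet> x = 0"
    "\<And>b b'. b \<in> B \<Longrightarrow> b' \<in> B \<Longrightarrow> z b \<bullet> b' = (if b = b' then 1 else 0)"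
    using D unfolding dual_system_def by auto
  show xB: "x \<notin> B - {j}"
  proof
    assume "x \<in> B - {j}"
    then have "z j \<bullet> x = 0" using D'(5)[of j x] j by auto
    then show False using x(2) by simp
  qed
  have "j \<in> span (T0 \<union> insert x (B - {j}))"
  proof -
    let ?W = "span (T0 \<union> insert x (B - {j}))"
    have e: "x - (\<Sum>b\<in>B. (z b \<bullet> x) *\<^sub>R b) \<in> ?W"
      using dual_system_expand[OF D T0(1)] x by (simp add: span_base)
    have sum: "(\<Sum>b\<in>B. (z b \<bullet> x) *\<^sub>R b) = (z j \<bullet> x) *\<^sub>R j + (\<Sum>b\<in>B-{j}. (z b \<bullet> x) *\<^sub>R b)"
      using D'(1) j by (rule sum.remove)
    have r: "(\<Sum>b\<in>B-{j}. (z b \<bullet> x) *\<^sub>R b) \<in> ?W"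
      by (intro span_sum span_scale span_base) auto
    have "x \<in> ?W" by (intro span_base) auto
    from span_diff[OF span_diff[OF this e] r]
    have "(z j \<bullet> x) *\<^sub>R j \<in> ?W" by (simp add: sum)
    from span_scale[OF this, of "1 / (z j \<bullet> x)"] show ?thesis using x by simp
  qed
  then have "T0 \<union> B \<subseteq> span (T0 \<union> insert x (B - {j}))"
    using span_superset[of "T0 \<union> insert x (B - {j})"] by auto
  then have "U \<subseteq> span (T0 \<union> insert x (B - {j}))" unfolding D'(3) by (simp add: span_minimal)
  moreover have "span (T0 \<union> insert x (B - {j})) \<subseteq> U"
    using T0 U x D'(2) by (intro span_minimal) auto
  ultimately have "U = span (T0 \<union> insert x (B - {j}))" by blast
  moreover have "(if m = x then z j /\<^sub>R (z j \<bullet> x) else z m - ((z m \<bullet> x) / (z j \<bullet> x)) *\<^sub>R z j) \<bullet> m'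
     = (if m = m' then 1 else 0)" if "m \<in> insert x (B - {j})" "m' \<in> insert x (B - {j})" for m m'
    using that D'(5) j x(2) xB by (auto simp: inner_diff_left)
  moreover have "(if m = x then z j /\<^sub>R (z j \<bullet> x) else z m - ((z m \<bullet> x) / (z j \<bullet> x)) *\<^sub>R z j) \<bullet> y = 0"
    if "m \<in> insert x (B - {j})" "y \<in> T0" for m y
    using that D'(4) j by (auto simp: inner_diff_left)
  ultimately show "dual_system S T0 U (insert x (B - {j}))
    (\<lambda>m. if m = x then z j /\<^sub>R (z j \<bullet> x) else z m - ((z m \<bullet> x) / (z j \<bullet> x)) *\<^sub>R z j)"
    unfolding dual_system_def using D'(1,2) x by (auto split del: if_split)
qed

section \<open>Minimal fibres over a connected hyperplane\<close>

text \<open>\<open>U\<close> is a hyperplane with normal vector \<open>v\<close>.  By unimodularity \<open>v\<close> has a single nonzero absolute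
value on \<open>S\<close>; up to sign, the elements of \<open>S\<close> outside \<open>U\<close> form the set \<open>upper\<close> below once this value is
normalized to one.\<close>

locale unimodular_hyperplane =
  fixes S T0 U :: "'v::euclidean_space set" and v :: 'v
  assumes fin: "finite S" and symm: "\<And>s. s \<in> S \<Longrightarrow> - s \<in> S" and uni: "unimodular S"
    and T0: "flat S T0" "T0 \<subseteq> U" and U: "flat S U"
    and v: "\<And>x. x \<in> U \<Longrightarrow> v \<bullet> x = 0"
    and gen: "\<And>s. s \<in> S \<Longrightarrow> v \<bullet> s \<noteq> 0 \<Longrightarrow> S \<subseteq> span (insert s U)"
begin

definition upper where "upper = {s\<in>S. v \<bullet> s = 1}"

abbreviation "dual \<equiv> dual_system S T0 U"

lemma finite_upper: "finite upper"
  using fin by (simp add: upper_def)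

text \<open>The functional \<open>z b - (z b \<bullet> s) v\<close> vanishes on the hyperplane spanned by \<open>T0\<close>, the other basis
elements and \<open>s\<close>, and it is one at \<open>b\<close>.\<close>

lemma coordinate_unimodular:
  assumes D: "dual B z" and b: "b \<in> B" and s: "s \<in> upper" and t: "t \<in> S"
  shows "z b \<bullet> t - (z b \<bullet> s) * (v \<bullet> t) \<in> {-1, 0, 1}"
proof -
  have D': "finite B" "B \<subseteq> S \<inter> U" "U = span (T0 \<union> B)" "\<And>b x. b \<in> B \<Longrightarrow> x \<in> T0 \<Longrightarrow> z b \<bullet> x = 0"
    "\<And>b b'. b \<in> B \<Longrightarrow> b' \<in> B \<Longrightarrow> z b \<bullet> b' = (if b = b' then 1 else 0)"
    using D unfolding dual_system_def by auto
  define y where "y = z b - (z b \<bullet> s) *\<^sub>R v"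
  let ?K = "{x\<in>S. y \<bullet> x = 0}"
  have yt: "y \<bullet> x = z b \<bullet> x - (z b \<bullet> s) * (v \<bullet> x)" for x by (simp add: y_def inner_diff_left)
  have yb: "y \<bullet> b = 1" using D'(2,5) b v by (auto simp: yt)
  have "S \<inter> T0 \<subseteq> ?K" using D'(4)[OF b] T0(2) v by (auto simp: yt)
  then have "T0 \<subseteq> span ?K" using T0(1) span_mono unfolding flat_def by blast
  then have "T0 \<subseteq> span (insert b ?K)" using span_mono[of ?K "insert b ?K"] by blast
  moreover have "B \<subseteq> insert b ?K" using D'(2,5) b v by (auto simp: yt)
  then have "B \<subseteq> span (insert b ?K)" using span_superset by blast
  ultimately have "U \<subseteq> span (insert b ?K)" unfolding D'(3) by (simp add: span_minimal)
  moreover have "s \<in> ?K" using s by (simp add: upper_def yt)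
  then have "s \<in> span (insert b ?K)" by (simp add: span_base)
  ultimately have "span (insert s U) \<subseteq> span (insert b ?K)" by (simp add: span_minimal)
  then have "S \<subseteq> span (insert b ?K)" using gen[of s] s by (auto simp: upper_def)
  then have "y \<bullet> t \<noteq> 0 \<Longrightarrow> \<bar>y \<bullet> t\<bar> = \<bar>y \<bullet> b\<bar>"
    using uni[unfolded unimodular_def, rule_format, of b y t] b D'(2) yb t by auto
  then have "y \<bullet> t = 0 \<or> \<bar>y \<bullet> t\<bar> = 1" using yb by auto
  then have "y \<bullet> t \<in> {-1, 0, 1}" by (auto simp: abs_if split: if_splits)
  then show ?thesis unfolding yt .
qed

lemma coordinate_upper:
  assumes "dual B z" "b \<in> B" "s \<in> upper" "t \<in> upper"
  shows "z b \<bullet> t - z b \<bullet> s \<in> {-1, 0, 1}"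
  using coordinate_unimodular[OF assms(1-3), of t] assms(4) by (simp add: upper_def)

lemma coordinate_hyperplane:
  assumes "dual B z" "b \<in> B" "s \<in> upper" "x \<in> S \<inter> U"
  shows "z b \<bullet> x \<in> {-1, 0, 1}"
  using coordinate_unimodular[OF assms(1-3), of x] assms(4) v by simp

definition fibre where "fibre y s = {t\<in>upper. y \<bullet> t = y \<bullet> s}"

text \<open>The competing fibres are those of all coordinate functionals of all dual systems, so minimality
survives an exchange.\<close>

definition minimal_fibre where
  "minimal_fibre y s \<longleftrightarrow> s \<in> upper \<and> (\<exists>B z b. dual B z \<and> b \<in> B \<and> z b = y) \<and>
     (\<forall>B z. dual B z \<longrightarrow> (\<forall>b\<in>B. \<forall>t\<in>upper. card (fibre y s) \<le> card (fibre (z b) t)))"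

text \<open>Adjacency in the fundamental graph of a basis: \<open>U\<close> is connected over \<open>T0\<close> only if this graph is.\<close>

definition linked where "linked z i j \<longleftrightarrow> (\<exists>x\<in>S \<inter> U. z i \<bullet> x \<noteq> 0 \<and> z j \<bullet> x \<noteq> 0)"

definition constant_on_fibre where
  "constant_on_fibre y s w \<longleftrightarrow> (\<forall>t\<in>fibre y s. w \<bullet> t = w \<bullet> s)"

text \<open>If \<open>x\<close> links \<open>b\<close> and \<open>j\<close>, then exchanging \<open>b\<close> for \<open>x\<close> turns \<open>z j\<close> into
\<open>z j - e (z b)\<close> with \<open>e = \<plusminus>1\<close>, and the differences of all three functionals on \<open>upper\<close> lie in
\<open>{-1, 0, 1}\<close>.  If \<open>z j\<close> took two values on the minimal fibre, then by minimality both values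
would also occur outside of it, and the four resulting combinations of values of \<open>z b\<close> and \<open>z j\<close>
violate the bound for \<open>z j - e (z b)\<close>.\<close>

lemma linked_constant:
  assumes D: "dual B z" and b: "b \<in> B" and min: "minimal_fibre (z b) s"
    and j: "j \<in> B" and l: "linked z b j"
  shows "constant_on_fibre (z b) s (z j)"
proof (rule ccontr)
  assume nc: "\<not> ?thesis"
  have s: "s \<in> upper" using min by (simp add: minimal_fibre_def)
  have sf: "s \<in> fibre (z b) s" using s by (simp add: fibre_def)
  from nc obtain t where t: "t \<in> fibre (z b) s" "z j \<bullet> t \<noteq> z j \<bullet> s" by (auto simp: constant_on_fibre_def)
  have tu: "t \<in> upper" using t by (simp add: fibre_def)
  obtain b1 b2 where b12: "b1 \<in> fibre (z b) s" "b2 \<in> fibre (z b) s" "z j \<bullet> b2 = z j \<bullet> b1 + 1"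
  proof (cases "z j \<bullet> t - z j \<bullet> s = 1")
    case True then show ?thesis using that[of s t] t sf by simp
  next
    case False
    then have "z j \<bullet> t - z j \<bullet> s = -1" using coordinate_upper[OF D j s tu] t(2) by auto
    then show ?thesis using that[of t s] t sf by simp
  qed
  have u12: "b1 \<in> upper" "b2 \<in> upper" and y12: "z b \<bullet> b1 = z b \<bullet> s" "z b \<bullet> b2 = z b \<bullet> s"
    using b12 by (auto simp: fibre_def)
  have jb: "j \<noteq> b" using y12 b12(3) by auto
  \<comment> \<open>Otherwise the fibre of z j through c would be properly contained in the minimal fibre.\<close>
  have out: "\<exists>t\<in>upper. z j \<bullet> t = z j \<bullet> c \<and> z b \<bullet> t \<noteq> z b \<bullet> s"
    if c: "c \<in> upper" and c': "c' \<in> fibre (z b) s" "z j \<bullet> c' \<noteq> z j \<bullet> c" for c c'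
  proof (rule ccontr)
    assume "\<not> ?thesis"
    then have "fibre (z j) c \<subset> fibre (z b) s" using c' by (auto simp: fibre_def)
    then have "card (fibre (z j) c) < card (fibre (z b) s)"
      using finite_upper by (intro psubset_card_mono) (auto simp: fibre_def)
    moreover have "card (fibre (z b) s) \<le> card (fibre (z j) c)"
      using min D j c unfolding minimal_fibre_def by blast
    ultimately show False by simp
  qed
  obtain t1 where t1: "t1 \<in> upper" "z j \<bullet> t1 = z j \<bullet> b1" "z b \<bullet> t1 \<noteq> z b \<bullet> s"
    using out[OF u12(1) b12(2)] b12(3) by auto
  obtain t2 where t2: "t2 \<in> upper" "z j \<bullet> t2 = z j \<bullet> b2" "z b \<bullet> t2 \<noteq> z b \<bullet> s"
    using out[OF u12(2) b12(1)] b12(3) by auto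
  obtain x where x: "x \<in> S \<inter> U" "z b \<bullet> x \<noteq> 0" "z j \<bullet> x \<noteq> 0" using l by (auto simp: linked_def)
  define e where "e = (z j \<bullet> x) / (z b \<bullet> x)"
  have e: "e = 1 \<or> e = -1"
    using coordinate_hyperplane[OF D b s x(1)] coordinate_hyperplane[OF D j s x(1)] x
    by (auto simp: e_def)
  note D2 = dual_system_exchange[OF D flat_subspace[OF T0(1)] T0(2) flat_subspace[OF U] b x(1,2)]
  have jx: "j \<noteq> x" using D2(2) j jb by auto
  have j2: "j \<in> insert x (B - {b})" using j jb by auto
  have *: "(z j \<bullet> p - e * (z b \<bullet> p)) - (z j \<bullet> q - e * (z b \<bullet> q)) \<in> {-1,0,1}"
    if "p \<in> upper" "q \<in> upper" for p q
    using coordinate_upper[OF D2(1) j2 that(2,1)] jx by (simp add: e_def inner_diff_left)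
  have y1: "z b \<bullet> t1 - z b \<bullet> s \<in> {-1,1}" using coordinate_upper[OF D b s t1(1)] t1(3) by auto
  have y2: "z b \<bullet> t2 - z b \<bullet> s \<in> {-1,1}" using coordinate_upper[OF D b s t2(1)] t2(3) by auto
  have y3: "z b \<bullet> t2 - z b \<bullet> t1 \<in> {-1,0,1}" using coordinate_upper[OF D b t1(1) t2(1)] by auto
  have "- 1 - e * (z b \<bullet> t1 - z b \<bullet> s) \<in> {-1, 0, 1}"
    using *[OF t1(1) u12(2)] unfolding t1(2) y12 b12(3) by (simp add: algebra_simps)
  moreover have "1 - e * (z b \<bullet> t2 - z b \<bullet> s) \<in> {-1, 0, 1}"
    using *[OF t2(1) u12(1)] unfolding t2(2) y12 b12(3) by (simp add: algebra_simps)
  ultimately have "e * (z b \<bullet> t1 - z b \<bullet> s) \<le> 0" "e * (z b \<bullet> t2 - z b \<bullet> s) \<ge> 0" by auto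
  moreover have "z b \<bullet> t2 - z b \<bullet> s = z b \<bullet> t1 - z b \<bullet> s"
    using y1 y2 y3 by auto
  ultimately have "e * (z b \<bullet> t1 - z b \<bullet> s) = 0" by simp
  then show False using e y1 by auto
qed

text \<open>Consider a shortest walk from \<open>p 0\<close> to an index \<open>j\<close> at which the functional is not constant, over
all dual systems that contain the given cutting functional.  By \<open>linked_constant\<close> its length is at
least two.  Let \<open>l\<close> be the last index before \<open>j\<close> and let \<open>x\<close> link them.  Exchanging \<open>j\<close> for \<open>x\<close> adds a
nonzero multiple of \<open>z j\<close> to \<open>z l\<close>, which is constant on the fibre, and leaves the functionals earlier on the walk
unchanged.  So in the new system already \<open>l\<close> is not constant, at the end of a shorter walk.\<close>

lemma walk_constant:
  assumes "dual B z" "p 0 \<in> B" "minimal_fibre (z (p 0)) s"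
    "\<And>k. k \<le> n \<Longrightarrow> p k \<in> B" "\<And>k. k < n \<Longrightarrow> linked z (p k) (p (Suc k))"
  shows "constant_on_fibre (z (p 0)) s (z (p n))"
  using assms
proof (induction n arbitrary: B z p rule: less_induct)
  case (less n)
  note D = less.prems(1) and min = less.prems(3) and pB = less.prems(4) and lk = less.prems(5)
  let ?y = "z (p 0)"
  have s: "s \<in> upper" using min by (simp add: minimal_fibre_def)
  have IH: "constant_on_fibre ?y s (z (q m))"
    if "m < n" "q 0 = p 0" "\<And>k. k \<le> m \<Longrightarrow> q k \<in> B" "\<And>k. k < m \<Longrightarrow> linked z (q k) (q (Suc k))" for q m
    using less.IH[OF that(1) D, of q] that min pB[of 0] by simp
  consider "n = 0" | "n = 1" | "n \<ge> 2" by linarith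
  then show ?case
  proof cases
    case 1
    then show ?thesis by (simp add: constant_on_fibre_def fibre_def)
  next
    case 2
    then show ?thesis using linked_constant[OF D pB[of 0] min pB[of 1]] lk[of 0] by simp
  next
    case 3
    show ?thesis
    proof (rule ccontr)
      assume nc: "\<not> ?thesis"
      define j where "j = p n"
      define l where "l = p (n - 1)"
      have jB: "j \<in> B" and lB: "l \<in> B" using pB by (auto simp: j_def l_def)
      have const: "constant_on_fibre ?y s (z (p k))" if "k < n" for k
        using IH[of k p] that pB lk by simp
      \<comment> \<open>A link from an earlier index would give a shorter walk to j.\<close>
      have noshort: "\<not> linked z (p k) j" if k: "k < n - 1" for k
      proof
        assume lkj: "linked z (p k) j"
        have "constant_on_fibre ?y s (z ((\<lambda>i. if i \<le> k then p i else j) (Suc k)))"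
          using k pB lk lkj jB by (intro IH) (auto simp: le_Suc_eq less_Suc_eq)
        then show False using nc by (simp add: j_def)
      qed
      have "linked z l j" using lk[of "n-1"] 3 by (simp add: l_def j_def)
      then obtain x where x: "x \<in> S \<inter> U" "z l \<bullet> x \<noteq> 0" "z j \<bullet> x \<noteq> 0" by (auto simp: linked_def)
      have zx: "z (p k) \<bullet> x = 0" if "k < n - 1" for k
        using noshort[OF that] x by (auto simp: linked_def)
      note D2 = dual_system_exchange[OF D flat_subspace[OF T0(1)] T0(2) flat_subspace[OF U] jB x(1,3)]
      define z' where "z' = (\<lambda>m. if m = x then z j /\<^sub>R (z j \<bullet> x)
         else z m - ((z m \<bullet> x) / (z j \<bullet> x)) *\<^sub>R z j)"
      define B' where "B' = insert x (B - {j})"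
      have D': "dual B' z'" using D2(1) by (simp add: z'_def B'_def)
      have pj: "p k \<noteq> j" if "k < n" for k using const[OF that] nc by (auto simp: j_def)
      have pB': "p k \<in> B'" if "k \<le> n - 1" for k using pB[of k] pj[of k] that 3 by (auto simp: B'_def)
      have px: "p k \<noteq> x" if "k < n" for k using D2(2) pB[of k] pj[of k] that by auto
      have z'p: "z' (p k) = z (p k)" if "k < n - 1" for k
        using zx[OF that] px[of k] that by (simp add: z'_def)
      have z'l: "z' l = z l - ((z l \<bullet> x) / (z j \<bullet> x)) *\<^sub>R z j"
        using px[of "n-1"] 3 by (simp add: z'_def l_def)
      have lk': "linked z' (p k) (p (Suc k))" if k: "k < n - 1" for k
      proof -
        obtain w where w: "w \<in> S \<inter> U" "z (p k) \<bullet> w \<noteq> 0" "z (p (Suc k)) \<bullet> w \<noteq> 0"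
          using lk[of k] k unfolding linked_def by (metis diff_le_self less_le_trans)
        have "z j \<bullet> w = 0" using noshort[OF k] w by (auto simp: linked_def)
        then have "z' (p (Suc k)) \<bullet> w \<noteq> 0"
          using w(3) px[of "Suc k"] k by (simp add: z'_def inner_diff_left)
        then show ?thesis using w z'p[OF k] by (auto simp: linked_def)
      qed
      have "constant_on_fibre (z' (p 0)) s (z' (p (n - 1)))"
        using less.IH[OF _ D', of "n-1" p] 3 pB' lk' min z'p[of 0] by simp
      then have cl': "constant_on_fibre ?y s (z' l)" using z'p[of 0] 3 by (simp add: l_def)
      have cl: "constant_on_fibre ?y s (z l)" using const[of "n-1"] 3 by (simp add: l_def)
      have "constant_on_fibre ?y s (z j)" unfolding constant_on_fibre_def
      proof
        fix t assume t: "t \<in> fibre ?y s"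
        have "z' l \<bullet> t = z' l \<bullet> s" "z l \<bullet> t = z l \<bullet> s"
          using cl cl' t by (auto simp: constant_on_fibre_def)
        then have "(z l \<bullet> x) / (z j \<bullet> x) * (z j \<bullet> t) = (z l \<bullet> x) / (z j \<bullet> x) * (z j \<bullet> s)"
          by (simp add: z'l inner_diff_left)
        then show "z j \<bullet> t = z j \<bullet> s" using x by simp
      qed
      then show False using nc by (simp add: j_def)
    qed
  qed
qed

lemma exists_minimal_fibre:
  assumes "dual B z" "b \<in> B" "upper \<noteq> {}"
  shows "\<exists>y s. minimal_fibre y s"
proof -
  define P where "P = (\<lambda>(y, s). s \<in> upper \<and> (\<exists>B z b. dual B z \<and> b \<in> B \<and> z b = y))"
  obtain s where "s \<in> upper" using assms by blast
  then have "P (z b, s)" using assms by (auto simp: P_def)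
  then obtain ys where "P ys" "\<And>ys'. P ys' \<Longrightarrow> card (fibre (fst ys) (snd ys)) \<le> card (fibre (fst ys') (snd ys'))"
    using ex_has_least_nat[of P "(z b, s)" "\<lambda>ys. card (fibre (fst ys) (snd ys))"] by blast
  moreover obtain y s where "ys = (y, s)" by force
  ultimately have "minimal_fibre y s"
    unfolding minimal_fibre_def P_def by fastforce
  then show ?thesis by blast
qed

text \<open>The indices reachable from \<open>b\<close> and the remaining ones split \<open>U\<close> modulo \<open>T0\<close>; connectedness makes all
indices reachable.\<close>

lemma fibre_constant_if_connected:
  assumes con: "connected_over S T0 U"
    and D: "dual B z" and b: "b \<in> B" and min: "minimal_fibre (z b) s" and j: "j \<in> B"
  shows "constant_on_fibre (z b) s (z j)"
proof -
  define R where "R i \<longleftrightarrow> (\<exists>p n. p 0 = b \<and> p n = i \<and> (\<forall>k\<le>n. p k \<in> B) \<and>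
    (\<forall>k<n. linked z (p k) (p (Suc k))))" for i
  define P where "P = {i\<in>B. R i}"
  have D': "finite B" "B \<subseteq> S \<inter> U" "U = span (T0 \<union> B)" "\<And>b x. b \<in> B \<Longrightarrow> x \<in> T0 \<Longrightarrow> z b \<bullet> x = 0"
    "\<And>b b'. b \<in> B \<Longrightarrow> b' \<in> B \<Longrightarrow> z b \<bullet> b' = (if b = b' then 1 else 0)"
    using D unfolding dual_system_def by auto
  note sT0 = flat_subspace[OF T0(1)]
  have bP: "b \<in> P" unfolding P_def R_def using b by (auto intro!: exI[of _ "\<lambda>_. b"] exI[of _ 0])
  have step: "m \<in> P" if i: "i \<in> P" "m \<in> B" "linked z i m" for i m
  proof -
    obtain p n where p: "p 0 = b" "p n = i" "\<forall>k\<le>n. p k \<in> B" "\<forall>k<n. linked z (p k) (p (Suc k))"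
      using i(1) by (auto simp: P_def R_def)
    have "R m" unfolding R_def
      using p i by (intro exI[of _ "\<lambda>k. if k \<le> n then p k else m"] exI[of _ "Suc n"])
        (auto simp: less_Suc_eq)
    then show ?thesis using i by (simp add: P_def)
  qed
  define T1 where "T1 = span (T0 \<union> P)"
  define T2 where "T2 = span (T0 \<union> (B - P))"
  have z1: "z i \<bullet> x = 0" if "i \<in> B - P" "x \<in> T1" for i x
    using dual_system_kills[OF D, of i P x] that by (auto simp: T1_def P_def)
  have z2: "z i \<bullet> x = 0" if "i \<in> P" "x \<in> T2" for i x
    using dual_system_kills[OF D, of i "B - P" x] that by (auto simp: T2_def P_def)
  have PB: "P \<subseteq> B" by (auto simp: P_def)
  have T1U: "T1 \<subseteq> U" unfolding T1_def D'(3) using PB by (intro span_mono) auto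
  have "T1 \<inter> T2 = T0"
  proof
    show "T1 \<inter> T2 \<subseteq> T0"
    proof
      fix x assume x: "x \<in> T1 \<inter> T2"
      have "z i \<bullet> x = 0" if "i \<in> B" for i
        using z1[of i x] z2[of i x] x that by (cases "i \<in> P") auto
      then have "x \<in> span (T0 \<union> {})"
        using x T1U by (intro dual_system_mem_span[OF D sT0]) auto
      then show "x \<in> T0" using sT0 by (simp add: span_eq_iff[THEN iffD2])
    qed
    show "T0 \<subseteq> T1 \<inter> T2" by (auto simp: T1_def T2_def intro: span_base)
  qed
  moreover have "S \<inter> U \<subseteq> T1 \<union> T2"
  proof
    fix x assume x: "x \<in> S \<inter> U"
    show "x \<in> T1 \<union> T2"
    proof (cases "\<exists>i\<in>P. z i \<bullet> x \<noteq> 0")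
      case True
      then obtain i where i: "i \<in> P" "z i \<bullet> x \<noteq> 0" by blast
      have "z m \<bullet> x = 0" if "m \<in> B" "m \<notin> P" for m
        using step[OF i(1) that(1)] that x i by (auto simp: linked_def)
      then have "x \<in> T1" unfolding T1_def using x by (intro dual_system_mem_span[OF D sT0]) auto
      then show ?thesis by simp
    next
      case False
      then have "x \<in> T2" unfolding T2_def using x by (intro dual_system_mem_span[OF D sT0]) auto
      then show ?thesis by simp
    qed
  qed
  ultimately have "U \<subseteq> T1 \<or> U \<subseteq> T2"
    using con unfolding connected_over_def T1_def T2_def by (meson subspace_span)
  moreover have "\<not> U \<subseteq> T2" using z2[OF bP, of b] D'(2,5) b by auto
  ultimately have "U \<subseteq> T1" by blast
  then have "j \<in> T1" using D'(2) j by auto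
  then have "j \<in> P" using z1[of j j] D'(5)[OF j j] j by auto
  then show ?thesis using walk_constant[OF D, of _ s] min b by (auto simp: P_def R_def)
qed

text \<open>The flat \<open>F\<close> is the kernel in \<open>U\<close> of a functional with a minimal fibre, and \<open>q\<close> is any element of that
fibre.  Another element of \<open>S\<close> in the span of \<open>q\<close> and \<open>F\<close> that is not in \<open>F\<close> belongs, up to sign, to the
same fibre.  All coordinates agree on it, so it differs from \<open>q\<close> by an element of \<open>T0\<close>.\<close>

lemma isolated_element:
  assumes con: "connected_over S T0 U" and TU: "T0 \<noteq> U" and ne: "upper \<noteq> {}"
  shows "\<exists>F q. flat S F \<and> T0 \<subseteq> F \<and> dim F + 1 = dim U \<and> q \<in> S - F \<and>
    S \<inter> span (insert q F) \<subseteq> F \<union> span (insert q T0)"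
proof -
  note sT0 = flat_subspace[OF T0(1)]
  obtain B0 z0 where D0: "dual B0 z0" using exists_dual_system[OF fin U sT0 T0(2)] by blast
  have "B0 \<noteq> {}" using D0 TU sT0 by (auto simp: dual_system_def span_eq_iff[THEN iffD2])
  then obtain y s where min': "minimal_fibre y s" using exists_minimal_fibre[OF D0 _ ne] by blast
  then obtain B z b where D: "dual B z" and b: "b \<in> B" "z b = y" by (auto simp: minimal_fibre_def)
  have min: "minimal_fibre (z b) s" using min' b by simp
  have s: "s \<in> upper" using min by (simp add: minimal_fibre_def)
  have D': "finite B" "B \<subseteq> S \<inter> U" "U = span (T0 \<union> B)" "\<And>b x. b \<in> B \<Longrightarrow> x \<in> T0 \<Longrightarrow> z b \<bullet> x = 0"
    "\<And>b b'. b \<in> B \<Longrightarrow> b' \<in> B \<Longrightarrow> z b \<bullet> b' = (if b = b' then 1 else 0)"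
    using D unfolding dual_system_def by auto
  define F where "F = span (T0 \<union> (B - {b}))"
  have sF: "subspace F" by (simp add: F_def)
  have FU: "F \<subseteq> U" unfolding F_def D'(3) by (intro span_mono) auto
  have zF: "z b \<bullet> x = 0" if "x \<in> F" for x
    using dual_system_kills[OF D, of b "B - {b}" x] that b(1) by (auto simp: F_def)
  have bF: "b \<notin> F" using zF[of b] D'(5) b by auto
  have "flat S F"
  proof -
    have "S \<inter> T0 \<subseteq> S \<inter> F" by (auto simp: F_def intro: span_base)
    then have "T0 \<subseteq> span (S \<inter> F)" using T0(1) span_mono unfolding flat_def by blast
    moreover have "B - {b} \<subseteq> S \<inter> F" using D'(2) by (auto simp: F_def intro: span_base)
    then have "B - {b} \<subseteq> span (S \<inter> F)" using span_superset by blast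
    ultimately have "F \<subseteq> span (S \<inter> F)" unfolding F_def by (simp add: span_minimal)
    then show ?thesis using span_minimal[of "S \<inter> F" F] sF by (auto simp: flat_def)
  qed
  moreover have T0F: "T0 \<subseteq> F" by (auto simp: F_def intro: span_base)
  moreover have "dim F + 1 = dim U"
  proof -
    have "U = span (insert b F)"
    proof
      have "T0 \<union> B \<subseteq> insert b F" by (auto simp: F_def intro: span_base)
      then show "U \<subseteq> span (insert b F)" unfolding D'(3) by (rule span_mono)
      show "span (insert b F) \<subseteq> U" using FU D'(2) b flat_subspace[OF U] by (intro span_minimal) auto
    qed
    then show ?thesis using bF sF by (simp add: dim_insert span_eq_iff[THEN iffD2])
  qed
  moreover have vs: "v \<bullet> s = 1" "s \<in> S" using s by (auto simp: upper_def)
  have "s \<in> S - F" using vs v FU by force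
  moreover have "S \<inter> span (insert s F) \<subseteq> F \<union> span (insert s T0)"
  proof
    fix t assume t: "t \<in> S \<inter> span (insert s F)"
    then obtain c f where f: "f \<in> F" "t = f + c *\<^sub>R s" using span_insertE[OF _ sF] by blast
    have vt: "v \<bullet> t = c" using f FU v vs by (auto simp: inner_add_right)
    show "t \<in> F \<union> span (insert s T0)"
    proof (cases "c = 0")
      case True
      then show ?thesis using f by simp
    next
      case False
      have c1: "\<bar>c\<bar> = 1"
      proof -
        have "S \<subseteq> span (insert s U)" using gen vs by simp
        moreover have "S \<inter> U \<subseteq> {x\<in>S. v \<bullet> x = 0}" using v by auto
        then have "U \<subseteq> span {x\<in>S. v \<bullet> x = 0}" using U span_mono unfolding flat_def by blast
        then have "insert s U \<subseteq> span (insert s {x\<in>S. v \<bullet> x = 0})"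
          using span_mono[of "{x\<in>S. v \<bullet> x = 0}" "insert s {x\<in>S. v \<bullet> x = 0}"] span_base[of s] by blast
        then have "span (insert s U) \<subseteq> span (insert s {x\<in>S. v \<bullet> x = 0})" by (simp add: span_minimal)
        ultimately have "S \<subseteq> span (insert s {x\<in>S. v \<bullet> x = 0})" by blast
        then have "\<bar>v \<bullet> t\<bar> = \<bar>v \<bullet> s\<bar>"
          using uni[unfolded unimodular_def, rule_format, of s v t] vs vt False t by auto
        then show ?thesis using vt vs by simp
      qed
      define t' where "t' = c *\<^sub>R t"
      have cc: "c * c = 1" using c1 by (metis abs_mult_self_eq mult_1)
      have "t' \<in> S" using c1 t symm unfolding t'_def by (cases "c = 1") (auto simp: abs_if split: if_splits)
      then have t'u: "t' \<in> upper" using vt cc by (simp add: upper_def t'_def)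
      have t's: "t' - s = c *\<^sub>R f" using f cc by (simp add: t'_def scaleR_add_right)
      then have "z b \<bullet> t' = z b \<bullet> s" using zF[OF f(1)]
        by (metis inner_diff_right inner_scaleR_right mult_zero_right right_minus_eq)
      then have t'f: "t' \<in> fibre (z b) s" using t'u by (simp add: fibre_def)
      have "z j \<bullet> (t' - s) = 0" if "j \<in> B" for j
        using fibre_constant_if_connected[OF con D b(1) min that] t'f
        by (simp add: constant_on_fibre_def inner_diff_right)
      moreover have "t' - s \<in> U" unfolding t's using f FU flat_subspace[OF U] by (auto intro: subspace_scale)
      ultimately have "t' - s \<in> span (T0 \<union> {})" by (intro dual_system_mem_span[OF D sT0]) auto
      then have "c *\<^sub>R f \<in> T0" using sT0 t's by (simp add: span_eq_iff[THEN iffD2])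
      then have "(1/c) *\<^sub>R (c *\<^sub>R f) \<in> T0" by (rule subspace_scale[OF sT0])
      then have "f \<in> T0" using False by simp
      then have "t \<in> span (insert s T0)" unfolding f(2) by (intro span_add span_scale span_base) auto
      then show ?thesis by simp
    qed
  qed
  ultimately show ?thesis by blast
qed

end

section \<open>Flats with an isolated element\<close>

text \<open>In a splitting of the enlarged flat the connected part \<open>T\<close> lies on one side, so that only
the line through \<open>q\<close> is left for the other side.\<close>

lemma connected_plus_isolated:
  fixes q :: "'v::euclidean_space"
  assumes con: "connected_over S T0 T" and T: "subspace T" "T0 \<subseteq> T" and q: "q \<in> S" "q \<notin> T"
    and ncon: "\<not> connected_over S T0 (span (insert q T))"
  shows "S \<inter> span (insert q T) \<subseteq> T \<union> span (insert q T0)"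
proof -
  let ?W = "span (insert q T)"
  have TW: "T \<subseteq> ?W" by (auto intro: span_base)
  obtain T1 T2 where T12: "subspace T1" "subspace T2" "T1 \<inter> T2 = T0" "S \<inter> ?W \<subseteq> T1 \<union> T2"
     "\<not> ?W \<subseteq> T1" "\<not> ?W \<subseteq> T2"
    using ncon unfolding connected_over_def by blast
  have main: ?thesis if h: "subspace T1" "subspace T2" "T1 \<inter> T2 = T0" "S \<inter> ?W \<subseteq> T1 \<union> T2"
     "\<not> ?W \<subseteq> T1" "T \<subseteq> T1" for T1 T2
  proof -
    have q1: "q \<notin> T1" using h(1,5,6) span_minimal[of "insert q T" T1] by auto
    show ?thesis
    proof
      fix s assume s: "s \<in> S \<inter> ?W"
      then obtain c t where t: "t \<in> T" "s = t + c *\<^sub>R q" using span_insertE[OF _ T(1)] by blast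
      show "s \<in> T \<union> span (insert q T0)"
      proof (cases "s \<in> T1")
        case True
        then have "c *\<^sub>R q \<in> T1" using t h(6) subspace_diff[OF h(1), of s t] by auto
        then have "c = 0" using q1 subspace_scale[OF h(1), of "c *\<^sub>R q" "1/c"] by (cases "c = 0") auto
        then show ?thesis using t by simp
      next
        case False
        then have s2: "s \<in> T2" using s h(4) by blast
        have "q \<in> T2" using h(4) q q1 span_base[of q "insert q T"] by blast
        then have "s - c *\<^sub>R q \<in> T2" by (intro subspace_diff subspace_scale h(2) s2)
        then have "t \<in> T2" using t(2) by simp
        then have "t \<in> T0" using t h(3,6) by blast
        then show ?thesis unfolding t(2) by (intro UnI2 span_add span_scale span_base) auto
      qed
    qed
  qed
  have "S \<inter> T \<subseteq> T1 \<union> T2" using T12(4) TW by blast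
  then have "T \<subseteq> T1 \<or> T \<subseteq> T2" using con T12 unfolding connected_over_def by blast
  then show ?thesis
  proof
    assume "T \<subseteq> T1"
    then show ?thesis by (rule main[OF T12(1-5)])
  next
    assume "T \<subseteq> T2"
    moreover have "T2 \<inter> T1 = T0" "S \<inter> ?W \<subseteq> T2 \<union> T1" using T12(3,4) by blast+
    ultimately show ?thesis using main[OF T12(2,1) _ _ T12(6)] by blast
  qed
qed


text \<open>For \<open>T0 = {0}\<close> this is the theorem of Motzkin and Hansen for unimodular \<open>S\<close>.  The version relative to
\<open>T0\<close> is needed for the induction: if \<open>q\<close> is isolated over \<open>F\<close> relative to a maximal connected flat
\<open>T\<close>, and \<open>q\<close> is isolated over \<open>T\<close> relative to \<open>T0\<close>, then \<open>q\<close> is isolated over \<open>F\<close> relative to \<open>T0\<close>.\<close>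

lemma exists_flat_with_isolated_element:
  fixes S :: "'v::euclidean_space set"
  assumes fin: "finite S" and symm: "\<And>s. s \<in> S \<Longrightarrow> - s \<in> S" and uni: "unimodular S"
    and T0: "flat S T0" "dim T0 + 2 \<le> dim S"
  shows "\<exists>F q. flat S F \<and> T0 \<subseteq> F \<and> dim F + 2 = dim S \<and> q \<in> S - F \<and>
    S \<inter> span (insert q F) \<subseteq> F \<union> span (insert q T0)"
  using T0
proof (induction "dim S - dim T0" arbitrary: T0 rule: less_induct)
  case less
  define n where "n = dim S"
  have sT0: "subspace T0" using less.prems by (simp add: flat_subspace)
  define PT where "PT T \<longleftrightarrow> flat S T \<and> T0 \<subseteq> T \<and> connected_over S T0 T \<and> dim T0 < dim T \<and> dim T < n" for T
  have subsp: "T \<subseteq> span S" if "flat S T" for T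
    using that span_mono[of "S \<inter> T" S] by (auto simp: flat_def)
  have flat_insert: "flat S (span (insert q T))" if T: "flat S T" and q: "q \<in> S" for q T
  proof -
    let ?W = "span (insert q T)"
    have "S \<inter> T \<subseteq> S \<inter> ?W" by (auto intro: span_base)
    then have "T \<subseteq> span (S \<inter> ?W)" using T span_mono unfolding flat_def by blast
    moreover have "q \<in> span (S \<inter> ?W)" using q by (auto intro: span_base)
    ultimately have "?W \<subseteq> span (S \<inter> ?W)" by (simp add: span_minimal)
    then show ?thesis using span_minimal[of "S \<inter> ?W" ?W] by (auto simp: flat_def)
  qed
  have dim_ins: "dim (span (insert q T)) = dim T + 1" if "subspace T" "q \<notin> T" for q and T :: "'v set"
  proof -
    have "span T = T" using that by simp
    then have "q \<notin> span T" using that(2) by metis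
    then show ?thesis by (simp add: dim_insert)
  qed
  have exq: "\<exists>q\<in>S. q \<notin> T" if "subspace T" "dim T < n" for T
  proof (rule ccontr)
    assume "\<not> ?thesis"
    then have "span S \<subseteq> T" using that by (intro span_minimal) auto
    then show False using dim_subset[of "span S" T] that by (simp add: n_def)
  qed
  have "\<exists>T. PT T"
  proof -
    obtain s where s: "s \<in> S" "s \<notin> T0" using exq[OF sT0] less.prems by (auto simp: n_def)
    let ?T = "span (insert s T0)"
    have "connected_over S T0 ?T" unfolding connected_over_def
    proof (intro allI impI)
      fix T1 T2 assume h: "subspace T1" "subspace T2" "T1 \<inter> T2 = T0" "S \<inter> ?T \<subseteq> T1 \<union> T2"
      have "s \<in> T1 \<union> T2" using h(4) s by (auto intro: span_base)
      then have "insert s T0 \<subseteq> T1 \<or> insert s T0 \<subseteq> T2" using h(3) by blast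
      then show "?T \<subseteq> T1 \<or> ?T \<subseteq> T2" using h(1,2) span_minimal by meson
    qed
    then have "PT ?T" unfolding PT_def
      using flat_insert[OF less.prems(1) s(1)] dim_ins[OF sT0 s(2)] less.prems(2)
      by (auto simp: n_def intro: span_base)
    then show ?thesis by blast
  qed
  moreover have "\<And>T. PT T \<Longrightarrow> dim T < n" by (simp add: PT_def)
  ultimately obtain T where T: "PT T" "\<And>T'. PT T' \<Longrightarrow> dim T' \<le> dim T"
    using ex_has_greatest_nat[of PT _ dim n] by (metis less_imp_le)
  have T': "flat S T" "T0 \<subseteq> T" "connected_over S T0 T" "dim T0 < dim T" "dim T < n"
    using T(1) by (auto simp: PT_def)
  have sT: "subspace T" using T' by (simp add: flat_subspace)
  show ?case
  proof (cases "dim T + 2 \<le> n")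
    case True
    then obtain F q where F: "flat S F" "T \<subseteq> F" "dim F + 2 = n" "q \<in> S - F"
      "S \<inter> span (insert q F) \<subseteq> F \<union> span (insert q T)"
    proof -
      have "dim S - dim T < dim S - dim T0" using T' by (simp add: n_def)
      from less.hyps[OF this T'(1) True[unfolded n_def]] show ?thesis using that unfolding n_def by blast
    qed
    have qT: "q \<notin> T" using F by auto
    have "\<not> connected_over S T0 (span (insert q T))"
    proof
      assume "connected_over S T0 (span (insert q T))"
      then have "PT (span (insert q T))" unfolding PT_def
        using flat_insert[OF T'(1), of q] F(4) dim_ins[OF sT qT] True T'(2,4)
        by (auto intro: span_base)
      then show False using T(2) dim_ins[OF sT qT] by fastforce
    qed
    then have "S \<inter> span (insert q T) \<subseteq> T \<union> span (insert q T0)"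
      using connected_plus_isolated[OF T'(3) sT T'(2) _ qT] F(4) by blast
    then have "S \<inter> span (insert q F) \<subseteq> F \<union> span (insert q T0)" using F(2,5) by blast
    then show ?thesis using F T'(2) unfolding n_def by blast
  next
    case False
    then have dT: "dim T + 1 = n" using T' by simp
    obtain h where h: "h \<in> S" "h \<notin> T" using exq[OF sT T'(5)] by blast
    obtain y w where yw: "y \<in> span T" "\<And>x. x \<in> span T \<Longrightarrow> real_inner_class.orthogonal w x" "h = y + w"
      using orthogonal_subspace_decomp_exists by blast
    have spT: "span T = T" using sT by (simp add: span_eq_iff)
    have w0: "w \<noteq> 0" using h yw spT by auto
    define v where "v = w /\<^sub>R (w \<bullet> w)"
    have vT: "v \<bullet> x = 0" if "x \<in> T" for x
      using yw(2)[of x] that spT by (simp add: v_def real_inner_class.orthogonal_def)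
    have vh: "v \<bullet> h = 1" using vT[of y] yw spT w0 by (simp add: inner_add_right v_def)
    have gen: "S \<subseteq> span (insert s T)" if s: "s \<in> S" "v \<bullet> s \<noteq> 0" for s
    proof -
      have "s \<notin> T" using vT s by auto
      then have "dim (span (insert s T)) = dim S" using dim_ins[OF sT] dT by (simp add: n_def)
      moreover have "span (insert s T) \<subseteq> span S"
        using subsp[OF T'(1)] s by (intro span_minimal) (auto intro: span_base)
      ultimately have "span (insert s T) = span S"
        by (intro subspace_dim_equal) auto
      then show ?thesis using span_superset[of S] by simp
    qed
    interpret unimodular_hyperplane S T0 T v
      using fin symm uni less.prems(1) T'(1,2) vT gen by unfold_locales auto
    have "T0 \<noteq> T" "upper \<noteq> {}" using T'(4) h vh by (auto simp: upper_def)
    from isolated_element[OF T'(3) this] show ?thesis using dT by (auto simp: n_def)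
  qed
qed

text \<open>The conclusion concerns the integral span, rather than the real span, of \<open>q\<close> and \<open>C\<close> because this span
stays inside a minimal lattice, and only the elements of \<open>S\<close> in that lattice are controlled.\<close>

theorem exists_split_sublattice:
  fixes S :: "'v::euclidean_space set"
  assumes fin: "finite S" and symm: "\<And>s. s \<in> S \<Longrightarrow> - s \<in> S" and dim: "dim S \<ge> 2"
  obtains q C where "q \<in> S" "C \<subseteq> S" "q \<notin> C" "independent (insert q C)" "card C + 2 = dim S"
    "S \<inter> int_span (insert q C) \<subseteq> int_span {q} \<union> int_span C"
proof -
  obtain B where B: "B \<subseteq> S" "independent B" "span B = span S" "unimodular (S \<inter> int_span B)"
    using exists_minimal_lattice[OF fin] by blast
  define S' where "S' = S \<inter> int_span B"
  have finB: "finite B" using B(1) fin finite_subset by blast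
  have "B \<subseteq> S'" using B(1) finB by (auto simp: S'_def int_span_base)
  then have spS': "span S' = span S"
    using B(3) span_mono[of B S'] span_mono[of S' S] by (auto simp: S'_def)
  have symm': "s \<in> S' \<Longrightarrow> - s \<in> S'" for s using symm by (simp add: S'_def int_span_uminus)
  have "span (S' \<inter> {0}) = {0}" by (cases "0 \<in> S'") auto
  then have "flat S' {0}" by (simp add: flat_def)
  then obtain F q where F: "flat S' F" "dim F + 2 = dim S'" "q \<in> S' - F"
      "S' \<inter> span (insert q F) \<subseteq> F \<union> span (insert q {0})"
  proof -
    have "dim S' = dim S" using spS' dim_span by metis
    then show ?thesis
      using exists_flat_with_isolated_element[OF _ symm' _ \<open>flat S' {0}\<close>] fin B(4) dim that
      unfolding S'_def by fastforce
  qed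
  obtain C where C: "C \<subseteq> S' \<inter> F" "independent C" "S' \<inter> F \<subseteq> span C"
    using maximal_independent_subset by blast
  have sF: "subspace F" using F by (simp add: flat_subspace)
  have spC: "span C = F" 
    using C span_mono[of C "S' \<inter> F"] span_minimal[of "S' \<inter> F" "span C"] F(1) by (auto simp: flat_def)
  have qC: "q \<notin> span C" using F spC by auto
  have ind: "independent (insert q C)" using C(2) qC by (simp add: independent_insert)
  have finC: "finite C" using C fin finite_subset[of C S] by (auto simp: S'_def)
  have q0: "q \<noteq> 0" using qC span_zero by auto
  have "card C = dim F" using C(2) spC dim_eq_card_independent dim_span by metis
  moreover have "dim S' = dim S" using spS' dim_span by metis
  ultimately have "card C + 2 = dim S" using F(2) by simp
  moreover have "S \<inter> int_span (insert q C) \<subseteq> int_span {q} \<union> int_span C"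
  proof
    fix s assume s: "s \<in> S \<inter> int_span (insert q C)"
    have "insert q C \<subseteq> int_span B" using C(1) F(3) by (auto simp: S'_def)
    then have "int_span (insert q C) \<subseteq> int_span B" by (rule int_span_mono_gen)
    then have s': "s \<in> S'" using s by (auto simp: S'_def)
    have "C \<subseteq> F" using C by auto
    then have "span (insert q C) \<subseteq> span (insert q F)" by (intro span_mono) auto
    moreover have "span {q, 0} = span {q}" using span_insert_0[of "{q}"] by (simp add: insert_commute)
    ultimately have "s \<in> F \<union> span {q}"
      using s s' F(4) int_span_subset_span[of "insert q C"] by blast
    moreover obtain k y where ky: "y \<in> int_span C" "s = of_int k *\<^sub>R q + y"
      using int_span_insert[OF finC _ IntD2[OF s]] qC span_base by blast
    have yF: "y \<in> F" using ky(1) int_span_subset_span spC by blast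
    ultimately consider "s \<in> F" | "s \<in> span {q}" by blast
    then show "s \<in> int_span {q} \<union> int_span C"
    proof cases
      case 1
      then have "of_int k *\<^sub>R q \<in> F" using ky(2) subspace_diff[OF sF 1 yF] by simp
      then have "k = 0" using F(3) subspace_scale[OF sF, of "of_int k *\<^sub>R q" "1 / of_int k"]
        by (cases "k = 0") auto
      then show ?thesis using ky by simp
    next
      case 2
      then obtain c where "s = c *\<^sub>R q" by (auto simp: span_singleton)
      then have y: "y = (c - of_int k) *\<^sub>R q" using ky(2) by (metis add_diff_cancel_left' scaleR_diff_left)
      have "c = of_int k"
      proof (rule ccontr)
        assume "c \<noteq> of_int k"
        then show False using yF y F(3) subspace_scale[OF sF yF, of "1 / (c - of_int k)"] by simp
      qed
      then have "s = of_int k *\<^sub>R q" using ky y by simp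
      then show ?thesis using int_span_scale[OF int_span_base[of "{q}" q]] by simp
    qed
  qed
  ultimately show ?thesis
    using that[of q C] F(3) C(1) ind qC span_base[of q C] by (auto simp: S'_def)
qed

section \<open>Characters of the torus\<close>

text \<open>Subtracting the linear part leaves an additive function that vanishes on the integers.  It is
periodic, hence bounded by continuity, and a bounded additive function is zero.\<close>

lemma additive_continuous_real:
  fixes k :: "real \<Rightarrow> real"
  assumes cont: "continuous_on UNIV k" and add: "\<And>s t. k (s + t) = k s + k t"
  shows "k t = t * k 1"
proof -
  define h where "h t = k t - t * k 1" for t
  have hadd: "h (s + t) = h s + h t" for s t by (simp add: h_def add algebra_simps)
  have h0: "h 0 = 0" using hadd[of 0 0] by simp
  have hneg: "h (- t) = - h t" for t using hadd[of t "- t"] h0 by simp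
  have hnat: "h (of_nat n * t) = of_nat n * h t" for n t
    by (induction n) (simp_all add: h0 hadd algebra_simps)
  have h1: "h 1 = 0" by (simp add: h_def)
  have hint: "h (of_int z) = 0" for z
  proof (cases "z \<ge> 0")
    case True
    then show ?thesis using hnat[of "nat z" 1] h1 by simp
  next
    case False
    then show ?thesis using hnat[of "nat (- z)" 1] h1 hneg[of "of_int (-z)"] by simp
  qed
  have "continuous_on {0..1} h" unfolding h_def
    by (intro continuous_intros continuous_on_subset[OF cont]) auto
  then have "bounded (h ` {0..1})" by (intro compact_imp_bounded compact_continuous_image) auto
  then obtain M where M: "\<And>x. x \<in> {0..1} \<Longrightarrow> \<bar>h x\<bar> \<le> M" unfolding bounded_iff by (metis imageI real_norm_def)
  have bd: "\<bar>h x\<bar> \<le> M" for x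
  proof -
    have "h x = h (frac x) + h (of_int \<lfloor>x\<rfloor>)" using hadd[of "frac x" "of_int \<lfloor>x\<rfloor>"] by (simp add: frac_def)
    then show ?thesis using M[of "frac x"] hint by (simp add: frac_ge_0 frac_lt_1 less_imp_le)
  qed
  have "h t = 0"
  proof (rule ccontr)
    assume "h t \<noteq> 0"
    then obtain n :: nat where "real n * \<bar>h t\<bar> > M" using reals_Archimedean3[of "\<bar>h t\<bar>"] by auto
    then show False using bd[of "of_nat n * t"] by (simp add: hnat abs_mult)
  qed
  then show ?thesis by (simp add: h_def)
qed

text \<open>A continuous logarithm turns the character into a function whose defect of additivity is
continuous with values in the multiples of \<open>2 \<pi>\<close>, hence zero.\<close>

lemma real_character:
  fixes g :: "real \<Rightarrow> complex"
  assumes cont: "continuous_on UNIV g" and mult: "\<And>s t. g (s + t) = g s * g t"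
    and norm: "\<And>t. cmod (g t) = 1"
  obtains c where "\<And>t. g t = cis (c * t)"
proof -
  have "g t \<noteq> 0" for t using norm[of t] by auto
  then obtain h where h: "continuous_on UNIV h" "\<And>x. g x = exp (h x)"
    using continuous_logarithm_on_contractible[OF cont] convex_imp_contractible[OF convex_UNIV] by auto
  have Re: "Re (h x) = 0" for x using norm[of x] by (simp add: h(2))
  define k where "k t = Im (h t) - Im (h 0)" for t
  have g0: "g 0 = 1"
  proof -
    have "g 0 \<noteq> 0" using norm[of 0] by auto
    then show ?thesis using mult[of 0 0] by simp
  qed
  have gk: "g t = cis (k t)" for t
  proof -
    have e: "g t = cis (Im (h t))" for t by (simp add: h(2) exp_eq_polar Re)
    have "cis (k t) = g t / g 0" by (simp add: k_def e[symmetric] cis_divide[symmetric])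
    then show ?thesis by (simp add: g0)
  qed
  have kc: "continuous_on UNIV k" unfolding k_def by (intro continuous_intros h)
  have "k (s + t) - k s - k t = 0" for s t
  proof -
    let ?f = "\<lambda>t. k (s + t) - k s - k t"
    have cis1: "cis (?f t) = 1" for t
    proof -
      have "cis (?f t) = g (s + t) / g s / g t" by (simp add: gk cis_divide[symmetric])
      then show ?thesis using norm[of s] norm[of t] by (auto simp: mult)
    qed
    have val: "\<exists>n::int. ?f t = 2 * pi * of_int n" for t
      using cis1[of t] by (auto simp: complex_eq_iff cos_one_2pi_int mult_ac)
    have "continuous_on UNIV ?f"
      by (intro continuous_intros continuous_on_subset[OF kc] continuous_on_compose2[OF kc]) auto
    moreover have "\<exists>e>0. \<forall>y. y \<in> UNIV \<and> ?f y \<noteq> ?f x \<longrightarrow> e \<le> norm (?f y - ?f x)" for x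
    proof (intro exI conjI allI impI)
      fix y assume y: "y \<in> UNIV \<and> ?f y \<noteq> ?f x"
      obtain n m where nm: "?f x = 2 * pi * of_int n" "?f y = 2 * pi * of_int m" using val by blast
      then have "m \<noteq> n" using y by auto
      then have "1 \<le> \<bar>m - n\<bar>" by linarith
      then have "1 \<le> \<bar>real_of_int (m - n)\<bar>" by linarith
      moreover have "norm (?f y - ?f x) = 2 * pi * \<bar>real_of_int (m - n)\<bar>"
        unfolding nm by (simp add: abs_mult right_diff_distrib[symmetric] del: of_int_diff)
      ultimately show "2 * pi \<le> norm (?f y - ?f x)" by simp
    qed simp
    ultimately have "?f constant_on UNIV"
      by (intro continuous_discrete_range_constant) auto
    then have "?f t = ?f 0" unfolding constant_on_def by (metis UNIV_I)
    moreover have "k 0 = 0" by (simp add: k_def)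
    ultimately show ?thesis by simp
  qed
  then have "k (s + t) = k s + k t" for s t by (metis diff_diff_add right_minus_eq)
  then have "k t = t * k 1" for t using additive_continuous_real[OF kc] by blast
  then show ?thesis using that[of "k 1"] gk by (metis mult.commute)
qed

definition character :: "nat \<Rightarrow> (nat \<Rightarrow> int) \<Rightarrow> (nat \<Rightarrow> complex) \<Rightarrow> complex" where
  "character d m z = (\<Prod>i<d. z i powi m i)"

definition torus_exp :: "nat \<Rightarrow> (nat \<Rightarrow> real) \<Rightarrow> nat \<Rightarrow> complex" where
  "torus_exp d t = (\<lambda>i\<in>{..<d}. cis (t i))"

lemma carrier_torus: "carrier (torus d) = (\<Pi>\<^sub>E i\<in>{..<d}. sphere 0 1)"
  by (simp add: torus_def circle_group_def)

lemma mult_torus: "x \<otimes>\<^bsub>torus d\<^esub> y = (\<lambda>i\<in>{..<d}. x i * y i)"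
  by (simp add: torus_def circle_group_def)

lemma one_torus: "\<one>\<^bsub>torus d\<^esub> = (\<lambda>i\<in>{..<d}. 1)"
  by (simp add: torus_def circle_group_def)

lemma group_torus: "Group.group (torus d)"
  using comm_group_torus comm_group_def by blast

lemma torus_exp_in_carrier [simp]: "torus_exp d t \<in> carrier (torus d)"
  by (simp add: carrier_torus torus_exp_def)

lemma torus_exp_cong: "(\<And>i. i < d \<Longrightarrow> cis (s i) = cis (t i)) \<Longrightarrow> torus_exp d s = torus_exp d t"
  by (auto simp: torus_exp_def)

lemma torus_exp_surj:
  assumes "z \<in> carrier (torus d)"
  shows "torus_exp d (\<lambda>i. Arg (z i)) = z"
proof
  fix i show "torus_exp d (\<lambda>i. Arg (z i)) i = z i"
  proof (cases "i < d")
    case True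
    then have "cmod (z i) = 1" using assms by (auto simp: carrier_torus PiE_iff)
    then have "z i = cis (Arg (z i))" by (metis cis_Arg norm_zero sgn_div_norm scaleR_one inverse_1 zero_neq_one)
    then show ?thesis using True by (simp add: torus_exp_def)
  next
    case False
    then show ?thesis using assms by (auto simp: carrier_torus torus_exp_def PiE_iff extensional_def)
  qed
qed

lemma torus_exp_add: "torus_exp d s \<otimes>\<^bsub>torus d\<^esub> torus_exp d t = torus_exp d (\<lambda>i. s i + t i)"
  by (auto simp: mult_torus torus_exp_def cis_mult)

lemma torus_exp_0: "torus_exp d (\<lambda>_. 0) = \<one>\<^bsub>torus d\<^esub>"
  by (auto simp: one_torus torus_exp_def)

lemma torus_square_root:
  assumes "z \<in> carrier (torus d)"
  obtains w where "w \<in> carrier (torus d)" "w \<otimes>\<^bsub>torus d\<^esub> w = z"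
  using that[of "torus_exp d (\<lambda>i. Arg (z i) / 2)"] torus_exp_surj[OF assms]
  by (simp add: torus_exp_add)

lemma character_torus_exp: "character d m (torus_exp d t) = cis (\<Sum>i<d. of_int (m i) * t i)"
proof -
  have "cis (\<Sum>i<n. of_int (m i) * t i) = (\<Prod>i<n. cis (of_int (m i) * t i))" for n
    by (induction n) (auto simp: cis_mult[symmetric])
  then show ?thesis by (simp add: character_def torus_exp_def cis_power_int)
qed

lemma norm_character: "z \<in> carrier (torus d) \<Longrightarrow> cmod (character d m z) = 1"
  using torus_exp_surj[of z d] character_torus_exp[of d m] by (metis norm_cis)

lemma character_mult:
  assumes "x \<in> carrier (torus d)" "y \<in> carrier (torus d)"
  shows "character d m (x \<otimes>\<^bsub>torus d\<^esub> y) = character d m x * character d m y"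
proof -
  have "character d m (torus_exp d s \<otimes>\<^bsub>torus d\<^esub> torus_exp d t) = 
     character d m (torus_exp d s) * character d m (torus_exp d t)" for s t
    by (simp add: torus_exp_add character_torus_exp cis_mult sum.distrib distrib_left)
  then show ?thesis using assms torus_exp_surj by metis
qed

lemma character_hom: "character d m \<in> hom (torus d) circle_group"
  by (auto simp: hom_def circle_group_def norm_character character_mult)

lemma continuous_map_torus_component:
  assumes "i < d" shows "continuous_map (torus_topology d) euclidean (\<lambda>z. z i)"
  using continuous_map_product_projection[of i "{..<d}" "\<lambda>_. circle_topology"] assms
  unfolding torus_topology_def circle_topology_def continuous_map_in_subtopology by simp

lemma continuous_map_power_int:
  fixes f :: "'b \<Rightarrow> complex"
  assumes "continuous_map X euclidean f" "\<And>x. x \<in> topspace X \<Longrightarrow> f x \<noteq> 0"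
  shows "continuous_map X euclidean (\<lambda>x. f x powi n)"
proof -
  have "continuous_map X (top_of_set (- {0})) f" using assms by (auto simp: continuous_map_in_subtopology)
  moreover have "continuous_map (top_of_set (- {0})) euclidean (\<lambda>z::complex. z powi n)"
    by (auto intro!: continuous_intros)
  ultimately have "continuous_map X euclidean ((\<lambda>z::complex. z powi n) \<circ> f)"
    by (rule continuous_map_compose)
  then show ?thesis by (simp add: o_def)
qed

lemma continuous_map_mult_euclidean:
  fixes f g :: "'b \<Rightarrow> complex"
  assumes "continuous_map X euclidean f" "continuous_map X euclidean g"
  shows "continuous_map X euclidean (\<lambda>x. f x * g x)"
proof -
  have "continuous_map X (prod_topology euclidean euclidean) (\<lambda>x. (f x, g x))"
    using assms by (rule continuous_map_pairedI)
  moreover have "continuous_map (prod_topology euclidean euclidean) euclidean (\<lambda>(x, y). x * y :: complex)"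
    by (auto simp: euclidean_product_topology case_prod_unfold intro!: continuous_intros)
  ultimately have "continuous_map X euclidean ((\<lambda>(x, y). x * y) \<circ> (\<lambda>x. (f x, g x)))"
    by (rule continuous_map_compose)
  then show ?thesis by (simp add: o_def)
qed

lemma continuous_character: "continuous_map (torus_topology d) euclidean (character d m)"
proof -
  have "continuous_map (torus_topology d) euclidean (\<lambda>z. \<Prod>i<n. z i powi m i)" if "n \<le> d" for n
    using that
  proof (induction n)
    case (Suc n)
    have "z n \<noteq> 0" if "z \<in> topspace (torus_topology d)" for z
      using that Suc.prems by (auto simp: topspace_torus_topology carrier_torus PiE_iff dest: bspec[of _ _ n])
    then have "continuous_map (torus_topology d) euclidean (\<lambda>z. z n powi m n)"
      using Suc.prems by (intro continuous_map_power_int continuous_map_torus_component) auto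
    then show ?case using Suc by (simp add: continuous_map_mult_euclidean)
  qed simp
  then show ?thesis unfolding character_def by blast
qed

lemma continuous_character_circle: "continuous_map (torus_topology d) circle_topology (character d m)"
  using continuous_character[of d m] norm_character[of _ d m]
  by (auto simp: circle_topology_def continuous_map_in_subtopology topspace_torus_topology)

lemma continuous_map_into_torus:
  "continuous_map X (torus_topology d) f \<longleftrightarrow>
     f ` topspace X \<subseteq> extensional {..<d} \<and> (\<forall>i<d. continuous_map X circle_topology (\<lambda>x. f x i))"
  by (auto simp: torus_topology_def continuous_map_componentwise)

lemma continuous_cis_circle: "continuous_map euclidean circle_topology cis"
  by (auto simp: circle_topology_def continuous_map_in_subtopology intro!: continuous_intros)

lemma continuous_torus_exp_line:
  "continuous_map euclideanreal (torus_topology d) (\<lambda>s. torus_exp d (\<lambda>i. s * t i))"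
proof -
  have "continuous_map euclideanreal circle_topology (cis \<circ> (\<lambda>s. s * t i))" for i
    by (intro continuous_map_compose[OF _ continuous_cis_circle]) (auto intro!: continuous_intros)
  then show ?thesis unfolding continuous_map_into_torus
    by (auto simp: torus_exp_def o_def)
qed

text \<open>On each coordinate circle the character pulls back to a character of the line that is trivial
at \<open>2 \<pi>\<close>, and the torus is the product of these circles.\<close>

theorem torus_character:
  assumes hom: "\<eta> \<in> hom (torus d) circle_group"
    and cont: "continuous_map (torus_topology d) euclidean \<eta>"
  obtains m where "\<And>z. z \<in> carrier (torus d) \<Longrightarrow> \<eta> z = character d m z"
proof -
  interpret T: Group.group "torus d" by (rule group_torus)
  have mult: "\<eta> (x \<otimes>\<^bsub>torus d\<^esub> y) = \<eta> x * \<eta> y" if "x \<in> carrier (torus d)" "y \<in> carrier (torus d)" for x y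
    using hom_mult[OF hom that] by (simp add: circle_group_def)
  have norm: "cmod (\<eta> x) = 1" if "x \<in> carrier (torus d)" for x
    using hom_in_carrier[OF hom that] by (simp add: circle_group_def)
  define e where "e j = (\<lambda>i::nat. if i = j then 1 else (0::real))" for j
  have "\<exists>n::int. \<forall>s. \<eta> (torus_exp d (\<lambda>i. s * e j i)) = cis (of_int n * s)" for j
  proof -
    let ?g = "\<lambda>s. \<eta> (torus_exp d (\<lambda>i. s * e j i))"
    have "continuous_map euclideanreal euclidean (\<eta> \<circ> (\<lambda>s. torus_exp d (\<lambda>i. s * e j i)))"
      using continuous_torus_exp_line cont by (rule continuous_map_compose)
    then have "continuous_on UNIV ?g" by (simp add: o_def)
    moreover have "?g (s + t) = ?g s * ?g t" for s t
      by (subst mult[symmetric]) (simp_all add: torus_exp_add distrib_right)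
    moreover have "cmod (?g s) = 1" for s by (simp add: norm)
    ultimately obtain c where c: "\<And>t. ?g t = cis (c * t)" using real_character by blast
    have "?g (2 * pi) = ?g 0" by (intro arg_cong[of _ _ \<eta>] torus_exp_cong) (simp add: e_def)
    then have "cis (c * (2 * pi)) = cis (c * 0)" unfolding c .
    then have "cis (c * (2 * pi)) = 1" by simp
    then obtain n :: int where "c * (2 * pi) = 2 * pi * of_int n"
      by (auto simp: complex_eq_iff cos_one_2pi_int mult_ac)
    then have "c = of_int n" by simp
    then show ?thesis using c by blast
  qed
  then obtain m :: "nat \<Rightarrow> int" where m: "\<And>j s. \<eta> (torus_exp d (\<lambda>i. s * e j i)) = cis (of_int (m j) * s)"
    by metis
  have "\<eta> (torus_exp d (\<lambda>i. if i < n then t i else 0)) = cis (\<Sum>i<n. of_int (m i) * t i)" for t n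
  proof (induction n)
    case 0
    have "\<eta> \<one>\<^bsub>torus d\<^esub> = 1" using mult[of "\<one>\<^bsub>torus d\<^esub>" "\<one>\<^bsub>torus d\<^esub>"] norm[of "\<one>\<^bsub>torus d\<^esub>"] by auto
    then show ?case by (simp add: torus_exp_0)
  next
    case (Suc n)
    have "torus_exp d (\<lambda>i. if i < Suc n then t i else 0)
       = torus_exp d (\<lambda>i. if i < n then t i else 0) \<otimes>\<^bsub>torus d\<^esub> torus_exp d (\<lambda>i. t n * e n i)"
      unfolding torus_exp_add by (intro torus_exp_cong) (auto simp: e_def less_Suc_eq)
    then show ?case by (simp add: mult Suc m cis_mult)
  qed
  note ind = this[of d]
  show ?thesis
  proof (rule that[of m])
    fix z assume z: "z \<in> carrier (torus d)"
    define t where "t i = Arg (z i)" for i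
    have "z = torus_exp d (\<lambda>i. if i < d then t i else 0)"
      using torus_exp_surj[OF z] torus_exp_cong[of d "\<lambda>i. if i < d then t i else 0" t]
      by (simp add: t_def [abs_def])
    then have "\<eta> z = cis (\<Sum>i<d. of_int (m i) * t i)" using ind by simp
    also have "\<dots> = character d m (torus_exp d t)" by (simp add: character_torus_exp)
    also have "torus_exp d t = z" using torus_exp_surj[OF z] by (simp add: t_def [abs_def])
    finally show "\<eta> z = character d m z" .
  qed
qed

section \<open>Joint eigenvectors of commuting symmetric maps\<close>

text \<open>A maximum point \<open>x\<close> of the Rayleigh quotient on the unit sphere is an eigenvector.  Its residual
\<open>y = A x - M x\<close> is orthogonal to \<open>x\<close>, and moving from \<open>x\<close> in the direction of \<open>y\<close> would increase the
quotient to first order by \<open>2 (y \<bullet> y)\<close>.\<close>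

lemma self_adjoint_eigenvector:
  fixes A :: "'a::euclidean_space \<Rightarrow> 'a"
  assumes W: "subspace W" "W \<noteq> {0}" and lin: "linear A" and inv: "A ` W \<subseteq> W"
    and sa: "\<And>x y. A x \<bullet> y = x \<bullet> A y"
  obtains x c where "x \<in> W" "x \<noteq> 0" "A x = c *\<^sub>R x"
proof -
  let ?S = "W \<inter> sphere 0 1"
  have W0: "0 \<in> W" using W by (simp add: subspace_0)
  then obtain w where w: "w \<in> W" "w \<noteq> 0" using W by blast
  then have "w /\<^sub>R norm w \<in> ?S" using W by (simp add: subspace_scale)
  then have ne: "?S \<noteq> {}" by blast
  have "compact ?S" using closed_subspace[OF W(1)] by (metis compact_sphere closed_Int_compact)
  moreover have "continuous_on ?S (\<lambda>x. A x \<bullet> x)"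
    by (intro continuous_intros linear_continuous_on linear_conv_bounded_linear[THEN iffD1] lin)
  ultimately obtain x where x: "x \<in> ?S" "\<And>y. y \<in> ?S \<Longrightarrow> A y \<bullet> y \<le> A x \<bullet> x"
    using continuous_attains_sup[of ?S "\<lambda>x. A x \<bullet> x"] ne by blast
  define M where "M = A x \<bullet> x"
  have xx: "x \<bullet> x = 1" using x(1) by (simp add: norm_eq_1)
  have bound: "A y \<bullet> y \<le> M * (y \<bullet> y)" if "y \<in> W" for y
  proof (cases "y = 0")
    case True then show ?thesis by simp
  next
    case False
    let ?u = "y /\<^sub>R norm y"
    have "?u \<in> ?S" using that False W by (simp add: subspace_scale)
    from x(2)[OF this] have "(A y \<bullet> y) / (norm y)\<^sup>2 \<le> M"
      by (simp add: linear_scale[OF lin] M_def power2_eq_square divide_inverse mult_ac)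
    then show ?thesis using False by (simp add: divide_simps power2_norm_eq_inner)
  qed
  have AxW: "A x \<in> W" using inv x by auto
  have "A x - M *\<^sub>R x = 0"
  proof -
    define y where "y = A x - M *\<^sub>R x"
    have yW: "y \<in> W" using AxW x W by (simp add: y_def subspace_diff subspace_scale)
    have xy: "x \<bullet> y = 0" by (simp add: y_def inner_diff_right xx M_def inner_commute)
    have Axy: "A x \<bullet> y = y \<bullet> y"
    proof -
      have "A x = y + M *\<^sub>R x" by (simp add: y_def)
      then show ?thesis using xy by (simp add: inner_add_left)
    qed
    define C where "C = M * (y \<bullet> y) - A y \<bullet> y"
    have quad: "2 * t * (y \<bullet> y) \<le> t\<^sup>2 * C" for t
    proof -
      have q1: "A (x + t *\<^sub>R y) \<bullet> (x + t *\<^sub>R y) \<le> M * ((x + t *\<^sub>R y) \<bullet> (x + t *\<^sub>R y))"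
        using x yW W by (intro bound) (simp add: subspace_add subspace_scale)
      have q2: "A (x + t *\<^sub>R y) \<bullet> (x + t *\<^sub>R y) = M + 2 * t * (y \<bullet> y) + t\<^sup>2 * (A y \<bullet> y)"
        using sa[of y x] Axy
        by (simp add: linear_add[OF lin] linear_scale[OF lin] inner_add_left inner_add_right M_def
            power2_eq_square algebra_simps inner_commute)
      have q3: "(x + t *\<^sub>R y) \<bullet> (x + t *\<^sub>R y) = 1 + t\<^sup>2 * (y \<bullet> y)"
        using xy by (simp add: inner_add_left inner_add_right xx inner_commute power2_eq_square)
      have "M + 2 * t * (y \<bullet> y) + t\<^sup>2 * (A y \<bullet> y) \<le> M * (1 + t\<^sup>2 * (y \<bullet> y))"
        using q1 unfolding q2 q3 .
      then show ?thesis by (simp add: C_def algebra_simps)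
    qed
    have "y \<bullet> y = 0"
    proof (rule ccontr)
      assume "y \<bullet> y \<noteq> 0"
      then have pos: "y \<bullet> y > 0" using inner_ge_zero[of y] by linarith
      define t where "t = (y \<bullet> y) / (\<bar>C\<bar> + 1)"
      have tpos: "t > 0" using pos by (simp add: t_def)
      have "2 * (y \<bullet> y) \<le> t * C" using quad[of t] tpos by (simp add: power2_eq_square)
      also have "\<dots> \<le> t * (\<bar>C\<bar> + 1)" using tpos by (intro mult_left_mono) auto
      also have "\<dots> = y \<bullet> y" by (simp add: t_def)
      finally show False using pos by simp
    qed
    then show ?thesis by (simp add: y_def)
  qed
  then have "A x = M *\<^sub>R x" by simp
  then show ?thesis using that[of x M] x(1) xx by (metis IntD1 inner_zero_left zero_neq_one)
qed

text \<open>By induction on the dimension: if some \<open>A i\<close> is not a scalar on \<open>W\<close>, then one of its eigenspaces in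
\<open>W\<close> is a smaller subspace, and it is invariant because the maps commute.\<close>

lemma joint_eigenvector:
  fixes A :: "'i \<Rightarrow> 'a::euclidean_space \<Rightarrow> 'a"
  assumes lin: "\<And>i. i \<in> I \<Longrightarrow> linear (A i)"
    and sa: "\<And>i x y. i \<in> I \<Longrightarrow> A i x \<bullet> y = x \<bullet> A i y"
    and comm: "\<And>i j x. i \<in> I \<Longrightarrow> j \<in> I \<Longrightarrow> A i (A j x) = A j (A i x)"
    and "subspace W" "W \<noteq> {0}" "\<And>i. i \<in> I \<Longrightarrow> A i ` W \<subseteq> W"
  shows "\<exists>x\<in>W. x \<noteq> 0 \<and> (\<forall>i\<in>I. \<exists>c. A i x = c *\<^sub>R x)"
  using assms(4-6)
proof (induction "dim W" arbitrary: W rule: less_induct)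
  case less
  show ?case
  proof (cases "\<forall>i\<in>I. \<exists>c. \<forall>x\<in>W. A i x = c *\<^sub>R x")
    case True
    moreover obtain x where "x \<in> W" "x \<noteq> 0" using less.prems(1,2) subspace_0 by blast
    ultimately show ?thesis by blast
  next
    case False
    then obtain i where i: "i \<in> I" "\<And>c. \<exists>x\<in>W. A i x \<noteq> c *\<^sub>R x" by blast
    obtain x c where x: "x \<in> W" "x \<noteq> 0" "A i x = c *\<^sub>R x"
      using self_adjoint_eigenvector[OF less.prems(1,2) lin[OF i(1)] less.prems(3)[OF i(1)] sa[OF i(1)]]
      by blast
    define W' where "W' = {w\<in>W. A i w = c *\<^sub>R w}"
    have W': "subspace W'" unfolding W'_def subspace_def
      using less.prems(1) lin[OF i(1)]
      by (auto simp: subspace_0 subspace_add subspace_scale linear_0 linear_add linear_scale scaleR_add_right)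
    have sub: "W' \<subset> W" using i(2)[of c] by (auto simp: W'_def)
    then have "dim W' < dim W" using W' less.prems(1) 
      by (metis dim_psubset span_eq_iff)
    moreover have "W' \<noteq> {0}" using x by (auto simp: W'_def)
    moreover have "A j ` W' \<subseteq> W'" if "j \<in> I" for j
      using less.prems(3)[OF that] comm[OF i(1) that] lin[OF that]
      by (auto simp: W'_def linear_scale)
    ultimately have "\<exists>x\<in>W'. x \<noteq> 0 \<and> (\<forall>i\<in>I. \<exists>c. A i x = c *\<^sub>R x)"
      using less.hyps[of W'] W' by blast
    then show ?thesis using sub by blast
  qed
qed

definition orthonormal :: "'a::euclidean_space set \<Rightarrow> bool" where
  "orthonormal B \<longleftrightarrow> (\<forall>b\<in>B. \<forall>b'\<in>B. b \<bullet> b' = (if b = b' then 1 else 0))"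

lemma joint_eigenbasis:
  fixes A :: "'i \<Rightarrow> 'a::euclidean_space \<Rightarrow> 'a"
  assumes lin: "\<And>i. i \<in> I \<Longrightarrow> linear (A i)"
    and sa: "\<And>i x y. i \<in> I \<Longrightarrow> A i x \<bullet> y = x \<bullet> A i y"
    and comm: "\<And>i j x. i \<in> I \<Longrightarrow> j \<in> I \<Longrightarrow> A i (A j x) = A j (A i x)"
    and "subspace W" "\<And>i. i \<in> I \<Longrightarrow> A i ` W \<subseteq> W"
  shows "\<exists>B. finite B \<and> B \<subseteq> W \<and> orthonormal B \<and> (\<forall>b\<in>B. \<forall>i\<in>I. \<exists>c. A i b = c *\<^sub>R b) \<and>
    (\<forall>x\<in>W. x = (\<Sum>b\<in>B. (x \<bullet> b) *\<^sub>R b))"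
  using assms(4,5)
proof (induction "dim W" arbitrary: W rule: less_induct)
  case less
  show ?case
  proof (cases "W = {0}")
    case True
    then show ?thesis by (intro exI[of _ "{}"]) (auto simp: orthonormal_def)
  next
    case False
    obtain x0 where x0: "x0 \<in> W" "x0 \<noteq> 0" "\<And>i. i \<in> I \<Longrightarrow> \<exists>c. A i x0 = c *\<^sub>R x0"
      using joint_eigenvector[of I A, OF lin sa comm less.prems(1) False less.prems(2)] by blast
    define x where "x = x0 /\<^sub>R norm x0"
    have x: "x \<in> W" "x \<bullet> x = 1" using x0 less.prems(1)
      by (auto simp: x_def subspace_scale dot_square_norm power2_eq_square)
    have xe: "\<exists>c. A i x = c *\<^sub>R x" if "i \<in> I" for i
      using x0(3)[OF that] by (auto simp: x_def linear_scale[OF lin[OF that]] mult.commute)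
    define W' where "W' = {w\<in>W. x \<bullet> w = 0}"
    have W': "subspace W'" unfolding W'_def subspace_def
      using less.prems(1) by (auto simp: subspace_0 subspace_add subspace_scale inner_add_right)
    have "x \<notin> W'" using x(2) by (simp add: W'_def)
    moreover have "W' \<subseteq> W" by (auto simp: W'_def)
    ultimately have sub: "W' \<subset> W" using x(1) by blast
    then have d: "dim W' < dim W" using W' less.prems(1) by (metis dim_psubset span_eq_iff)
    have inv: "A i ` W' \<subseteq> W'" if i: "i \<in> I" for i
    proof -
      obtain c where "A i x = c *\<^sub>R x" using xe[OF i] by blast
      then have "x \<bullet> A i w = c * (x \<bullet> w)" for w using sa[OF i, of x w] by simp
      then show ?thesis using less.prems(2)[OF i] by (auto simp: W'_def)
    qed
    have "\<exists>B. finite B \<and> B \<subseteq> W' \<and> orthonormal B \<and> (\<forall>b\<in>B. \<forall>i\<in>I. \<exists>c. A i b = c *\<^sub>R b) \<and>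
      (\<forall>x\<in>W'. x = (\<Sum>b\<in>B. (x \<bullet> b) *\<^sub>R b))"
      by (rule less.hyps[OF d W']) (rule inv)
    then obtain B where B: "finite B" "B \<subseteq> W'" "orthonormal B"
      "\<forall>b\<in>B. \<forall>i\<in>I. \<exists>c. A i b = c *\<^sub>R b" "\<forall>x\<in>W'. x = (\<Sum>b\<in>B. (x \<bullet> b) *\<^sub>R b)"
      by (elim exE conjE)
    have xB: "x \<notin> B" using B(2) x by (auto simp: W'_def)
    have "orthonormal (insert x B)" 
      using B(2,3) x by (auto simp: orthonormal_def W'_def inner_commute)
    moreover have "\<forall>y\<in>W. y = (\<Sum>b\<in>insert x B. (y \<bullet> b) *\<^sub>R b)"
    proof
      fix y assume y: "y \<in> W"
      let ?y = "y - (y \<bullet> x) *\<^sub>R x"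
      have "?y \<in> W'" using y x less.prems(1)
        by (simp add: W'_def subspace_diff subspace_scale inner_diff_right inner_commute)
      then have "?y = (\<Sum>b\<in>B. (?y \<bullet> b) *\<^sub>R b)" by (rule bspec[OF B(5)])
      also have "\<dots> = (\<Sum>b\<in>B. (y \<bullet> b) *\<^sub>R b)"
        using B(2) by (intro sum.cong) (auto simp: W'_def inner_diff_left)
      finally show "y = (\<Sum>b\<in>insert x B. (y \<bullet> b) *\<^sub>R b)" using B(1) xB by (simp add: algebra_simps)
    qed
    moreover have "finite (insert x B)" "insert x B \<subseteq> W" using B(1,2) x(1) sub by blast+
    moreover have "\<forall>b\<in>insert x B. \<forall>i\<in>I. \<exists>c. A i b = c *\<^sub>R b" using B(4) xe by blast
    ultimately show ?thesis by (intro exI[of _ "insert x B"] conjI)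
  qed
qed

section \<open>Weights of a torus action\<close>

text \<open>Only the values of the representation at group elements and vectors are used here, without the
extensional encoding of maps.\<close>

locale torus_action =
  fixes d :: nat and R :: "(nat \<Rightarrow> complex) \<Rightarrow> 'a::euclidean_space \<Rightarrow> 'a"
  assumes lin: "g \<in> carrier (torus d) \<Longrightarrow> linear (R g)"
    and iso: "g \<in> carrier (torus d) \<Longrightarrow> R g x \<bullet> R g y = x \<bullet> y"
    and mult: "g \<in> carrier (torus d) \<Longrightarrow> h \<in> carrier (torus d) \<Longrightarrow>
        R (g \<otimes>\<^bsub>torus d\<^esub> h) x = R g (R h x)"
    and one: "R \<one>\<^bsub>torus d\<^esub> x = x"
    and cont: "continuous_map (torus_topology d) euclidean (\<lambda>g. R g x)"
begin

abbreviation "T \<equiv> carrier (torus d)"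

sublocale G: comm_group "torus d" by (rule comm_group_torus)

text \<open>\<open>A g\<close> and \<open>K g\<close> are twice the symmetric and twice the skew part of \<open>R g\<close>, because \<open>R (inv g)\<close> is the
adjoint of \<open>R g\<close>.\<close>

definition A where "A g x = R g x + R (inv\<^bsub>torus d\<^esub> g) x"

definition K where "K g x = R g x - R (inv\<^bsub>torus d\<^esub> g) x"

lemma R_commute: "g \<in> T \<Longrightarrow> h \<in> T \<Longrightarrow> R g (R h x) = R h (R g x)"
  by (metis mult G.m_comm)

lemma R_inv [simp]: "g \<in> T \<Longrightarrow> R g (R (inv\<^bsub>torus d\<^esub> g) x) = x" "g \<in> T \<Longrightarrow> R (inv\<^bsub>torus d\<^esub> g) (R g x) = x"
  by (simp_all add: mult[symmetric] one)

lemma R_adjoint: "g \<in> T \<Longrightarrow> R g x \<bullet> y = x \<bullet> R (inv\<^bsub>torus d\<^esub> g) y"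
  using iso[of g x "R (inv\<^bsub>torus d\<^esub> g) y"] by simp

lemma R_adjoint': "g \<in> T \<Longrightarrow> R (inv\<^bsub>torus d\<^esub> g) x \<bullet> y = x \<bullet> R g y"
  using R_adjoint[of "inv\<^bsub>torus d\<^esub> g" x y] by simp

lemma linear_A: "g \<in> T \<Longrightarrow> linear (A g)"
  unfolding A_def using lin by (intro linear_compose_add) auto

lemma linear_K: "g \<in> T \<Longrightarrow> linear (K g)"
  unfolding K_def using lin by (intro linear_compose_sub) auto

lemma A_self_adjoint: "g \<in> T \<Longrightarrow> A g x \<bullet> y = x \<bullet> A g y"
  by (simp add: A_def inner_add_left inner_add_right R_adjoint R_adjoint')

lemma K_skew: "g \<in> T \<Longrightarrow> K g x \<bullet> y = - (x \<bullet> K g y)"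
  by (simp add: K_def inner_diff_left inner_diff_right R_adjoint R_adjoint')

lemma A_commute: "g \<in> T \<Longrightarrow> h \<in> T \<Longrightarrow> A g (A h x) = A h (A g x)"
  by (simp add: A_def linear_add[OF lin] R_commute)

lemma K_K: 
  assumes "g \<in> T" "h \<in> T"
  shows "K g (K h x) = A (g \<otimes>\<^bsub>torus d\<^esub> h) x - A (g \<otimes>\<^bsub>torus d\<^esub> inv\<^bsub>torus d\<^esub> h) x"
  using assms
  by (simp add: A_def K_def linear_diff[OF lin] mult G.inv_mult R_commute algebra_simps)

lemma K_R_commute: "g \<in> T \<Longrightarrow> h \<in> T \<Longrightarrow> K g (R h x) = R h (K g x)"
  by (simp add: K_def linear_diff[OF lin] R_commute)

lemma K_K_commute: "g \<in> T \<Longrightarrow> h \<in> T \<Longrightarrow> K g (K h x) = K h (K g x)"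
  by (simp add: K_def linear_diff[OF lin] R_commute)

text \<open>For nonzero \<open>b\<close> this determines \<open>m\<close> up to sign.  Using the real part of the character
avoids complexification.\<close>

definition weight :: "'a \<Rightarrow> (nat \<Rightarrow> int) \<Rightarrow> bool" where
  "weight b m \<longleftrightarrow> (\<forall>g\<in>T. A g b = (2 * Re (character d m g)) *\<^sub>R b)"

text \<open>The product of two skew parts is a difference of symmetric parts (\<open>K_K\<close>), so it acts on \<open>b\<close> as a scalar.
It follows that the vectors \<open>K g b\<close> lie on one line orthogonal to \<open>b\<close>.  If \<open>e\<close> spans it, then
\<open>R g\<close> acts on the span of \<open>b\<close> and \<open>e\<close> as multiplication by the complex number with parts
\<open>\<alpha> g = b \<bullet> R g b\<close> and \<open>\<beta> g = e \<bullet> R g b\<close>, and this number is a continuous character.\<close>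

lemma exists_weight:
  assumes b: "b \<bullet> b = 1" and eig: "\<And>g. g \<in> T \<Longrightarrow> \<exists>c. A g b = c *\<^sub>R b"
  shows "\<exists>m. weight b m"
proof -
  define l where "l g = (SOME c. A g b = c *\<^sub>R b)" for g
  have l: "A g b = l g *\<^sub>R b" if "g \<in> T" for g
    unfolding l_def by (rule someI_ex[OF eig[OF that]])
  have Kb: "b \<bullet> K g b = 0" if "g \<in> T" for g
    using K_skew[OF that, of b b] by (simp add: inner_commute)
  \<comment> \<open>The vector e is zero if all K g b vanish, and a unit vector otherwise.\<close>
  have ex_e: "\<exists>e. (\<exists>h\<in>T. \<exists>n. e = n *\<^sub>R K h b) \<and> (e \<bullet> e = 1 \<or> e = 0) \<and> b \<bullet> e = 0 \<and> 
     (\<forall>g\<in>T. \<exists>c. K g b = c *\<^sub>R e \<and> K g e = - (c *\<^sub>R b))"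
  proof (cases "\<forall>g\<in>T. K g b = 0")
    case True
    have "\<exists>h\<in>T. \<exists>n. 0 = n *\<^sub>R K h b"
      by (intro bexI[of _ "\<one>\<^bsub>torus d\<^esub>"] exI[of _ 0]) simp_all
    moreover have "K g 0 = 0" if "g \<in> T" for g by (rule linear_0[OF linear_K[OF that]])
    ultimately show ?thesis using True by (intro exI[of _ 0] conjI ballI) auto
  next
    case False
    then obtain h where h: "h \<in> T" "K h b \<noteq> 0" by blast
    define n where "n = norm (K h b)"
    have n: "n > 0" using h by (simp add: n_def)
    define e where "e = K h b /\<^sub>R n"
    have ee: "e \<bullet> e = 1" using n by (simp add: e_def n_def dot_square_norm power2_eq_square)
    have Kh: "K h b = n *\<^sub>R e" using n by (simp add: e_def)
    have KK: "\<exists>c. K g (K h' b) = c *\<^sub>R b" if "g \<in> T" "h' \<in> T" for g h'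
      using that l[of "g \<otimes>\<^bsub>torus d\<^esub> h'"] l[of "g \<otimes>\<^bsub>torus d\<^esub> inv\<^bsub>torus d\<^esub> h'"]
      by (auto simp: K_K scaleR_diff_left[symmetric])
    have Ke: "K g e = - (c *\<^sub>R b)" if g: "g \<in> T" and c: "K g b = c *\<^sub>R e" for g c
    proof -
      obtain c' where "K g (K h b) = c' *\<^sub>R b" using KK[OF g h(1)] by blast
      then have c': "K g e = (c' / n) *\<^sub>R b" using n by (simp add: e_def linear_scale[OF linear_K[OF g]] divide_inverse mult.commute)
      have "c' / n = b \<bullet> K g e" using b by (simp add: c')
      also have "\<dots> = - (K g b \<bullet> e)" using K_skew[OF g, of b e] by simp
      also have "\<dots> = - c" using ee by (simp add: c)
      finally show ?thesis using c' by simp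
    qed
    have Khe: "K h e = - (n *\<^sub>R b)" by (rule Ke[OF h(1) Kh])
    have "\<exists>c. K g b = c *\<^sub>R e \<and> K g e = - (c *\<^sub>R b)" if g: "g \<in> T" for g
    proof -
      obtain c where c: "K h (K g b) = c *\<^sub>R b" using KK[OF h(1) g] by blast
      have "K g (K h (K h b)) = K h (K h (K g b))"
        using g h by (simp add: K_K_commute[of g h])
      then have "K g (n *\<^sub>R (- (n *\<^sub>R b))) = (c * n) *\<^sub>R e"
        by (simp add: c Kh Khe linear_scale[OF linear_K[OF h(1)]])
      then have "- ((n * n) *\<^sub>R K g b) = (c * n) *\<^sub>R e"
        by (simp add: linear_scale[OF linear_K[OF g]] linear_neg[OF linear_K[OF g]])
      then have "(n * n) *\<^sub>R K g b = - ((c * n) *\<^sub>R e)" by (metis minus_minus)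
      then have "(1 / (n * n)) *\<^sub>R ((n * n) *\<^sub>R K g b) = (1 / (n * n)) *\<^sub>R (- ((c * n) *\<^sub>R e))" by simp
      then have "K g b = (1 / (n * n) * (- (c * n))) *\<^sub>R e" using n by simp
      then show ?thesis using Ke[OF g] by blast
    qed
    moreover have "b \<bullet> e = 0" using Kb[OF h(1)] by (simp add: e_def)
    moreover have "e = (1 / n) *\<^sub>R K h b" by (simp add: e_def divide_inverse)
    ultimately show ?thesis using ee h(1) by blast
  qed
  then obtain e h0 n0 where e0: "h0 \<in> T" "e = n0 *\<^sub>R K h0 b" and e: "e \<bullet> e = 1 \<or> e = 0" "b \<bullet> e = 0" "\<And>g. g \<in> T \<Longrightarrow> \<exists>c. K g b = c *\<^sub>R e \<and> K g e = - (c *\<^sub>R b)" by blast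
  define \<alpha> where "\<alpha> g = b \<bullet> R g b" for g
  define \<beta> where "\<beta> g = e \<bullet> R g b" for g
  have RAK: "2 *\<^sub>R R g x = A g x + K g x" for g x by (simp add: A_def K_def scaleR_2)
  have Rb: "R g b = \<alpha> g *\<^sub>R b + \<beta> g *\<^sub>R e" and Ab: "A g b = (2 * \<alpha> g) *\<^sub>R b"
    and Ke: "K g e = - ((2 * \<beta> g) *\<^sub>R b)" if g: "g \<in> T" for g
  proof -
    obtain c where c: "K g b = c *\<^sub>R e" "K g e = - (c *\<^sub>R b)" using e(3)[OF g] by blast
    have "2 *\<^sub>R R g b = l g *\<^sub>R b + c *\<^sub>R e" by (simp add: RAK l[OF g] c(1))
    then have "(1/2) *\<^sub>R (2 *\<^sub>R R g b) = (1/2) *\<^sub>R (l g *\<^sub>R b + c *\<^sub>R e)" by simp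
    then have r: "R g b = (l g / 2) *\<^sub>R b + (c / 2) *\<^sub>R e" by (simp add: scaleR_add_right)
    have a: "\<alpha> g = l g / 2" using b e(2) by (simp add: \<alpha>_def r inner_add_right)
    show 1: "A g b = (2 * \<alpha> g) *\<^sub>R b" by (simp add: a l[OF g])
    have "e = 0 \<or> \<beta> g = c / 2" using e(1,2) by (auto simp: \<beta>_def r inner_add_right inner_commute)
    then have be: "(c / 2) *\<^sub>R e = \<beta> g *\<^sub>R e" by auto
    show "R g b = \<alpha> g *\<^sub>R b + \<beta> g *\<^sub>R e" using r a be by simp
    show "K g e = - ((2 * \<beta> g) *\<^sub>R b)"
    proof (cases "e = 0")
      case True
      then show ?thesis by (simp add: \<beta>_def linear_0[OF linear_K[OF g]])
    next
      case False
      then have "c = 2 * \<beta> g" using \<open>e = 0 \<or> \<beta> g = c / 2\<close> by simp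
      then show ?thesis using c(2) by simp
    qed
  qed
  have Re: "R g e = \<alpha> g *\<^sub>R e - \<beta> g *\<^sub>R b" if g: "g \<in> T" for g
  proof -
    have "A g (K h0 b) = K h0 (A g b)"
      using g e0(1) by (simp add: A_def K_R_commute linear_add[OF linear_K])
    then have "A g e = (2 * \<alpha> g) *\<^sub>R e"
      by (simp add: e0(2) linear_scale[OF linear_A[OF g]] Ab[OF g] linear_scale[OF linear_K[OF e0(1)]])
    then have "2 *\<^sub>R R g e = (2 * \<alpha> g) *\<^sub>R e - (2 * \<beta> g) *\<^sub>R b" by (simp add: RAK Ke[OF g])
    then have "(1/2) *\<^sub>R (2 *\<^sub>R R g e) = (1/2) *\<^sub>R ((2 * \<alpha> g) *\<^sub>R e - (2 * \<beta> g) *\<^sub>R b)" by simp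
    then show ?thesis by (simp add: scaleR_diff_right)
  qed
  define u where "u g = Complex (\<alpha> g) (\<beta> g)" for g
  have \<beta>e: "\<beta> g * (e \<bullet> e) = \<beta> g" for g using e(1) by (auto simp: \<beta>_def)
  have mult_chi: "u (g \<otimes>\<^bsub>torus d\<^esub> h) = u g * u h" if gh: "g \<in> T" "h \<in> T" for g h
  proof -
    have r: "R (g \<otimes>\<^bsub>torus d\<^esub> h) b = \<alpha> h *\<^sub>R (\<alpha> g *\<^sub>R b + \<beta> g *\<^sub>R e) + \<beta> h *\<^sub>R (\<alpha> g *\<^sub>R e - \<beta> g *\<^sub>R b)"
      using gh by (simp add: mult Rb[OF gh(2)] linear_add[OF lin] linear_scale[OF lin] Rb[OF gh(1)] Re[OF gh(1)])
    have "\<alpha> (g \<otimes>\<^bsub>torus d\<^esub> h) = \<alpha> h * \<alpha> g - \<beta> h * \<beta> g"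
      unfolding \<alpha>_def[of "g \<otimes>\<^bsub>torus d\<^esub> h"] r
      by (simp add: inner_add_right inner_diff_right b e(2))
    moreover have "\<beta> (g \<otimes>\<^bsub>torus d\<^esub> h) = \<alpha> h * (\<beta> g * (e \<bullet> e)) + (\<beta> h * (e \<bullet> e)) * \<alpha> g"
      unfolding \<beta>_def[of "g \<otimes>\<^bsub>torus d\<^esub> h"] r
      by (simp add: inner_add_right inner_diff_right e(2) inner_commute[of e b] algebra_simps)
    ultimately show ?thesis by (simp add: u_def complex_eq_iff \<beta>e mult.commute)
  qed
  have norm_chi: "cmod (u g) = 1" if g: "g \<in> T" for g
  proof -
    have "1 = R g b \<bullet> R g b" using iso[OF g] b by simp
    also have "\<dots> = (\<alpha> g)\<^sup>2 + \<beta> g * (\<beta> g * (e \<bullet> e))"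
      by (simp add: Rb[OF g] inner_add_left inner_add_right b e(2) inner_commute[of e b] power2_eq_square)
    finally show ?thesis by (simp add: u_def cmod_def \<beta>e power2_eq_square)
  qed
  have "continuous_map euclidean euclidean (\<lambda>v. Complex (b \<bullet> v) (e \<bullet> v))"
    by (auto simp: Complex_eq intro!: continuous_intros)
  then have "continuous_map (torus_topology d) euclidean ((\<lambda>v. Complex (b \<bullet> v) (e \<bullet> v)) \<circ> (\<lambda>g. R g b))"
    by (rule continuous_map_compose[OF cont])
  then have "continuous_map (torus_topology d) euclidean u" 
    by (simp add: o_def u_def[abs_def] \<alpha>_def \<beta>_def)
  moreover have "u \<in> hom (torus d) circle_group"
    using mult_chi norm_chi by (auto simp: hom_def circle_group_def)
  ultimately obtain m where m: "\<And>g. g \<in> T \<Longrightarrow> u g = character d m g"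
    using torus_character by blast
  have "weight b m" unfolding weight_def
  proof
    fix g assume g: "g \<in> T"
    have "Re (character d m g) = \<alpha> g" unfolding m[OF g, symmetric] u_def by simp
    then show "A g b = (2 * Re (character d m g)) *\<^sub>R b" by (simp only: Ab[OF g])
  qed
  then show ?thesis by blast
qed

end

locale weighted_torus_action = torus_action +
  fixes B :: "'a::euclidean_space set" and wt :: "'a \<Rightarrow> nat \<Rightarrow> int"
  assumes finite_B: "finite B" and orthonormal_B: "orthonormal B"
    and wt: "b \<in> B \<Longrightarrow> weight b (wt b)"
    and expand: "x = (\<Sum>b\<in>B. (x \<bullet> b) *\<^sub>R b)"
begin

text \<open>If the character is trivial at \<open>g\<close> then \<open>R g b \<bullet> b = b \<bullet> b\<close>, which forces equality in the Cauchy-Schwarz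
inequality because \<open>R g\<close> is an isometry.\<close>

lemma fixed_basis_vector:
  assumes b: "b \<in> B" and g: "g \<in> T" and ch: "character d (wt b) g = 1"
  shows "R g b = b"
proof -
  have "A g b = 2 *\<^sub>R b" using wt[OF b] g ch by (simp add: weight_def)
  moreover have "A g b \<bullet> b = 2 * (R g b \<bullet> b)"
    by (simp add: A_def inner_add_left R_adjoint'[OF g] inner_commute[of b "R g b"])
  ultimately have 1: "R g b \<bullet> b = b \<bullet> b" by simp
  have "(R g b - b) \<bullet> (R g b - b) = 0"
    by (simp add: inner_diff_left inner_diff_right iso[OF g] 1 inner_commute[of b "R g b"])
  then show ?thesis by simp
qed

lemma fixed_iff:
  assumes g: "g \<in> T"
  shows "R g x = x \<longleftrightarrow> (\<forall>b\<in>B. x \<bullet> b \<noteq> 0 \<longrightarrow> character d (wt b) g = 1)"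
proof
  assume fx: "R g x = x"
  then have "R (inv\<^bsub>torus d\<^esub> g) x = x" using R_inv(2)[OF g, of x] by simp
  then have Ax: "A g x = 2 *\<^sub>R x" by (simp add: A_def fx scaleR_2)
  show "\<forall>b\<in>B. x \<bullet> b \<noteq> 0 \<longrightarrow> character d (wt b) g = 1"
  proof (intro ballI impI)
    fix b assume b: "b \<in> B" "x \<bullet> b \<noteq> 0"
    have "2 * (x \<bullet> b) = A g x \<bullet> b" by (simp add: Ax)
    also have "\<dots> = x \<bullet> A g b" by (rule A_self_adjoint[OF g])
    also have "\<dots> = 2 * Re (character d (wt b) g) * (x \<bullet> b)"
      using wt[OF b(1)] g by (simp add: weight_def)
    finally have "Re (character d (wt b) g) = 1" using b by simp
    moreover have "cmod (character d (wt b) g) = 1" by (rule norm_character[OF g])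
    ultimately show "character d (wt b) g = 1"
      by (simp add: complex_eq_iff cmod_def)
  qed
next
  assume ch: "\<forall>b\<in>B. x \<bullet> b \<noteq> 0 \<longrightarrow> character d (wt b) g = 1"
  have "R g x = R g (\<Sum>b\<in>B. (x \<bullet> b) *\<^sub>R b)" using arg_cong[OF expand, of "R g" x] .
  also have "\<dots> = (\<Sum>b\<in>B. (x \<bullet> b) *\<^sub>R R g b)"
    by (simp add: linear_sum[OF lin[OF g]] linear_scale[OF lin[OF g]])
  also have "\<dots> = (\<Sum>b\<in>B. (x \<bullet> b) *\<^sub>R b)"
    using ch fixed_basis_vector[OF _ g] by (intro sum.cong) auto
  also have "\<dots> = x" by (rule expand[symmetric])
  finally show "R g x = x" .
qed

end

context torus_action
begin

lemma exists_weight_basis: "\<exists>B wt. weighted_torus_action d R B wt"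
proof -
  have "\<exists>B. finite B \<and> B \<subseteq> UNIV \<and> orthonormal B \<and> (\<forall>b\<in>B. \<forall>i\<in>T. \<exists>c. A i b = c *\<^sub>R b) \<and>
    (\<forall>x\<in>UNIV. x = (\<Sum>b\<in>B. (x \<bullet> b) *\<^sub>R b))"
    by (rule joint_eigenbasis) (auto simp: linear_A A_self_adjoint A_commute)
  then obtain B where B: "finite B" "orthonormal B" "\<forall>b\<in>B. \<forall>i\<in>T. \<exists>c. A i b = c *\<^sub>R b"
    "\<forall>x\<in>UNIV. x = (\<Sum>b\<in>B. (x \<bullet> b) *\<^sub>R b)" by blast
  have "\<exists>m. weight b m" if "b \<in> B" for b
    using exists_weight[of b] that B(2,3) by (auto simp: orthonormal_def)
  then obtain wt where "\<And>b. b \<in> B \<Longrightarrow> weight b (wt b)" by metis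
  then have "weighted_torus_action d R B wt"
    using B by unfold_locales auto
  then show ?thesis by blast
qed

end

definition dot :: "nat \<Rightarrow> (nat \<Rightarrow> int) \<Rightarrow> (nat \<Rightarrow> real) \<Rightarrow> real" where
  "dot d m t = (\<Sum>i<d. of_int (m i) * t i)"

lemma character_torus_exp_dot: "character d m (torus_exp d t) = cis (dot d m t)"
  by (simp add: character_torus_exp dot_def)

lemma cis_line_eq_1: 
  assumes "\<And>s. cis (s * c) = 1" shows "c = 0"
proof (rule ccontr)
  assume "c \<noteq> 0"
  then have "cis pi = 1" using assms[of "pi / c"] by simp
  then show False by simp
qed

lemma torus_exp_line_trivial:
  assumes "\<And>s. torus_exp d (\<lambda>i. s * t i) = \<one>\<^bsub>torus d\<^esub>"
  shows "\<forall>i<d. t i = 0"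
proof (intro allI impI, rule cis_line_eq_1)
  fix i s assume i: "i < d"
  have "torus_exp d (\<lambda>i. s * t i) i = \<one>\<^bsub>torus d\<^esub> i" by (simp only: assms)
  then show "cis (s * t i) = 1" using i by (simp add: torus_exp_def one_torus)
qed

section \<open>Splitting the weights\<close>

lemma card_le_DIM_if_independent_family:
  fixes u :: "nat \<Rightarrow> 'a::euclidean_space"
  assumes ind: "\<And>t. (\<Sum>i<d. t i *\<^sub>R u i) = 0 \<Longrightarrow> \<forall>i<d. t i = 0"
  shows "d \<le> DIM('a)"
proof -
  have inj: "inj_on u {..<d}"
  proof (rule inj_onI, rule ccontr)
    fix i j assume ij: "i \<in> {..<d}" "j \<in> {..<d}" "u i = u j" "i \<noteq> j"
    define t where "t k = (if k = i then 1 else 0) - (if k = j then 1 else (0::real))" for k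
    have "t k *\<^sub>R u k = (if k = i then u i else 0) - (if k = j then u j else 0)" for k
      by (simp add: t_def)
    then have "(\<Sum>k<d. t k *\<^sub>R u k) = (\<Sum>k<d. (if k = i then u i else 0)) - (\<Sum>k<d. (if k = j then u j else 0))"
      by (simp only: sum_subtractf)
    also have "\<dots> = u i - u j" using ij(1,2) by simp
    also have "\<dots> = 0" using ij(3) by (rule right_minus_eq[THEN iffD2])
    finally have "t i = 0" using ind[of t] ij(1) by simp
    then show False using ij(4) by (simp add: t_def)
  qed
  have fin: "finite (u ` {..<d})" by simp
  have "independent (u ` {..<d})"
  proof (rule independent_if_scalars_zero[OF fin])
    fix f x assume f: "(\<Sum>y\<in>u ` {..<d}. f y *\<^sub>R y) = 0" "x \<in> u ` {..<d}"
    obtain i where i: "i < d" "x = u i" using f(2) by blast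
    have "(\<Sum>i<d. f (u i) *\<^sub>R u i) = (\<Sum>y\<in>u ` {..<d}. f y *\<^sub>R y)"
      by (rule sum.reindex_cong[OF inj, symmetric]) auto
    also note f(1)
    finally show "f x = 0" using ind[of "\<lambda>i. f (u i)"] i by simp
  qed
  then have "card (u ` {..<d}) \<le> DIM('a)" by (rule conjunct2[OF independent_bound])
  then show ?thesis by (simp add: card_image[OF inj])
qed

locale faithful_weighted_torus_action = weighted_torus_action +
  assumes faithful: "g \<in> T \<Longrightarrow> (\<And>x. R g x = x) \<Longrightarrow> g = \<one>\<^bsub>torus d\<^esub>"
begin

text \<open>A direction \<open>t\<close> annihilated by all weights generates a one-parameter subgroup that acts trivially.\<close>

lemma weights_separate:
  assumes "\<And>b. b \<in> B \<Longrightarrow> dot d (wt b) t = 0"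
  shows "\<forall>i<d. t i = 0"
proof (rule torus_exp_line_trivial)
  fix s
  show "torus_exp d (\<lambda>i. s * t i) = \<one>\<^bsub>torus d\<^esub>"
  proof (rule faithful)
    fix x
    have "character d (wt b) (torus_exp d (\<lambda>i. s * t i)) = 1" if "b \<in> B" for b
    proof -
      have "dot d (wt b) (\<lambda>i. s * t i) = s * dot d (wt b) t"
        by (simp add: dot_def sum_distrib_left mult_ac)
      then show ?thesis using assms[OF that] by (simp add: character_torus_exp_dot)
    qed
    then show "R (torus_exp d (\<lambda>i. s * t i)) x = x" by (simp add: fixed_iff)
  qed simp
qed

text \<open>The columns \<open>u i\<close> of the weight matrix are \<open>d\<close> independent vectors of the representation
space.  Hence the weights can be placed into the representation space itself, which serves as an
ambient Euclidean space of sufficient dimension for the combinatorial theorem.\<close>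

lemma rank_le_DIM: "d \<le> DIM('a)"
proof -
  define u where "u i = (\<Sum>b\<in>B. of_int (wt b i) *\<^sub>R b)" for i
  have ub: "u i \<bullet> b = of_int (wt b i)" if "b \<in> B" for i b
  proof -
    have "u i \<bullet> b = (\<Sum>b'\<in>B. if b' = b then of_int (wt b' i) else 0)"
      unfolding u_def inner_sum_left using that orthonormal_B
      by (intro sum.cong) (auto simp: orthonormal_def)
    then show ?thesis using that finite_B by simp
  qed
  have ind: "\<forall>i<d. t i = 0" if "(\<Sum>i<d. t i *\<^sub>R u i) = 0" for t
  proof (rule weights_separate)
    fix b assume b: "b \<in> B"
    have "dot d (wt b) t = (\<Sum>i<d. t i *\<^sub>R u i) \<bullet> b"
      by (simp add: inner_sum_left ub[OF b] dot_def mult.commute)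
    then show "dot d (wt b) t = 0" by (simp add: that)
  qed
  show ?thesis by (rule card_le_DIM_if_independent_family[where u = u and d = d]) (rule ind)
qed

definition signed_weight :: "(nat \<Rightarrow> int) \<Rightarrow> bool" where
  "signed_weight m \<longleftrightarrow> (\<exists>b\<in>B. m = wt b \<or> m = (\<lambda>i. - wt b i))"

text \<open>The form in which \<open>exists_split_sublattice\<close> is used.  The vectors \<open>q\<close> and \<open>f j\<close> are independent, which
is expressed by solvability of the inhomogeneous system and by a kernel spanned by \<open>\<tau>\<close>.\<close>

lemma split_weights:
  assumes d: "d \<ge> 2"
  obtains q f \<tau> where "signed_weight q" "\<And>j. j < d - 2 \<Longrightarrow> signed_weight (f j)"
    "\<And>\<theta>0 \<theta>. \<exists>t. dot d q t = \<theta>0 \<and> (\<forall>j<d-2. dot d (f j) t = \<theta> j)"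
    "\<exists>i<d. \<tau> i \<noteq> 0" "dot d q \<tau> = 0" "\<And>j. j < d - 2 \<Longrightarrow> dot d (f j) \<tau> = 0"
    "\<And>t. dot d q t = 0 \<Longrightarrow> (\<And>j. j < d - 2 \<Longrightarrow> dot d (f j) t = 0) \<Longrightarrow> \<exists>s. \<forall>i<d. t i = s * \<tau> i"
    "\<And>b n k. b \<in> B \<Longrightarrow> (\<And>i. i < d \<Longrightarrow> wt b i = n * q i + (\<Sum>j<d-2. k j * f j i)) \<Longrightarrow>
       (\<exists>n'. \<forall>i<d. wt b i = n' * q i) \<or> (\<exists>k'. \<forall>i<d. wt b i = (\<Sum>j<d-2. k' j * f j i))"
proof -
  obtain w :: "nat \<Rightarrow> 'a" where w: "inj_on w {..<d}" "w ` {..<d} \<subseteq> Basis"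
    using card_le_inj[of "{..<d}" "Basis :: 'a set"] rank_le_DIM by auto
  have ww: "w i \<bullet> w j = (if i = j then 1 else 0)" if "i < d" "j < d" for i j
    using that w by (auto simp: inner_Basis inj_on_def image_subset_iff)
  \<comment> \<open>The lattice is embedded isometrically by means of orthonormal vectors w i.\<close>
  define \<iota> where "\<iota> m = (\<Sum>i<d. of_int (m i) *\<^sub>R w i)" for m :: "nat \<Rightarrow> int"
  define W where "W = span (w ` {..<d})"
  have \<iota>W: "\<iota> m \<in> W" for m by (auto simp: \<iota>_def W_def intro!: span_sum span_scale intro: span_base)
  have \<iota>w: "\<iota> m \<bullet> w i = of_int (m i)" if "i < d" for m i
  proof -
    have "\<iota> m \<bullet> w i = (\<Sum>j<d. if j = i then of_int (m j) else 0)"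
      unfolding \<iota>_def inner_sum_left using that by (intro sum.cong) (auto simp: ww)
    then show ?thesis using that by simp
  qed
  have \<iota>x: "\<iota> m \<bullet> x = dot d m (\<lambda>i. w i \<bullet> x)" for m x
    by (simp add: \<iota>_def inner_sum_left dot_def)
  define vec where "vec t = (\<Sum>i<d. t i *\<^sub>R w i)" for t
  have vecW: "vec t \<in> W" for t by (auto simp: vec_def W_def intro!: span_sum span_scale intro: span_base)
  have wvec: "w i \<bullet> vec t = t i" if "i < d" for i t
  proof -
    have "w i \<bullet> vec t = (\<Sum>j<d. if j = i then t j else 0)"
      unfolding vec_def inner_sum_right using that by (intro sum.cong) (auto simp: ww)
    then show ?thesis using that by simp
  qed
  have \<iota>vec: "\<iota> m \<bullet> vec t = dot d m t" for m t
    unfolding \<iota>x dot_def by (intro sum.cong) (auto simp: wvec)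
  have W0: "x = 0" if "x \<in> W" "\<And>i. i < d \<Longrightarrow> w i \<bullet> x = 0" for x
  proof -
    have "x \<bullet> x = 0"
      by (rule inner_zero_on_span[of x "w ` {..<d}"]) (use that in \<open>auto simp: W_def inner_commute\<close>)
    then show ?thesis by simp
  qed
  have dimW: "dim W = d"
  proof -
    have "independent (w ` {..<d})" using w(2) independent_Basis independent_mono by blast
    then show ?thesis using w(1) by (simp add: W_def dim_eq_card_independent card_image)
  qed
  define S where "S = (\<lambda>b. \<iota> (wt b)) ` B \<union> (\<lambda>b. \<iota> (\<lambda>i. - wt b i)) ` B"
  have \<iota>neg: "\<iota> (\<lambda>i. - m i) = - \<iota> m" for m by (simp add: \<iota>_def sum_negf)
  have finS: "finite S" using finite_B by (simp add: S_def)
  have symS: "s \<in> S \<Longrightarrow> - s \<in> S" for s by (auto simp: S_def \<iota>neg)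
  have Ssw: "\<exists>m. signed_weight m \<and> \<iota> m = s" if "s \<in> S" for s
    using that unfolding S_def signed_weight_def by blast
  have SW: "S \<subseteq> W" by (auto simp: S_def \<iota>W)
  have spanS: "span S = W"
  proof (rule ccontr)
    assume "span S \<noteq> W"
    moreover have "span S \<subseteq> W" using SW unfolding W_def by (simp add: span_minimal)
    moreover have spanW: "span W = W" unfolding W_def by (rule span_span)
    ultimately have "span S \<subset> span W" by blast
    then obtain x where x: "x \<noteq> 0" "x \<in> span W" "\<And>y. y \<in> span S \<Longrightarrow> real_inner_class.orthogonal x y"
      using orthogonal_to_subspace_exists_gen by blast
    have "\<forall>i<d. w i \<bullet> x = 0"
    proof (rule weights_separate)
      fix b assume "b \<in> B"
      then have "\<iota> (wt b) \<in> span S" by (auto simp: S_def intro: span_base)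
      then have "x \<bullet> \<iota> (wt b) = 0" using x(3) by (simp add: real_inner_class.orthogonal_def)
      then have "\<iota> (wt b) \<bullet> x = 0" by (simp only: inner_commute)
      then show "dot d (wt b) (\<lambda>i. w i \<bullet> x) = 0" by (simp add: \<iota>x)
    qed
    then show False using W0[of x] x(1,2) unfolding spanW by blast
  qed
  then have dimS: "dim S = d" using dimW by (metis dim_span)
  have dimS2: "dim S \<ge> 2" using d dimS by simp
  obtain q0 C where qC: "q0 \<in> S" "C \<subseteq> S" "q0 \<notin> C" "independent (insert q0 C)" "card C + 2 = dim S"
    "S \<inter> int_span (insert q0 C) \<subseteq> int_span {q0} \<union> int_span C"
    by (rule exists_split_sublattice[OF finS symS dimS2])
  have finC: "finite C" using qC(2) finS finite_subset by blast
  have cardC: "card C = d - 2" using qC(5) dimS by simp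
  obtain c where c: "bij_betw c {..<d-2} C"
    using finite_same_card_bij[of "{..<d-2}" C] finC cardC by auto
  obtain q where q: "signed_weight q" "\<iota> q = q0" using Ssw[OF qC(1)] by blast
  have "\<exists>m. signed_weight m \<and> \<iota> m = c j" if "j < d - 2" for j
    using Ssw qC(2) c that by (auto simp: bij_betw_def)
  then have "\<exists>f. \<forall>j<d-2. signed_weight (f j) \<and> \<iota> (f j) = c j" by metis
  then obtain f where f: "\<And>j. j < d - 2 \<Longrightarrow> signed_weight (f j)" "\<And>j. j < d - 2 \<Longrightarrow> \<iota> (f j) = c j"
    by blast
  have cC: "c j \<in> C" if "j < d - 2" for j using c that by (auto simp: bij_betw_def)
  have Cc: "\<exists>j<d-2. c j = y" if "y \<in> C" for y using c that by (auto simp: bij_betw_def)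
  let ?I = "insert q0 C"
  have surj: "\<exists>t. dot d q t = \<theta>0 \<and> (\<forall>j<d-2. dot d (f j) t = \<theta> j)" for \<theta>0 \<theta>
  proof -
    have "flat ?I (span ?I)" unfolding flat_def by (simp add: Int_absorb2 span_superset)
    then obtain B' z where D: "dual_system ?I {0} (span ?I) B' z"
      using exists_dual_system[of ?I "span ?I" "{0}"] finC by (auto simp: span_zero)
    have B': "B' \<subseteq> ?I" "span ?I = span B'" 
      "\<And>b b'. b \<in> B' \<Longrightarrow> b' \<in> B' \<Longrightarrow> z b \<bullet> b' = (if b = b' then 1 else 0)"
      using D by (auto simp: dual_system_def)
    have B'I: "B' = ?I"
    proof (rule ccontr)
      assume "B' \<noteq> ?I"
      then obtain y where y: "y \<in> ?I" "y \<notin> B'" using B'(1) by blast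
      then have "y \<in> span (?I - {y})" using B' span_mono[of B' "?I - {y}"] span_base[OF y(1)] by blast
      then show False using qC(4) y(1) unfolding dependent_def by blast
    qed
    define g where "g y = (if y = q0 then \<theta>0 else \<theta> (inv_into {..<d-2} c y))" for y
    define x where "x = (\<Sum>y\<in>?I. g y *\<^sub>R z y)"
    have xy: "y \<bullet> x = g y" if "y \<in> ?I" for y
    proof -
      have "y \<bullet> x = (\<Sum>y'\<in>?I. if y' = y then g y' else 0)"
        unfolding x_def inner_sum_right using that B'(3) unfolding B'I
        by (intro sum.cong) (auto simp: inner_commute[of y "z _"])
      then show ?thesis using that finC by simp
    qed
    have "dot d q (\<lambda>i. w i \<bullet> x) = \<theta>0" using xy[of q0] q(2) \<iota>x[of q x] by (simp add: g_def)
    moreover have "dot d (f j) (\<lambda>i. w i \<bullet> x) = \<theta> j" if "j < d - 2" for j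
    proof -
      have "c j \<noteq> q0" using cC[OF that] qC(3) by auto
      moreover have "inv_into {..<d-2} c (c j) = j" using c that by (auto simp: bij_betw_def)
      ultimately show ?thesis using xy[of "c j"] cC[OF that] f(2)[OF that] \<iota>x[of "f j" x] by (simp add: g_def)
    qed
    ultimately show ?thesis by blast
  qed
  define N where "N = {y \<in> W. \<forall>x\<in>span ?I. real_inner_class.orthogonal x y}"
  have IW: "span ?I \<subseteq> W" using qC(1,2) SW unfolding W_def by (intro span_minimal) auto
  have "dim N + dim (span ?I) = dim W" unfolding N_def
    using IW by (intro dim_subspace_orthogonal_to_vectors) (auto simp: W_def)
  moreover have "dim (span ?I) = d - 1"
    using qC(3,4) finC cardC d by (simp add: dim_eq_card_independent)
  ultimately have dimN: "dim N = 1" using dimW d by simp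
  have NI: "y \<in> N \<longleftrightarrow> y \<in> W \<and> q0 \<bullet> y = 0 \<and> (\<forall>j<d-2. c j \<bullet> y = 0)" for y
  proof
    assume "y \<in> N"
    then show "y \<in> W \<and> q0 \<bullet> y = 0 \<and> (\<forall>j<d-2. c j \<bullet> y = 0)"
      using cC by (auto simp: N_def real_inner_class.orthogonal_def intro!: span_base)
  next
    assume y: "y \<in> W \<and> q0 \<bullet> y = 0 \<and> (\<forall>j<d-2. c j \<bullet> y = 0)"
    have "y \<bullet> x = 0" if "x \<in> span ?I" for x
      using that
    proof (rule inner_zero_on_span)
      fix k assume "k \<in> ?I"
      then consider "k = q0" | j where "j < d - 2" "k = c j" using Cc by blast
      then have "k \<bullet> y = 0" using y by cases auto
      then show "y \<bullet> k = 0" by (simp only: inner_commute)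
    qed
    then show "y \<in> N" using y by (simp add: N_def real_inner_class.orthogonal_def inner_commute)
  qed
  obtain BN where BN: "BN \<subseteq> N" "independent BN" "N \<subseteq> span BN" "card BN = dim N"
    by (rule basis_exists)
  then obtain v where v: "BN = {v}" unfolding dimN by (auto simp: card_1_singleton_iff)
  define \<tau> where "\<tau> i = w i \<bullet> v" for i
  have vN: "v \<in> N" and v0: "v \<noteq> 0" using BN v by auto
  have r1: "\<exists>i<d. \<tau> i \<noteq> 0" using W0[of v] vN v0 by (auto simp: NI \<tau>_def)
  have r2: "dot d q \<tau> = 0" using vN q(2) \<iota>x[of q v] by (simp add: NI \<tau>_def[abs_def])
  have r3: "dot d (f j) \<tau> = 0" if "j < d - 2" for j
    using vN f(2)[OF that] that \<iota>x[of "f j" v] by (simp add: NI \<tau>_def[abs_def])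
  have r4: "\<exists>s. \<forall>i<d. t i = s * \<tau> i" if t: "dot d q t = 0" "\<And>j. j < d - 2 \<Longrightarrow> dot d (f j) t = 0" for t
  proof -
    have "q0 \<bullet> vec t = 0" using \<iota>vec[of q t] q(2) t(1) by simp
    moreover have "c j \<bullet> vec t = 0" if "j < d - 2" for j
      using \<iota>vec[of "f j" t] f(2)[OF that] t(2)[OF that] by simp
    ultimately have "vec t \<in> N" unfolding NI using vecW by blast
    then obtain s where "vec t = s *\<^sub>R v" using BN(3) by (auto simp: v span_singleton)
    then have "t i = s * \<tau> i" if "i < d" for i using wvec[OF that, of t] by (simp add: \<tau>_def)
    then show ?thesis by blast
  qed
  have r5: "(\<exists>n'. \<forall>i<d. wt b i = n' * q i) \<or> (\<exists>k'. \<forall>i<d. wt b i = (\<Sum>j<d-2. k' j * f j i))"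
    if b: "b \<in> B" and nk: "\<And>i. i < d \<Longrightarrow> wt b i = n * q i + (\<Sum>j<d-2. k j * f j i)" for b n k
  proof -
    have combo: "\<iota> m = (\<Sum>j<d-2. of_int (k j) *\<^sub>R c j)" if "\<And>i. i < d \<Longrightarrow> m i = (\<Sum>j<d-2. k j * f j i)" for m k
    proof -
      have "\<iota> m = (\<Sum>i<d. \<Sum>j<d-2. (of_int (k j) * of_int (f j i)) *\<^sub>R w i)"
        unfolding \<iota>_def using that by (intro sum.cong) (auto simp: scaleR_sum_left)
      also have "\<dots> = (\<Sum>j<d-2. of_int (k j) *\<^sub>R \<iota> (f j))"
        by (subst sum.swap) (simp add: \<iota>_def scaleR_sum_right)
      finally show ?thesis by (simp add: f(2))
    qed
    define m2 where "m2 i = (\<Sum>j<d-2. k j * f j i)" for i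
    have "\<iota> (wt b) = of_int n *\<^sub>R \<iota> q + \<iota> m2"
      unfolding \<iota>_def scaleR_sum_right sum.distrib[symmetric]
      using nk by (intro sum.cong) (auto simp: m2_def scaleR_add_left[symmetric])
    also have "\<iota> m2 = (\<Sum>j<d-2. of_int (k j) *\<^sub>R c j)" by (rule combo) (simp add: m2_def)
    also have "of_int n *\<^sub>R \<iota> q + (\<Sum>j<d-2. of_int (k j) *\<^sub>R c j) \<in> int_span ?I"
      using finC cC by (intro int_span_add int_span_sum int_span_scale int_span_base) (auto simp: q(2))
    finally have "\<iota> (wt b) \<in> int_span ?I" .
    moreover have "\<iota> (wt b) \<in> S" using b unfolding S_def by blast
    ultimately have "\<iota> (wt b) \<in> S \<inter> int_span ?I" by blast
    then consider "\<iota> (wt b) \<in> int_span {q0}" | "\<iota> (wt b) \<in> int_span C" using qC(6) by blast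
    then show ?thesis
    proof cases
      case 1
      then obtain n0 where n0: "\<iota> (wt b) = (\<Sum>y\<in>{q0}. of_int (n0 y) *\<^sub>R y)"
        unfolding int_span_def by blast
      define n' :: int where "n' = n0 q0"
      have n': "\<iota> (wt b) = of_int n' *\<^sub>R \<iota> q" unfolding n0 q(2) by (simp add: n'_def)
      have "wt b i = n' * q i" if "i < d" for i
      proof -
        have "real_of_int (wt b i) = of_int (n' * q i)"
          using arg_cong[OF n', of "\<lambda>x. x \<bullet> w i"] \<iota>w[OF that] by simp
        then show ?thesis by linarith
      qed
      then show ?thesis by (intro disjI1 exI[of _ n']) simp
    next
      case 2
      then obtain k0 where k0: "\<iota> (wt b) = (\<Sum>y\<in>C. of_int (k0 y) *\<^sub>R y)"
        unfolding int_span_def by blast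
      also have "\<dots> = (\<Sum>j<d-2. of_int (k0 (c j)) *\<^sub>R c j)"
        by (rule sum.reindex_bij_betw[OF c, symmetric])
      also have "\<dots> = \<iota> (\<lambda>i. \<Sum>j<d-2. k0 (c j) * f j i)" by (rule combo[symmetric]) simp
      finally have e: "\<iota> (wt b) = \<iota> (\<lambda>i. \<Sum>j<d-2. k0 (c j) * f j i)" .
      have "wt b i = (\<Sum>j<d-2. k0 (c j) * f j i)" if "i < d" for i
        using arg_cong[OF e, of "\<lambda>x. x \<bullet> w i"] unfolding \<iota>w[OF that] by linarith
      then show ?thesis by (intro disjI2 exI[of _ "\<lambda>j. k0 (c j)"]) simp
    qed
  qed
  show ?thesis
  proof (rule that[of q f \<tau>])
    show "signed_weight q" by (rule q(1))
    show "signed_weight (f j)" if "j < d - 2" for j by (rule f(1)[OF that])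
    show "\<exists>t. dot d q t = \<theta>0 \<and> (\<forall>j<d-2. dot d (f j) t = \<theta> j)" for \<theta>0 \<theta> by (rule surj)
    show "\<exists>i<d. \<tau> i \<noteq> 0" by (rule r1)
    show "dot d q \<tau> = 0" by (rule r2)
    show "dot d (f j) \<tau> = 0" if "j < d - 2" for j by (rule r3[OF that])
    show "\<exists>s. \<forall>i<d. t i = s * \<tau> i" if "dot d q t = 0" "\<And>j. j < d - 2 \<Longrightarrow> dot d (f j) t = 0" for t
      using that by (rule r4)
    show "(\<exists>n'. \<forall>i<d. wt b i = n' * q i) \<or> (\<exists>k'. \<forall>i<d. wt b i = (\<Sum>j<d-2. k' j * f j i))"
      if "b \<in> B" "\<And>i. i < d \<Longrightarrow> wt b i = n * q i + (\<Sum>j<d-2. k j * f j i)" for b n k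
      using that by (rule r5)
  qed
qed

end

section \<open>Maps of tori given by characters\<close>

lemma compact_circle: "compact_space circle_topology"
  unfolding circle_topology_def by (rule compact_space_subtopology) simp

lemma Hausdorff_circle: "Hausdorff_space circle_topology"
  unfolding circle_topology_def by (rule Hausdorff_space_subtopology) simp

lemma compact_torus: "compact_space (torus_topology d)"
  unfolding torus_topology_def compact_space_product_topology using compact_circle by blast

lemma Hausdorff_torus: "Hausdorff_space (torus_topology d)"
  unfolding torus_topology_def Hausdorff_space_product_topology using Hausdorff_circle by blast

definition torus_map :: "nat \<Rightarrow> nat \<Rightarrow> (nat \<Rightarrow> nat \<Rightarrow> int) \<Rightarrow> (nat \<Rightarrow> complex) \<Rightarrow> nat \<Rightarrow> complex" where
  "torus_map d n a g = (\<lambda>k\<in>{..<n}. character d (a k) g)"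

lemma torus_map_in_carrier: "g \<in> carrier (torus d) \<Longrightarrow> torus_map d n a g \<in> carrier (torus n)"
  by (auto simp: torus_map_def carrier_torus[of n] norm_character)

lemma torus_map_hom: "torus_map d n a \<in> hom (torus d) (torus n)"
  by (auto simp: hom_def torus_map_in_carrier) (auto simp: torus_map_def mult_torus[of n] character_mult)

lemma continuous_torus_map: "continuous_map (torus_topology d) (torus_topology n) (torus_map d n a)"
  unfolding continuous_map_into_torus
  by (auto simp: torus_map_def continuous_character_circle)

lemma torus_map_torus_exp: "torus_map d n a (torus_exp d t) = torus_exp n (\<lambda>k. dot d (a k) t)"
  by (auto simp: torus_map_def torus_exp_def[of n] character_torus_exp_dot)

lemma torus_map_surj:
  assumes "\<And>\<theta>. \<exists>t. \<forall>k<n. dot d (a k) t = \<theta> k"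
  shows "torus_map d n a ` carrier (torus d) = carrier (torus n)"
proof
  show "torus_map d n a ` carrier (torus d) \<subseteq> carrier (torus n)" by (auto simp: torus_map_in_carrier)
  show "carrier (torus n) \<subseteq> torus_map d n a ` carrier (torus d)"
  proof
    fix z assume z: "z \<in> carrier (torus n)"
    obtain t where "\<forall>k<n. dot d (a k) t = Arg (z k)" using assms[of "\<lambda>k. Arg (z k)"] by blast
    then have "torus_map d n a (torus_exp d t) = torus_exp n (\<lambda>k. Arg (z k))"
      unfolding torus_map_torus_exp by (intro torus_exp_cong) simp
    then have "z = torus_map d n a (torus_exp d t)" using torus_exp_surj[OF z] by simp
    then show "z \<in> torus_map d n a ` carrier (torus d)" using torus_exp_in_carrier by blast
  qed
qed

lemma character_inj:
  assumes "\<And>t. cis (dot d m t) = cis (dot d c t)"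
  shows "\<forall>i<d. m i = c i"
proof (intro allI impI)
  fix i assume i: "i < d"
  have s: "(\<Sum>j<d. of_int (l j) * (if j = i then s else 0)) = of_int (l i) * s" for l :: "nat \<Rightarrow> int" and s :: real
  proof -
    have "(\<Sum>j<d. of_int (l j) * (if j = i then s else 0)) = (\<Sum>j<d. if j = i then of_int (l j) * s else 0)"
      by (intro sum.cong) auto
    then show ?thesis using i by simp
  qed
  have "of_int (m i) - of_int (c i) = (0 :: real)"
  proof (rule cis_line_eq_1)
    fix s :: real
    have "cis (of_int (m i) * s) = cis (of_int (c i) * s)"
      using assms[of "\<lambda>j. if j = i then s else 0"] unfolding dot_def s .
    then have "cis (of_int (m i) * s) / cis (of_int (c i) * s) = 1" by simp
    then show "cis (s * (of_int (m i) - of_int (c i))) = 1"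
      by (simp add: cis_divide algebra_simps)
  qed
  then show "m i = c i" by simp
qed

text \<open>Duality between subgroups and lattices: a character that is trivial on the kernel of a surjective map
of tori descends to the target, since the map is a quotient map, and the characters of the target
are known.\<close>

lemma character_factors:
  assumes surj: "\<And>\<theta>. \<exists>t. \<forall>k<n. dot d (a k) t = \<theta> k"
    and triv: "\<And>g. g \<in> carrier (torus d) \<Longrightarrow> torus_map d n a g = \<one>\<^bsub>torus n\<^esub> \<Longrightarrow> character d m g = 1"
  shows "\<exists>k. \<forall>i<d. m i = (\<Sum>j<n. k j * a j i)"
proof -
  let ?T = "carrier (torus d)" and ?P = "torus_map d n a"
  interpret G: Group.group "torus d" by (rule group_torus)
  interpret N: Group.group "torus n" by (rule group_torus)
  interpret h: group_hom "torus d" "torus n" ?P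
    by unfold_locales (rule torus_map_hom)
  have img: "?P ` ?T = carrier (torus n)" by (rule torus_map_surj[OF surj])
  have quot: "quotient_map (torus_topology d) (torus_topology n) ?P"
    using img by (intro continuous_imp_quotient_map continuous_torus_map compact_torus Hausdorff_torus)
      (simp add: topspace_torus_topology)
  have well: "character d m x = character d m y" if xy: "x \<in> ?T" "y \<in> ?T" "?P x = ?P y" for x y
  proof -
    let ?z = "x \<otimes>\<^bsub>torus d\<^esub> inv\<^bsub>torus d\<^esub> y"
    have "?P ?z = \<one>\<^bsub>torus n\<^esub>" using xy by simp
    then have "character d m ?z = 1" using xy by (intro triv) auto
    moreover have "x = ?z \<otimes>\<^bsub>torus d\<^esub> y" using xy by (simp add: G.m_assoc)
    ultimately show ?thesis using character_mult[of ?z d y m] xy by simp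
  qed
  obtain \<eta> where \<eta>: "continuous_map (torus_topology n) euclidean \<eta>"
    "\<And>x. x \<in> ?T \<Longrightarrow> \<eta> (?P x) = character d m x"
    using quotient_map_lift_exists[OF quot continuous_character[of d m]] well
    unfolding topspace_torus_topology by metis
  have hom: "\<eta> \<in> hom (torus n) circle_group"
  proof (rule homI)
    fix x assume "x \<in> carrier (torus n)"
    then obtain x' where "x' \<in> ?T" "x = ?P x'" using img by blast
    then show "\<eta> x \<in> carrier circle_group" by (simp add: \<eta>(2) circle_group_def norm_character)
  next
    fix x y assume "x \<in> carrier (torus n)" "y \<in> carrier (torus n)"
    then obtain x' y' where xy: "x' \<in> ?T" "x = ?P x'" "y' \<in> ?T" "y = ?P y'" using img by blast
    then have "\<eta> (x \<otimes>\<^bsub>torus n\<^esub> y) = \<eta> (?P (x' \<otimes>\<^bsub>torus d\<^esub> y'))" by simp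
    also have "\<dots> = \<eta> x * \<eta> y" using xy by (subst \<eta>(2)) (auto simp: \<eta>(2) character_mult)
    finally show "\<eta> (x \<otimes>\<^bsub>torus n\<^esub> y) = \<eta> x \<otimes>\<^bsub>circle_group\<^esub> \<eta> y" by (simp add: circle_group_def)
  qed
  obtain k where k: "\<And>z. z \<in> carrier (torus n) \<Longrightarrow> \<eta> z = character n k z"
    by (rule torus_character[OF hom \<eta>(1)]) blast
  define c where "c i = (\<Sum>j<n. k j * a j i)" for i
  have eq: "cis (dot d m t) = cis (dot d c t)" for t
  proof -
    have "cis (dot d m t) = character n k (?P (torus_exp d t))"
      using \<eta>(2)[of "torus_exp d t"] k[of "?P (torus_exp d t)"]
      by (simp add: torus_map_in_carrier character_torus_exp_dot)
    also have "\<dots> = cis (\<Sum>j<n. of_int (k j) * dot d (a j) t)"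
      by (simp add: torus_map_torus_exp character_torus_exp)
    also have "(\<Sum>j<n. of_int (k j) * dot d (a j) t) = dot d c t"
    proof -
      have "(\<Sum>j<n. of_int (k j) * dot d (a j) t) = (\<Sum>j<n. \<Sum>i<d. of_int (k j * a j i) * t i)"
        by (simp add: dot_def sum_distrib_left mult.assoc)
      also have "\<dots> = (\<Sum>i<d. \<Sum>j<n. of_int (k j * a j i) * t i)" by (rule sum.swap)
      also have "\<dots> = dot d c t" by (simp add: dot_def c_def sum_distrib_right)
      finally show ?thesis .
    qed
    finally show ?thesis .
  qed
  have "\<forall>i<d. m i = c i" by (rule character_inj[OF eq])
  then show ?thesis unfolding c_def by (rule exI[where x = k])
qed

section \<open>One-dimensional kernels of characters\<close>

lemma Euclidean_space_1_homeomorphic_interval: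
  assumes "\<delta> > 0"
  shows "top_of_set {-\<delta><..<\<delta>::real} homeomorphic_space Euclidean_space 1"
proof -
  have "{..<1::nat} = {0}" by auto
  then have "Euclidean_space 1 homeomorphic_space product_topology (\<lambda>i::nat. euclideanreal) {0}"
    using homeomorphic_Euclidean_space_product_topology[of 1] by simp
  then have E: "Euclidean_space 1 homeomorphic_space euclideanreal"
    using homeomorphic_space_singleton_product homeomorphic_space_trans by fastforce
  have "{-\<delta><..<\<delta>} = ball 0 \<delta>" by (auto simp: dist_real_def)
  then have "{-\<delta><..<\<delta>} homeomorphic (UNIV :: real set)" using homeomorphic_ball_UNIV[OF assms, of 0] by simp
  then obtain f g where fg: "homeomorphism {-\<delta><..<\<delta>} (UNIV :: real set) f g" by (auto simp: homeomorphic_def)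
  then have "homeomorphic_maps (top_of_set {-\<delta><..<\<delta>}) euclideanreal f g"
    by (auto simp: homeomorphic_maps_def homeomorphism_def continuous_map_in_subtopology)
  then have "top_of_set {-\<delta><..<\<delta>} homeomorphic_space euclideanreal"
    by (auto simp: homeomorphic_space_def)
  then show ?thesis using E homeomorphic_space_sym homeomorphic_space_trans by blast
qed

lemma Arg_small:
  assumes z: "cmod z = 1" and \<delta>: "0 < \<delta>" "\<delta> \<le> 1" and Re: "Re z > cos \<delta>"
  shows "\<bar>Arg z\<bar> < \<delta>" "z = cis (Arg z)" "z \<notin> \<real>\<^sub>\<le>\<^sub>0"
proof -
  have z0: "z \<noteq> 0" using z by auto
  have "\<delta> < pi / 2" using \<delta> pi_gt3 by linarith
  then have "cos \<delta> > 0" using \<delta> by (intro cos_gt_zero) auto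
  then show "z \<notin> \<real>\<^sub>\<le>\<^sub>0" using Re by (auto simp: complex_nonpos_Reals_iff)
  show e: "z = cis (Arg z)" using cis_Arg[OF z0] z by (simp add: sgn_div_norm)
  show "\<bar>Arg z\<bar> < \<delta>"
  proof (rule ccontr)
    assume "\<not> \<bar>Arg z\<bar> < \<delta>"
    moreover have "\<bar>Arg z\<bar> \<le> pi" using Arg_bounded[of z] by linarith
    ultimately have "cos \<bar>Arg z\<bar> \<le> cos \<delta>" using \<delta> by (intro cos_monotone_0_pi_le) auto
    moreover have "Re z = cos (Arg z)" using arg_cong[OF e, of Re] by simp
    ultimately show False using Re by simp
  qed
qed

text \<open>The chart at \<open>x\<close> is \<open>s \<mapsto> x \<cdot> exp (s \<sigma>)\<close>, and its inverse reads off the argument of the coordinate \<open>i0\<close>.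
A group element close to \<open>x\<close> is \<open>x \<cdot> exp t\<close> with small \<open>t\<close>; if all characters agree at both
points then the numbers \<open>dot d (a k) t\<close> are small multiples of \<open>2 \<pi>\<close>, hence zero, and \<open>t\<close> is a
multiple of \<open>\<sigma>\<close>.\<close>

lemma locally_Euclidean_torus_subgroup:
  fixes n d :: nat
  assumes i0: "i0 < d" "\<sigma> i0 = 1" and \<sigma>: "\<And>i. i < d \<Longrightarrow> \<bar>\<sigma> i\<bar> \<le> 1"
    and ker: "\<And>k. k < n \<Longrightarrow> dot d (a k) \<sigma> = 0"
    and line: "\<And>t. (\<forall>k<n. dot d (a k) t = 0) \<Longrightarrow> \<exists>s. \<forall>i<d. t i = s * \<sigma> i"
  defines "H \<equiv> {g \<in> carrier (torus d). \<forall>k<n. character d (a k) g = 1}"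
  shows "locally_Euclidean 1 (subtopology (torus_topology d) H)"
  unfolding locally_Euclidean_def
proof
  let ?T = "carrier (torus d)"
  fix x assume "x \<in> topspace (subtopology (torus_topology d) H)"
  then have xH: "x \<in> H" and xT: "x \<in> ?T" by (auto simp: H_def)
  have xn: "cmod (x i) = 1" if "i < d" for i using xT that by (auto simp: carrier_torus PiE_iff)
  have xx: "x i * cnj (x i) = 1" if "i < d" for i
    using xn[OF that] by (simp add: complex_norm_square[symmetric])
  \<comment> \<open>With coordinates of t below 1 / D, each dot d (a k) t is at most 1, which is less than 2 pi.\<close>
  define D where "D = 1 + (\<Sum>k<n. \<Sum>i<d. \<bar>real_of_int (a k i)\<bar>)"
  have D1: "D \<ge> 1" by (simp add: D_def sum_nonneg)
  define \<delta> where "\<delta> = 1 / D"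
  have \<delta>: "0 < \<delta>" "\<delta> \<le> 1" using D1 by (auto simp: \<delta>_def)
  define V where "V i = {z \<in> sphere 0 1. Re (z * cnj (x i)) > cos \<delta>}" for i
  define U where "U = H \<inter> (\<Pi>\<^sub>E i\<in>{..<d}. V i)"
  let ?X = "subtopology (torus_topology d) H"
  have UH: "U \<subseteq> H" by (auto simp: U_def)
  have "openin circle_topology (V i)" for i
  proof -
    have "open {z. Re (z * cnj (x i)) > cos \<delta>}" by (intro open_Collect_less continuous_intros)
    moreover have "V i = sphere 0 1 \<inter> {z. Re (z * cnj (x i)) > cos \<delta>}" by (auto simp: V_def)
    ultimately show ?thesis unfolding circle_topology_def by (simp add: openin_open_Int)
  qed
  then have "openin (torus_topology d) (\<Pi>\<^sub>E i\<in>{..<d}. V i)"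
    by (auto simp: torus_topology_def openin_PiE)
  then have openU: "openin ?X U" unfolding U_def by (rule openin_subtopology_Int2)
  have xU: "x \<in> U"
  proof -
    have "cos \<delta> < cos 0" using \<delta> pi_gt3 by (intro cos_monotone_0_pi) auto
    then have "x i \<in> V i" if "i < d" for i unfolding V_def using xn[OF that] xx[OF that] by (simp del: times_complex.sel)
    then show ?thesis using xH xT by (auto simp: U_def carrier_torus PiE_iff)
  qed
  define f where "f h = Arg (h i0 * cnj (x i0))" for h
  define g where "g s = x \<otimes>\<^bsub>torus d\<^esub> torus_exp d (\<lambda>i. s * \<sigma> i)" for s
  have g_eq: "g s = (\<lambda>i\<in>{..<d}. x i * cis (s * \<sigma> i))" for s
    by (auto simp: g_def mult_torus torus_exp_def)
  have gT: "g s \<in> ?T" for s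
    using xn by (auto simp: g_eq carrier_torus norm_mult)
  have gH: "g s \<in> H" for s
  proof -
    have "dot d (a k) (\<lambda>i. s * \<sigma> i) = s * dot d (a k) \<sigma>" for k
      by (simp add: dot_def sum_distrib_left mult_ac)
    then have "character d (a k) (g s) = 1" if "k < n" for k
      using that ker[OF that] xH xT
      by (simp add: g_def character_mult character_torus_exp_dot H_def)
    then show ?thesis using gT by (simp add: H_def)
  qed
  have gx: "g s i * cnj (x i) = cis (s * \<sigma> i)" if "i < d" for s i
    using xx[OF that] that by (simp add: g_eq mult_ac)
  have gU: "g s \<in> U" if s: "s \<in> {-\<delta><..<\<delta>}" for s
  proof -
    have "cos (s * \<sigma> i) > cos \<delta>" if i: "i < d" for i
    proof -
      have "\<bar>s * \<sigma> i\<bar> \<le> \<bar>s\<bar>" using \<sigma>[OF i] by (simp add: abs_mult mult_left_le)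
      then have "cos \<bar>s * \<sigma> i\<bar> > cos \<delta>" using s \<delta> pi_gt3 by (intro cos_monotone_0_pi) auto
      then show ?thesis by simp
    qed
    moreover have "g s i \<in> sphere 0 1" if "i < d" for i using gT[of s] that by (auto simp: carrier_torus PiE_iff)
    ultimately have "g s i \<in> V i" if "i < d" for i
      unfolding V_def using gx[OF that] that by (simp del: times_complex.sel)
    then show ?thesis using gH gT[of s] by (auto simp: U_def carrier_torus PiE_iff)
  qed
  have fg: "f (g s) = s" if s: "s \<in> {-\<delta><..<\<delta>}" for s
    using gx[OF i0(1), of s] i0(2) s \<delta> pi_gt3 by (simp add: f_def Arg_cis)
  have hU: "\<bar>Arg (h i * cnj (x i))\<bar> < \<delta>" "h i * cnj (x i) = cis (Arg (h i * cnj (x i)))"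
     "h i * cnj (x i) \<notin> \<real>\<^sub>\<le>\<^sub>0" if "h \<in> U" "i < d" for h i
  proof -
    have "h i \<in> V i" using that by (auto simp: U_def PiE_iff)
    then have "cmod (h i * cnj (x i)) = 1" "Re (h i * cnj (x i)) > cos \<delta>"
      using xn[OF that(2)] by (auto simp: V_def norm_mult)
    from Arg_small[OF this(1) \<delta> this(2)]
    show "\<bar>Arg (h i * cnj (x i))\<bar> < \<delta>" "h i * cnj (x i) = cis (Arg (h i * cnj (x i)))"
     "h i * cnj (x i) \<notin> \<real>\<^sub>\<le>\<^sub>0" by auto
  qed
  have gf: "g (f h) = h" if h: "h \<in> U" for h
  proof -
    have hT: "h \<in> ?T" "h \<in> H" using h by (auto simp: U_def H_def)
    define t where "t i = Arg (h i * cnj (x i))" for i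
    have hx: "h i = x i * cis (t i)" if "i < d" for i
    proof -
      have "x i * cis (t i) = h i * (x i * cnj (x i))"
        using hU(2)[OF h that] by (simp add: t_def mult_ac)
      then show ?thesis using xx[OF that] by simp
    qed
    have hm: "h = x \<otimes>\<^bsub>torus d\<^esub> torus_exp d t"
    proof
      fix i show "h i = (x \<otimes>\<^bsub>torus d\<^esub> torus_exp d t) i"
        using hT(1) hx[of i] by (cases "i < d") (auto simp: mult_torus torus_exp_def carrier_torus PiE_iff extensional_def)
    qed
    have "dot d (a k) t = 0" if k: "k < n" for k
    proof -
      have "character d (a k) h = 1" "character d (a k) x = 1" using hT xH k by (auto simp: H_def)
      then have c1: "cis (dot d (a k) t) = 1"
        unfolding hm using xT by (simp add: character_mult character_torus_exp_dot)
      have "\<bar>dot d (a k) t\<bar> \<le> (\<Sum>i<d. \<bar>real_of_int (a k i)\<bar> * \<delta>)"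
        unfolding dot_def using hU(1)[OF h, THEN less_imp_le]
        by (intro order_trans[OF sum_abs] sum_mono) (auto simp: abs_mult t_def intro: mult_left_mono)
      also have "\<dots> = (\<Sum>i<d. \<bar>real_of_int (a k i)\<bar>) * \<delta>" by (simp add: sum_distrib_right)
      also have "\<dots> \<le> D * \<delta>"
      proof (intro mult_right_mono)
        have "(\<Sum>i<d. \<bar>real_of_int (a k i)\<bar>) \<le> (\<Sum>k<n. \<Sum>i<d. \<bar>real_of_int (a k i)\<bar>)"
          using k by (intro member_le_sum[of k "{..<n}" "\<lambda>k. \<Sum>i<d. \<bar>real_of_int (a k i)\<bar>"])
            (simp_all add: sum_nonneg)
        then show "(\<Sum>i<d. \<bar>real_of_int (a k i)\<bar>) \<le> D" by (simp add: D_def)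
      qed (use \<delta> in auto)
      also have "\<dots> = 1" using D1 by (simp add: \<delta>_def)
      finally have small: "\<bar>dot d (a k) t\<bar> \<le> 1" .
      have "cos (dot d (a k) t) = 1" using c1 by (auto simp: complex_eq_iff)
      then obtain m :: int where m: "dot d (a k) t = of_int m * 2 * pi" using cos_one_2pi_int by blast
      have "m = 0"
      proof (rule ccontr)
        assume "m \<noteq> 0"
        then have "1 \<le> \<bar>real_of_int m\<bar>" by linarith
        then have "1 * 6 \<le> \<bar>real_of_int m\<bar> * (2 * pi)" using pi_gt3 by (intro mult_mono) auto
        moreover have "\<bar>dot d (a k) t\<bar> = \<bar>real_of_int m\<bar> * (2 * pi)" by (simp add: m abs_mult)
        ultimately show False using small by linarith
      qed
      then show ?thesis using m by simp
    qed
    then obtain s where s: "\<forall>i<d. t i = s * \<sigma> i" using line by blast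
    then have "f h = s" using i0 by (simp add: f_def t_def)
    moreover have "torus_exp d t = torus_exp d (\<lambda>i. s * \<sigma> i)" using s by (intro torus_exp_cong) simp
    ultimately show ?thesis unfolding hm by (simp add: g_def)
  qed
  have fU: "f h \<in> {-\<delta><..<\<delta>}" if "h \<in> U" for h
    using hU(1)[OF that i0(1)] by (simp add: f_def abs_less_iff) 
  let ?J = "top_of_set {-\<delta><..<\<delta>}"
  have topU: "topspace (subtopology (torus_topology d) U) = U"
    using UH by (auto simp: topspace_torus_topology H_def)
  have cont_f: "continuous_map (subtopology (torus_topology d) U) ?J f"
  proof -
    have "continuous_map (subtopology (torus_topology d) U) euclidean (\<lambda>h. h i0 * cnj (x i0))"
      using continuous_map_from_subtopology[OF continuous_map_torus_component[OF i0(1)], of U]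
      by (intro continuous_map_mult_euclidean) auto
    then have "continuous_map (subtopology (torus_topology d) U) (top_of_set (- \<real>\<^sub>\<le>\<^sub>0)) (\<lambda>h. h i0 * cnj (x i0))"
      using hU(3)[OF _ i0(1)] topU by (auto simp: continuous_map_in_subtopology)
    moreover have "continuous_map (top_of_set (- \<real>\<^sub>\<le>\<^sub>0)) euclideanreal Arg"
      using continuous_on_Arg by simp
    ultimately have "continuous_map (subtopology (torus_topology d) U) euclideanreal (Arg \<circ> (\<lambda>h. h i0 * cnj (x i0)))"
      by (rule continuous_map_compose)
    then show ?thesis using fU topU by (auto simp: continuous_map_in_subtopology f_def[abs_def] o_def)
  qed
  have cont_g: "continuous_map ?J (subtopology (torus_topology d) U) g"
  proof -
    have "continuous_map ?J circle_topology (\<lambda>s. g s i)" if "i < d" for i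
    proof -
      have "continuous_map ?J euclidean (\<lambda>s. x i * cis (s * \<sigma> i))"
        by (auto intro!: continuous_intros)
      then show ?thesis using that xn[OF that]
        by (auto simp: g_eq circle_topology_def continuous_map_in_subtopology norm_mult)
    qed
    then have "continuous_map ?J (torus_topology d) g"
      unfolding continuous_map_into_torus by (auto simp: g_eq)
    then show ?thesis using gU by (auto simp: continuous_map_in_subtopology)
  qed
  have "homeomorphic_maps (subtopology (torus_topology d) U) ?J f g"
    unfolding homeomorphic_maps_def using cont_f cont_g gf fg topU by simp
  then have "subtopology (torus_topology d) U homeomorphic_space ?J" by (auto simp: homeomorphic_space_def)
  then have "subtopology (torus_topology d) U homeomorphic_space Euclidean_space 1"
    using Euclidean_space_1_homeomorphic_interval[OF \<delta>(1)] homeomorphic_space_trans by blast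
  moreover have "subtopology ?X U = subtopology (torus_topology d) U"
    using UH by (simp add: subtopology_subtopology inf.absorb2)
  ultimately show "\<exists>U. openin ?X U \<and> x \<in> U \<and> subtopology ?X U homeomorphic_space Euclidean_space 1"
    using openU xU by (intro exI[of _ U]) simp
qed

section \<open>Restrictions to invariant subspaces\<close>

text \<open>If \<open>M\<close> is the matrix of \<open>f\<close> on \<open>W\<close> in an orthonormal basis, then
\<open>det (M M) = det (M\<^sup>T M) = 1\<close>.\<close>

lemma det_on_square:
  fixes f :: "'a::euclidean_space \<Rightarrow> 'a"
  assumes W: "subspace W" and lin: "linear f" and inv: "\<And>x. x \<in> W \<Longrightarrow> f x \<in> W"
    and iso: "\<And>x y. f x \<bullet> f y = x \<bullet> y"
  shows "det_on W (restrict (f \<circ> f) W) = 1"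
proof -
  obtain bs where bs: "orthonormal_basis W bs" using orthonormal_basis_exists[OF W] by blast
  define n where "n = length bs"
  have inW: "bs ! i \<in> W" if "i < n" for i
    using that bs nth_mem[of i bs] span_base[of "bs ! i" "set bs"] by (auto simp: n_def orthonormal_basis_def)
  define M where "M = mat n n (\<lambda>(i, j). bs ! i \<bullet> f (bs ! j))"
  have M: "M \<in> carrier_mat n n" by (simp add: M_def)
  have expand: "x \<bullet> y = (\<Sum>k<n. (bs ! k \<bullet> x) * (bs ! k \<bullet> y))" if "x \<in> W" for x y
  proof -
    have "x \<bullet> y = (\<Sum>k<n. (bs ! k \<bullet> x) *\<^sub>R (bs ! k)) \<bullet> y"
      using arg_cong[OF orthonormal_basis_expand[OF bs that], of "\<lambda>x. x \<bullet> y"] by (simp only: n_def)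
    then show ?thesis by (simp add: inner_sum_left)
  qed
  have "det_on W (restrict (f \<circ> f) W) = Determinant.det (matrix_wrt bs (restrict (f \<circ> f) W))"
    using inv W lin
    by (intro det_on_eq[OF bs]) (auto simp: linear_add linear_scale subspace_add subspace_scale)
  also have "matrix_wrt bs (restrict (f \<circ> f) W) = M * M"
  proof (rule eq_matI)
    fix i j assume "i < dim_row (M * M)" "j < dim_col (M * M)"
    then have ij: "i < n" "j < n" using M by auto
    have "bs ! i \<bullet> f (f (bs ! j)) = (\<Sum>k<n. (bs ! i \<bullet> f (bs ! k)) * (bs ! k \<bullet> f (bs ! j)))"
    proof -
      have e: "f (bs ! j) = (\<Sum>k<n. (bs ! k \<bullet> f (bs ! j)) *\<^sub>R (bs ! k))"
        using orthonormal_basis_expand[OF bs inv[OF inW[OF ij(2)]]] by (simp only: n_def)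
      have "f (f (bs ! j)) = (\<Sum>k<n. (bs ! k \<bullet> f (bs ! j)) *\<^sub>R f (bs ! k))"
        using arg_cong[OF e, of f] by (simp only: linear_sum[OF lin] linear_scale[OF lin])
      then show ?thesis by (simp add: inner_sum_right mult.commute)
    qed
    then show "matrix_wrt bs (restrict (f \<circ> f) W) $$ (i, j) = (M * M) $$ (i, j)"
      using ij inW by (simp add: matrix_wrt_def M_def n_def[symmetric] scalar_prod_def lessThan_atLeast0)
  qed (simp_all add: matrix_wrt_def M_def n_def)
  also have "Determinant.det (M * M) = Determinant.det (transpose_mat M * M)"
    using M by (simp add: det_mult[where n = n] det_transpose)
  also have "transpose_mat M * M = 1\<^sub>m n"
  proof (rule eq_matI)
    fix i j assume "i < dim_row (1\<^sub>m n :: real mat)" "j < dim_col (1\<^sub>m n :: real mat)"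
    then have ij: "i < n" "j < n" by auto
    have "(\<Sum>k<n. (bs ! k \<bullet> f (bs ! i)) * (bs ! k \<bullet> f (bs ! j))) = f (bs ! i) \<bullet> f (bs ! j)"
      by (rule expand[OF inv[OF inW[OF ij(1)]], symmetric])
    also have "\<dots> = (if i = j then 1 else 0)"
      using orthonormal_basis_inner[OF bs] ij by (simp add: iso n_def)
    finally show "(transpose_mat M * M) $$ (i, j) = 1\<^sub>m n $$ (i, j)"
      using ij by (simp add: M_def scalar_prod_def lessThan_atLeast0)
  qed (simp_all add: M_def)
  finally show ?thesis by (simp only: det_one)
qed

context torus_action
begin

definition invariant :: "'a set \<Rightarrow> bool" where
  "invariant W \<longleftrightarrow> subspace W \<and> (\<forall>g\<in>T. \<forall>x\<in>W. R g x \<in> W)"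

lemma restrict_in_SO:
  assumes W: "invariant W" and g: "g \<in> T"
  shows "restrict (R g) W \<in> carrier (SO W)"
proof -
  have sW: "subspace W" and inv: "\<And>g x. g \<in> T \<Longrightarrow> x \<in> W \<Longrightarrow> R g x \<in> W" using W by (auto simp: invariant_def)
  have "bij_betw (R g) W W"
    using g inv[OF g] inv[OF G.inv_closed[OF g]]
    by (intro bij_betwI[where g = "R (inv\<^bsub>torus d\<^esub> g)"]) auto
  then have "bij_betw (restrict (R g) W) W W" by (simp cong: bij_betw_cong)
  then have Bij: "restrict (R g) W \<in> Bij W" by (simp add: Bij_def)
  obtain w where w: "w \<in> T" "w \<otimes>\<^bsub>torus d\<^esub> w = g" using torus_square_root[OF g] by blast
  have "R g = R w \<circ> R w" using mult[OF w(1) w(1)] w(2) by auto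
  then have "det_on W (restrict (R g) W) = 1"
    using det_on_square[OF sW lin[OF w(1)] inv[OF w(1)] iso[OF w(1)]] by simp
  then show ?thesis
    using Bij sW lin[OF g] iso[OF g]
    by (auto simp: SO_def linear_add linear_scale subspace_add subspace_scale)
qed

text \<open>All representations in the theorem, of the quotient group as well as of the product
of tori, arise in this way from a quotient map \<open>p\<close> of the torus.\<close>

lemma SO_representation_quotient:
  assumes W: "invariant W" and p: "p \<in> hom (torus d) L" "p ` T = carrier L"
    and quot: "quotient_map (torus_topology d) Y p"
    and \<sigma>: "\<And>g. g \<in> T \<Longrightarrow> \<sigma> (p g) = restrict (R g) W"
  shows "SO_representation L Y W \<sigma>"
proof -
  have inv: "\<And>g x. g \<in> T \<Longrightarrow> x \<in> W \<Longrightarrow> R g x \<in> W" using W by (auto simp: invariant_def)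
  have "\<sigma> \<in> hom L (SO W)"
  proof (rule homI)
    fix x assume "x \<in> carrier L"
    then obtain g where "g \<in> T" "x = p g" using p(2) by blast
    then show "\<sigma> x \<in> carrier (SO W)" using restrict_in_SO[OF W] by (simp add: \<sigma>)
  next
    fix x y assume "x \<in> carrier L" "y \<in> carrier L"
    then obtain g h where gh: "g \<in> T" "x = p g" "h \<in> T" "y = p h" using p(2) by blast
    have "\<sigma> (x \<otimes>\<^bsub>L\<^esub> y) = \<sigma> (p (g \<otimes>\<^bsub>torus d\<^esub> h))" using gh hom_mult[OF p(1)] by simp
    also have "\<dots> = restrict (R (g \<otimes>\<^bsub>torus d\<^esub> h)) W" using gh by (intro \<sigma>) simp
    also have "\<dots> = compose W (restrict (R g) W) (restrict (R h) W)"
      using gh inv by (auto simp: compose_def mult restrict_def)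
    also have "\<dots> = \<sigma> x \<otimes>\<^bsub>SO W\<^esub> \<sigma> y"
      using restrict_in_SO[OF W] gh by (simp add: \<sigma> SO_def BijGroup_def)
    finally show "\<sigma> (x \<otimes>\<^bsub>L\<^esub> y) = \<sigma> x \<otimes>\<^bsub>SO W\<^esub> \<sigma> y" .
  qed
  moreover have "continuous_map Y (SO_topology W) \<sigma>"
  proof (rule continuous_compose_quotient_map[OF quot])
    have "continuous_map (torus_topology d) (SO_topology W) (\<lambda>g. restrict (R g) W)"
      unfolding SO_topology_def continuous_map_in_subtopology continuous_map_componentwise
      using restrict_in_SO[OF W] cont by (auto simp: topspace_torus_topology)
    then show "continuous_map (torus_topology d) (SO_topology W) (\<sigma> \<circ> p)"
      by (rule continuous_map_eq) (simp add: topspace_torus_topology \<sigma>)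
  qed
  ultimately show ?thesis by (simp add: SO_representation_def)
qed

lemma subspace_fixed_space:
  assumes "H \<subseteq> T"
  shows "subspace (fixed_space R H)"
  using assms lin unfolding fixed_space_def subspace_def
  by (auto simp: linear_0 linear_add linear_scale subset_iff)

lemma invariant_fixed_space:
  assumes "H \<subseteq> T"
  shows "invariant (fixed_space R H)"
proof -
  have "R h (R g x) = R g x" if "h \<in> H" "g \<in> T" "R h x = x" for g h x
    using R_commute[of h g x] that assms by auto
  then show ?thesis using subspace_fixed_space[OF assms] by (auto simp: invariant_def fixed_space_def)
qed

end

lemma torus_action_of_representation:
  assumes "SO_representation (torus d) (torus_topology d) (UNIV :: 'a::euclidean_space set) \<rho>"
  shows "torus_action d \<rho>"
proof -
  have hom: "\<rho> \<in> hom (torus d) (SO UNIV)" and cont: "continuous_map (torus_topology d) (SO_topology UNIV) \<rho>"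
    using assms by (auto simp: SO_representation_def)
  have c: "\<rho> g \<in> carrier (SO UNIV)" if "g \<in> carrier (torus d)" for g using hom_in_carrier[OF hom that] .
  have Bij: "\<rho> g \<in> Bij UNIV" if "g \<in> carrier (torus d)" for g using c[OF that] by (simp add: SO_def)
  interpret G: Group.group "torus d" by (rule group_torus)
  have mult: "\<rho> (g \<otimes>\<^bsub>torus d\<^esub> h) x = \<rho> g (\<rho> h x)" if "g \<in> carrier (torus d)" "h \<in> carrier (torus d)" for g h x
    using hom_mult[OF hom that] Bij[OF that(1)] Bij[OF that(2)] by (simp add: SO_def BijGroup_def compose_def)
  show ?thesis
  proof (rule torus_action.intro)
    fix g :: "nat \<Rightarrow> complex" and x y :: 'a assume g: "g \<in> carrier (torus d)"
    show "linear (\<rho> g)" using c[OF g] by (intro linearI) (auto simp: SO_def)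
  next
    fix g :: "nat \<Rightarrow> complex" and x y :: 'a assume g: "g \<in> carrier (torus d)"
    show "\<rho> g x \<bullet> \<rho> g y = x \<bullet> y" using c[OF g] by (auto simp: SO_def)
  next
    fix g h x assume "g \<in> carrier (torus d)" "h \<in> carrier (torus d)"
    then show "\<rho> (g \<otimes>\<^bsub>torus d\<^esub> h) x = \<rho> g (\<rho> h x)" by (rule mult)
  next
    fix x
    have "inj (\<rho> \<one>\<^bsub>torus d\<^esub>)" using Bij[OF G.one_closed] by (simp add: Bij_def bij_betw_def)
    moreover have "\<rho> \<one>\<^bsub>torus d\<^esub> (\<rho> \<one>\<^bsub>torus d\<^esub> x) = \<rho> \<one>\<^bsub>torus d\<^esub> x"
      using mult[OF G.one_closed G.one_closed, of x] by simp
    ultimately show "\<rho> \<one>\<^bsub>torus d\<^esub> x = x" by (rule injD)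
  next
    fix x
    show "continuous_map (torus_topology d) euclidean (\<lambda>g. \<rho> g x)"
      using cont unfolding SO_topology_def continuous_map_in_subtopology continuous_map_componentwise by auto
  qed
qed

section \<open>The product quotient\<close>

lemma character_uminus: "character d (\<lambda>i. - m i) g = inverse (character d m g)"
  by (simp add: character_def power_int_minus prod_inversef[symmetric] o_def)

lemma character_multiple:
  assumes "g \<in> carrier (torus d)" "\<And>i. i < d \<Longrightarrow> m i = n * q i" "character d q g = 1"
  shows "character d m g = 1"
proof -
  have "character d m g = (\<Prod>i<d. (g i powi q i) powi n)"
    unfolding character_def using assms(2) by (intro prod.cong) (auto simp: power_int_mult[symmetric] mult.commute)
  also have "\<dots> = (character d q g) powi n"
    unfolding character_def by (induction d) (simp_all add: power_int_mult_distrib)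
  finally show ?thesis using assms(3) by simp
qed

lemma character_combination:
  fixes k :: "nat \<Rightarrow> int" and n :: nat
  assumes g: "g \<in> carrier (torus d)" and m: "\<And>i. i < d \<Longrightarrow> m i = (\<Sum>j<n. k j * f j i)"
    and f: "\<And>j. j < n \<Longrightarrow> character d (f j) g = 1"
  shows "character d m g = 1"
proof -
  have g0: "g i \<noteq> 0" if "i < d" for i
    using g that by (auto simp: carrier_torus PiE_iff dest: bspec[of _ _ i])
  have s: "z powi (\<Sum>j<n. c j) = (\<Prod>j<n. z powi c j)" if "z \<noteq> 0" for z :: complex and c :: "nat \<Rightarrow> int" and n :: nat
    by (induction n) (simp_all add: power_int_add that)
  have "character d m g = (\<Prod>i<d. \<Prod>j<n. g i powi (k j * f j i))"
    unfolding character_def using m s[OF g0] by (intro prod.cong) auto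
  also have "\<dots> = (\<Prod>j<n. character d (\<lambda>i. k j * f j i) g)"
    unfolding character_def by (rule prod.swap)
  also have "\<dots> = (\<Prod>j<n. 1)"
    using character_multiple[OF g, of "\<lambda>i. k j * f j i" "k j" "f j" for j] f by (intro prod.cong) auto
  finally show ?thesis by simp
qed

lemma normalize_direction:
  fixes \<tau> :: "nat \<Rightarrow> real"
  assumes "\<exists>i<d. \<tau> i \<noteq> 0"
  obtains i0 where "i0 < d" "\<tau> i0 \<noteq> 0" "\<And>i. i < d \<Longrightarrow> \<bar>\<tau> i / \<tau> i0\<bar> \<le> 1"
proof -
  let ?M = "(\<lambda>i. \<bar>\<tau> i\<bar>) ` {..<d}"
  have fin: "finite ?M" and ne: "?M \<noteq> {}" using assms by auto
  obtain i0 where i0: "i0 < d" "Max ?M = \<bar>\<tau> i0\<bar>" using Max_in[OF fin ne] by auto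
  have le: "\<bar>\<tau> i\<bar> \<le> \<bar>\<tau> i0\<bar>" if "i < d" for i
    using Max_ge[OF fin, of "\<bar>\<tau> i\<bar>"] that i0 by auto
  obtain i1 where "i1 < d" "\<tau> i1 \<noteq> 0" using assms by blast
  then have "\<tau> i0 \<noteq> 0" using le[of i1] by auto
  then show ?thesis using that[of i0] i0 le by (simp add: abs_divide divide_le_eq)
qed

context faithful_weighted_torus_action
begin

text \<open>\<open>V2\<close> is the fixed space of the larger group \<open>N\<close>, the common kernel of the characters of \<open>f\<close>, and
\<open>V1\<close> is its orthogonal complement in the fixed space \<open>V0\<close> of \<open>H\<close>.  Both are invariant because the torus is commutative and acts
by isometries.  A weight vector in \<open>V0\<close> has a weight in the integral span of \<open>q\<close> and \<open>f\<close>.  If the weight is a combination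
of the \<open>f j\<close>, then the vector is in \<open>V2\<close>; so only multiples of \<open>q\<close> contribute to \<open>V1\<close>, and the kernel
of the character of \<open>q\<close> acts trivially there.\<close>

lemma exists_product_quotient:
  assumes d: "d \<ge> 2" and hom: "R \<in> hom (torus d) (SO UNIV)"
  shows "\<exists>H. closed_subgroup (torus d) (torus_topology d) H \<and>
    locally_Euclidean 1 (subtopology (torus_topology d) H) \<and>
    faithful_representation (torus d Mod H) (quotient_topology (torus d) (torus_topology d) H)
      (fixed_space R H) (induced_representation R H) \<and>
    (\<exists>\<phi> V1 V2 \<rho>1 \<rho>2.
      topological_group_iso
        (torus d Mod H) (quotient_topology (torus d) (torus_topology d) H)
        (circle_group \<times>\<times> torus (d - 2)) (prod_topology circle_topology (torus_topology (d - 2))) \<phi> \<and>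
      orthogonal_decomposition (fixed_space R H) V1 V2 \<and>
      SO_representation (circle_group \<times>\<times> torus (d - 2))
        (prod_topology circle_topology (torus_topology (d - 2))) V1 \<rho>1 \<and>
      SO_representation (circle_group \<times>\<times> torus (d - 2))
        (prod_topology circle_topology (torus_topology (d - 2))) V2 \<rho>2 \<and>
      {\<one>\<^bsub>circle_group\<^esub>} \<times> carrier (torus (d - 2))
        \<subseteq> kernel (circle_group \<times>\<times> torus (d - 2)) (SO V1) \<rho>1 \<and>
      carrier circle_group \<times> {\<one>\<^bsub>torus (d - 2)\<^esub>}
        \<subseteq> kernel (circle_group \<times>\<times> torus (d - 2)) (SO V2) \<rho>2 \<and>
      (\<forall>C\<in>carrier (torus d Mod H). \<forall>x\<in>V1. \<forall>y\<in>V2.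
        induced_representation R H C (x + y) = \<rho>1 (\<phi> C) x + \<rho>2 (\<phi> C) y))"
proof -
  obtain q f \<tau> where q: "signed_weight q" and f: "\<And>j. j < d - 2 \<Longrightarrow> signed_weight (f j)"
    and surj: "\<And>\<theta>0 \<theta>. \<exists>t. dot d q t = \<theta>0 \<and> (\<forall>j<d-2. dot d (f j) t = \<theta> j)"
    and \<tau>: "\<exists>i<d. \<tau> i \<noteq> 0" "dot d q \<tau> = 0" "\<And>j. j < d - 2 \<Longrightarrow> dot d (f j) \<tau> = 0"
    and line: "\<And>t. dot d q t = 0 \<Longrightarrow> (\<And>j. j < d - 2 \<Longrightarrow> dot d (f j) t = 0) \<Longrightarrow> \<exists>s. \<forall>i<d. t i = s * \<tau> i"
    and split: "\<And>b n k. b \<in> B \<Longrightarrow> (\<And>i. i < d \<Longrightarrow> wt b i = n * q i + (\<Sum>j<d-2. k j * f j i)) \<Longrightarrow>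
       (\<exists>n'. \<forall>i<d. wt b i = n' * q i) \<or> (\<exists>k'. \<forall>i<d. wt b i = (\<Sum>j<d-2. k' j * f j i))"
    by (rule split_weights[OF d]) blast
  define n where "n = Suc (d - 2)"
  \<comment> \<open>The joint family with q first, for the results about characters indexed by a single number.\<close>
  define a where "a k = (case k of 0 \<Rightarrow> q | Suc j \<Rightarrow> f j)" for k
  have all_n: "(\<forall>k<n. Q (a k)) \<longleftrightarrow> Q q \<and> (\<forall>j<d-2. Q (f j))" for Q
    unfolding n_def All_less_Suc2 by (simp add: a_def)
  define H where "H = {g \<in> T. \<forall>k<n. character d (a k) g = 1}"
  define N where "N = {g \<in> T. \<forall>j<d-2. character d (f j) g = 1}"
  have H_iff: "g \<in> H \<longleftrightarrow> g \<in> T \<and> character d q g = 1 \<and> (\<forall>j<d-2. character d (f j) g = 1)" for g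
    unfolding H_def using all_n[of "\<lambda>m. character d m g = 1"] by blast
  have HN: "H \<subseteq> N" and NT: "N \<subseteq> T" and HT: "H \<subseteq> T" by (auto simp: H_iff N_def)
  let ?T2 = "torus (d - 2)" and ?X = "torus_topology d"
  let ?P = "circle_group \<times>\<times> ?T2"
  let ?Y = "prod_topology circle_topology (torus_topology (d - 2))"
  define \<Psi> where "\<Psi> g = (character d q g, torus_map d (d - 2) f g)" for g
  have \<Psi>hom: "\<Psi> \<in> hom (torus d) ?P"
    unfolding \<Psi>_def hom_paired by (simp add: character_hom torus_map_hom)
  interpret C: Group.group circle_group using comm_group_circle_group comm_group_def by blast
  interpret T2: Group.group ?T2 by (rule group_torus)
  interpret P: Group.group ?P by (rule DirProd_group) unfold_locales
  interpret h: group_hom "torus d" ?P \<Psi> by unfold_locales (rule \<Psi>hom)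
  have topY: "topspace ?Y = carrier ?P"
    by (simp add: topspace_circle_topology topspace_torus_topology)
  have \<Psi>surj: "\<Psi> ` T = carrier ?P"
  proof
    show "\<Psi> ` T \<subseteq> carrier ?P" by (rule image_subsetI) (rule h.hom_closed)
    show "carrier ?P \<subseteq> \<Psi> ` T"
    proof
      fix p assume "p \<in> carrier ?P"
      then obtain w u where p: "p = (w, u)" "cmod w = 1" "u \<in> carrier ?T2" by (auto simp: circle_group_def)
      obtain t where t: "dot d q t = Arg w" "\<forall>j<d-2. dot d (f j) t = Arg (u j)"
        using surj[of "Arg w" "\<lambda>j. Arg (u j)"] by blast
      have "torus_map d (d - 2) f (torus_exp d t) = torus_exp (d - 2) (\<lambda>j. Arg (u j))"
        unfolding torus_map_torus_exp using t(2) by (intro torus_exp_cong) simp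
      moreover have "w \<noteq> 0" using p(2) by auto
      then have "cis (Arg w) = w" using cis_Arg[of w] p(2) by (simp add: sgn_div_norm)
      ultimately have "\<Psi> (torus_exp d t) = p"
        using torus_exp_surj[OF p(3)] by (simp add: \<Psi>_def p(1) character_torus_exp_dot t(1))
      then show "p \<in> \<Psi> ` T" using torus_exp_in_carrier by blast
    qed
  qed
  have \<Psi>cont: "continuous_map ?X ?Y \<Psi>"
    unfolding \<Psi>_def by (intro continuous_map_pairedI continuous_character_circle continuous_torus_map)
  have HausY: "Hausdorff_space ?Y"
    by (simp add: Hausdorff_space_prod_topology Hausdorff_circle Hausdorff_torus)
  have \<Psi>quot: "quotient_map ?X ?Y \<Psi>"
    using \<Psi>surj by (intro continuous_imp_quotient_map \<Psi>cont compact_torus HausY)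
      (simp only: topY topspace_torus_topology)
  have one_T2: "torus_map d (d - 2) f g = \<one>\<^bsub>?T2\<^esub> \<longleftrightarrow> (\<forall>j<d-2. character d (f j) g = 1)" for g
    by (auto simp: torus_map_def one_torus fun_eq_iff restrict_def)
  have one_C: "\<one>\<^bsub>circle_group\<^esub> = 1" by (simp add: circle_group_def)
  have kerH: "kernel (torus d) ?P \<Psi> = H"
    by (auto simp: kernel_def H_iff \<Psi>_def one_T2 one_C)
  have \<Psi>_coset: "\<Psi> (k \<otimes>\<^bsub>torus d\<^esub> g) = \<Psi> g" if k: "k \<in> H" and g: "g \<in> T" for k g
  proof -
    have "\<Psi> k = \<one>\<^bsub>?P\<^esub>" using k unfolding kerH[symmetric] kernel_def by blast
    moreover have "\<Psi> (k \<otimes>\<^bsub>torus d\<^esub> g) = \<Psi> k \<otimes>\<^bsub>?P\<^esub> \<Psi> g"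
      using k g HT by (intro h.hom_mult) auto
    ultimately show ?thesis using P.l_one[OF h.hom_closed[OF g]] by (simp only:)
  qed
  have subH: "subgroup H (torus d)" using h.subgroup_kernel by (simp add: kerH)
  have normH: "H \<lhd> torus d" using h.normal_kernel by (simp add: kerH)
  have closedH: "closedin ?X H"
  proof -
    have "closedin ?Y {\<one>\<^bsub>?P\<^esub>}"
      by (rule closedin_Hausdorff_singleton[OF HausY]) (simp only: topY P.one_closed)
    from closedin_continuous_map_preimage[OF \<Psi>cont this]
    have "closedin ?X {x \<in> topspace ?X. \<Psi> x \<in> {\<one>\<^bsub>?P\<^esub>}}" .
    moreover have "{x \<in> topspace ?X. \<Psi> x \<in> {\<one>\<^bsub>?P\<^esub>}} = H"
      unfolding kerH[symmetric] by (auto simp: kernel_def topspace_torus_topology)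
    ultimately show ?thesis by simp
  qed
  have dim1: "locally_Euclidean 1 (subtopology ?X H)"
  proof -
    obtain i0 where i0: "i0 < d" "\<tau> i0 \<noteq> 0" "\<And>i. i < d \<Longrightarrow> \<bar>\<tau> i / \<tau> i0\<bar> \<le> 1"
      using normalize_direction[OF \<tau>(1)] by blast
    define \<sigma> where "\<sigma> i = \<tau> i / \<tau> i0" for i
    have dot\<sigma>: "dot d m \<sigma> = dot d m \<tau> / \<tau> i0" for m
      by (simp add: dot_def \<sigma>_def sum_divide_distrib)
    have "\<forall>k<n. dot d (a k) \<sigma> = 0" using all_n[of "\<lambda>m. dot d m \<sigma> = 0"] \<tau>(2,3) by (simp add: dot\<sigma>)
    moreover have "\<exists>s. \<forall>i<d. t i = s * \<sigma> i" if "\<forall>k<n. dot d (a k) t = 0" for t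
    proof -
      have "dot d q t = 0" "\<And>j. j < d - 2 \<Longrightarrow> dot d (f j) t = 0"
        using that all_n[of "\<lambda>m. dot d m t = 0"] by auto
      then obtain s where "\<forall>i<d. t i = s * \<tau> i" using line by blast
      then show ?thesis using i0(2) by (intro exI[of _ "s * \<tau> i0"]) (simp add: \<sigma>_def)
    qed
    ultimately show ?thesis
      unfolding H_def using i0
      by (intro locally_Euclidean_torus_subgroup[where ?i0.0 = i0 and \<sigma> = \<sigma>]) (auto simp: \<sigma>_def)
  qed
  define V0 where "V0 = fixed_space R H"
  define V2 where "V2 = fixed_space R N"
  define V1 where "V1 = {x \<in> V0. \<forall>y\<in>V2. x \<bullet> y = 0}"
  have inv0: "invariant V0" unfolding V0_def by (rule invariant_fixed_space[OF HT])
  have inv2: "invariant V2" unfolding V2_def by (rule invariant_fixed_space[OF NT])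
  have V20: "V2 \<subseteq> V0" using HN by (auto simp: V0_def V2_def fixed_space_def)
  have V10: "V1 \<subseteq> V0" by (auto simp: V1_def)
  have s0: "subspace V0" and s2: "subspace V2" using inv0 inv2 by (auto simp: invariant_def)
  have s1: "subspace V1" using s0 unfolding V1_def subspace_def by (auto simp: inner_add_left)
  have inv1: "invariant V1" unfolding invariant_def
  proof (intro conjI s1 ballI)
    fix g x assume g: "g \<in> T" and x: "x \<in> V1"
    have "R g x \<bullet> y = 0" if "y \<in> V2" for y
    proof -
      have "R (inv\<^bsub>torus d\<^esub> g) y \<in> V2" using inv2 g that by (simp add: invariant_def)
      then show ?thesis using x by (simp add: V1_def R_adjoint[OF g])
    qed
    then show "R g x \<in> V1" using x inv0 g by (auto simp: V1_def invariant_def)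
  qed
  have decomp: "orthogonal_decomposition V0 V1 V2"
    unfolding orthogonal_decomposition_def
  proof (intro conjI s1 s2 ballI)
    show "real_inner_class.orthogonal x y" if "x \<in> V1" "y \<in> V2" for x y
      using that by (simp add: V1_def real_inner_class.orthogonal_def)
    show "V0 = {x + y | x y. x \<in> V1 \<and> y \<in> V2}"
    proof
      show "{x + y | x y. x \<in> V1 \<and> y \<in> V2} \<subseteq> V0"
        using V10 V20 s0 by (auto intro!: subspace_add)
      show "V0 \<subseteq> {x + y | x y. x \<in> V1 \<and> y \<in> V2}"
      proof
        fix v assume v: "v \<in> V0"
        obtain y z where yz: "y \<in> span V2" "\<And>w. w \<in> span V2 \<Longrightarrow> real_inner_class.orthogonal z w" "v = y + z"
          using orthogonal_subspace_decomp_exists by blast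
        have sp: "span V2 = V2" using s2 by (simp only: span_eq_iff)
        have y: "y \<in> V2" using yz(1) unfolding sp .
        have "z = v - y" using yz(3) by simp
        then have "z \<in> V0" using v y V20 s0 by (auto intro: subspace_diff)
        then have "z \<in> V1" using yz(2) unfolding sp by (simp add: V1_def real_inner_class.orthogonal_def)
        moreover have "v = z + y" using yz(3) by (simp add: add.commute)
        ultimately show "v \<in> {x + y | x y. x \<in> V1 \<and> y \<in> V2}" using y by blast
      qed
    qed
  qed
  have fixed0: "b \<in> V0" if "b \<in> B" "\<And>g. g \<in> H \<Longrightarrow> character d (wt b) g = 1" for b
    using that fixed_basis_vector HT by (auto simp: V0_def fixed_space_def)
  \<comment> \<open>Expand x in weight vectors; only weights that are trivial on H occur.\<close>
  have trivial_on_V1: "R g x = x" if g: "g \<in> T" "character d q g = 1" and x: "x \<in> V1" for g x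
    unfolding fixed_iff[OF g(1)]
  proof (intro ballI impI)
    fix b assume b: "b \<in> B" "x \<bullet> b \<noteq> 0"
    have "character d (wt b) k = 1" if "k \<in> H" for k
    proof -
      have "R k x = x" using x V10 that by (auto simp: V0_def fixed_space_def)
      then show ?thesis using fixed_iff[of k x] b that HT by blast
    qed
    then have "\<exists>k. \<forall>i<d. wt b i = (\<Sum>j<n. k j * a j i)"
    proof (intro character_factors)
      fix \<theta> :: "nat \<Rightarrow> real"
      obtain t where t: "dot d q t = \<theta> 0" "\<forall>j<d-2. dot d (f j) t = \<theta> (Suc j)"
        using surj[of "\<theta> 0" "\<lambda>j. \<theta> (Suc j)"] by blast
      then have "\<forall>k<n. dot d (a k) t = \<theta> k" unfolding n_def All_less_Suc2 by (simp add: a_def)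
      then show "\<exists>t. \<forall>k<n. dot d (a k) t = \<theta> k" by blast
    next
      fix g assume g: "g \<in> T" "torus_map d n a g = \<one>\<^bsub>torus n\<^esub>"
      have "character d (a k) g = 1" if "k < n" for k
        using fun_cong[OF g(2), of k] that by (simp add: torus_map_def one_torus)
      then have "g \<in> H" using g(1) by (simp add: H_def)
      then show "character d (wt b) g = 1" if "\<And>k. k \<in> H \<Longrightarrow> character d (wt b) k = 1"
        using that by blast
    qed
    then obtain k where "\<forall>i<d. wt b i = (\<Sum>j<n. k j * a j i)" by blast
    then have "wt b i = k 0 * q i + (\<Sum>j<d-2. k (Suc j) * f j i)" if "i < d" for i
      using that unfolding n_def sum.lessThan_Suc_shift by (simp add: a_def)
    from split[OF b(1) this] show "character d (wt b) g = 1"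
    proof
      assume "\<exists>n'. \<forall>i<d. wt b i = n' * q i"
      then obtain n' where "\<forall>i<d. wt b i = n' * q i" by blast
      then show ?thesis using character_multiple[OF g(1) _ g(2), of "wt b" n'] by blast
    next
      assume "\<exists>k'. \<forall>i<d. wt b i = (\<Sum>j<d-2. k' j * f j i)"
      then obtain k' where k': "\<forall>i<d. wt b i = (\<Sum>j<d-2. k' j * f j i)" by blast
      have "R k b = b" if "k \<in> N" for k
      proof -
        have "k \<in> T" using that NT by blast
        have "character d (wt b) k = 1"
        proof (rule character_combination[OF \<open>k \<in> T\<close>])
          show "wt b i = (\<Sum>j<d-2. k' j * f j i)" if "i < d" for i using k' that by blast
          show "character d (f j) k = 1" if "j < d - 2" for j using \<open>k \<in> N\<close> that by (simp add: N_def)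
        qed
        then show ?thesis using fixed_basis_vector[OF b(1)] \<open>k \<in> T\<close> by blast
      qed
      then have "b \<in> V2" by (simp add: V2_def fixed_space_def)
      then show ?thesis using x b(2) by (simp add: V1_def)
    qed
  qed
  define \<pi> where "\<pi> g = H #>\<^bsub>torus d\<^esub> g" for g
  let ?Q = "torus d Mod H" and ?QX = "quotient_topology (torus d) ?X H"
  have \<pi>quot: "quotient_map ?X ?QX \<pi>"
    unfolding \<pi>_def by (rule quotient_map_quotient_topology[OF topspace_torus_topology])
  have \<pi>surj: "\<pi> ` T = carrier ?Q" by (auto simp: carrier_FactGroup \<pi>_def)
  have \<pi>hom: "\<pi> \<in> hom (torus d) ?Q" unfolding \<pi>_def by (rule normal.r_coset_hom_Mod[OF normH])
  define \<phi> where "\<phi> C = the_elem (\<Psi> ` C)" for C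
  have \<phi>iso: "\<phi> \<in> iso ?Q ?P"
    using h.FactGroup_iso_set[OF \<Psi>surj] unfolding kerH \<phi>_def .
  have \<phi>\<pi>: "\<phi> (\<pi> g) = \<Psi> g" if g: "g \<in> T" for g
  proof -
    have "\<Psi> ` \<pi> g = {\<Psi> g}"
    proof -
      have "\<Psi> ` \<pi> g = (\<lambda>k. \<Psi> (k \<otimes>\<^bsub>torus d\<^esub> g)) ` H" unfolding \<pi>_def r_coset_def by blast
      also have "\<dots> = (\<lambda>k. \<Psi> g) ` H" using \<Psi>_coset g by (intro image_cong) auto
      also have "\<dots> = {\<Psi> g}" using subgroup.one_closed[OF subH] by blast
      finally show ?thesis .
    qed
    then show ?thesis by (simp add: \<phi>_def)
  qed
  have \<phi>quot: "quotient_map ?QX ?Y \<phi>"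
  proof (rule quotient_map_from_composition)
    show "continuous_map ?X ?QX \<pi>" using \<pi>quot by (rule quotient_imp_continuous_map)
    have "quotient_map ?X ?Y (\<phi> \<circ> \<pi>)"
      using \<Psi>quot by (rule quotient_map_eq) (simp add: topspace_torus_topology \<phi>\<pi>)
    then show "quotient_map ?X ?Y (\<phi> \<circ> \<pi>)" .
    then show "continuous_map ?QX ?Y \<phi>"
      by (intro continuous_compose_quotient_map[OF \<pi>quot] quotient_imp_continuous_map)
  qed
  have topQ: "topspace ?QX = carrier ?Q"
    using quotient_imp_surjective_map[OF \<pi>quot] \<pi>surj by (simp add: topspace_torus_topology)
  have \<phi>inj: "inj_on \<phi> (carrier ?Q)" using \<phi>iso by (auto simp: iso_def bij_betw_def)
  have \<phi>top: "topological_group_iso ?Q ?QX ?P ?Y \<phi>"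
    unfolding topological_group_iso_def homeomorphic_map_def using \<phi>iso \<phi>quot \<phi>inj by (simp add: topQ)
  have induced: "induced_representation R H (\<pi> g) = restrict (R g) V0" if "g \<in> T" for g
    unfolding \<pi>_def V0_def by (rule induced_representation_coset[OF hom subH that])
  have repQ: "SO_representation ?Q ?QX V0 (induced_representation R H)"
    by (rule SO_representation_quotient[OF inv0 \<pi>hom \<pi>surj \<pi>quot induced])
  \<comment> \<open>The weights q and f j occur in V0, so an element acting trivially on V0 lies in H.\<close>
  have detect: "character d m k = 1"
    if m: "signed_weight m" "\<And>g. g \<in> H \<Longrightarrow> character d m g = 1" and k: "k \<in> T" "\<And>x. x \<in> V0 \<Longrightarrow> R k x = x" for m k
  proof -
    obtain b where b: "b \<in> B" "m = wt b \<or> m = (\<lambda>i. - wt b i)" using m(1) by (auto simp: signed_weight_def)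
    have e: "character d m g = 1 \<longleftrightarrow> character d (wt b) g = 1" for g
      using b(2) by (auto simp: character_uminus)
    have "b \<in> V0" using fixed0[OF b(1)] m(2) e by blast
    then have "R k b = b" by (rule k(2))
    then have "\<forall>b'\<in>B. b \<bullet> b' \<noteq> 0 \<longrightarrow> character d (wt b') k = 1"
      unfolding fixed_iff[OF k(1)] .
    from bspec[OF this b(1)] have "b \<bullet> b \<noteq> 0 \<longrightarrow> character d (wt b) k = 1" .
    moreover have "b \<bullet> b = 1" using orthonormal_B b(1) by (simp add: orthonormal_def)
    ultimately have "character d (wt b) k = 1" by simp
    then show ?thesis by (simp only: e)
  qed
  have inj_induced: "inj_on (induced_representation R H) (carrier ?Q)"
  proof (rule inj_onI)
    fix C C' assume C: "C \<in> carrier ?Q" "C' \<in> carrier ?Q"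
      "induced_representation R H C = induced_representation R H C'"
    obtain g g' where g: "g \<in> T" "C = \<pi> g" "g' \<in> T" "C' = \<pi> g'"
      using C(1,2) unfolding \<pi>surj[symmetric] by blast
    define k where "k = inv\<^bsub>torus d\<^esub> g' \<otimes>\<^bsub>torus d\<^esub> g"
    have kT: "k \<in> T" using g by (simp add: k_def)
    have gk: "g = k \<otimes>\<^bsub>torus d\<^esub> g'"
    proof -
      have "g = g' \<otimes>\<^bsub>torus d\<^esub> k" using g by (simp add: k_def G.m_assoc[symmetric])
      then show ?thesis using G.m_comm[OF g(3) kT] by (simp only:)
    qed
    have fixk: "R k x = x" if x: "x \<in> V0" for x
    proof -
      have "restrict (R g) V0 x = restrict (R g') V0 x" using C(3) g by (simp add: induced)
      then have "R g x = R g' x" using x by simp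
      then show ?thesis using g by (simp add: k_def mult)
    qed
    have "character d q k = 1"
      by (rule detect[OF q _ kT fixk]) (simp_all add: H_iff)
    moreover have "character d (f j) k = 1" if "j < d - 2" for j
      by (rule detect[OF f[OF that] _ kT fixk]) (use that in \<open>simp_all add: H_iff\<close>)
    ultimately have "k \<in> H" using kT by (simp add: H_iff)
    then have "\<Psi> g = \<Psi> g'" unfolding gk using \<Psi>_coset[OF _ g(3)] by blast
    then have "\<phi> C = \<phi> C'" using g by (simp add: \<phi>\<pi>)
    then show "C = C'" by (rule inj_onD[OF \<phi>inj _ C(1,2)])
  qed
  have faithfulQ: "faithful_representation ?Q ?QX V0 (induced_representation R H)"
    unfolding faithful_representation_def using repQ inj_induced by blast
  \<comment> \<open>An arbitrary preimage; two choices differ by an element of H, which acts trivially on V0.\<close>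
  define lift where "lift p = (SOME g. g \<in> T \<and> \<Psi> g = p)" for p
  have lift: "lift p \<in> T" "\<Psi> (lift p) = p" if "p \<in> carrier ?P" for p
  proof -
    have "\<exists>g. g \<in> T \<and> \<Psi> g = p" using that unfolding \<Psi>surj[symmetric] by blast
    from someI_ex[OF this] show "lift p \<in> T" "\<Psi> (lift p) = p" by (auto simp: lift_def)
  qed
  have R_lift: "restrict (R (lift (\<Psi> g))) W = restrict (R g) W" if g: "g \<in> T" and W: "W \<subseteq> V0" for g W
  proof (rule restrict_ext)
    fix x assume "x \<in> W"
    have gP: "\<Psi> g \<in> carrier ?P" by (rule h.hom_closed[OF g])
    define k where "k = inv\<^bsub>torus d\<^esub> g \<otimes>\<^bsub>torus d\<^esub> lift (\<Psi> g)"
    have kT: "k \<in> T" using g lift[OF gP] by (simp add: k_def)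
    have gi: "inv\<^bsub>torus d\<^esub> g \<in> T" using g by simp
    have "\<Psi> k = \<Psi> (inv\<^bsub>torus d\<^esub> g) \<otimes>\<^bsub>?P\<^esub> \<Psi> (lift (\<Psi> g))"
      unfolding k_def by (rule h.hom_mult[OF gi lift(1)[OF gP]])
    also have "\<dots> = \<Psi> (inv\<^bsub>torus d\<^esub> g \<otimes>\<^bsub>torus d\<^esub> g)"
      unfolding lift(2)[OF gP] by (rule h.hom_mult[OF gi g, symmetric])
    also have "\<dots> = \<one>\<^bsub>?P\<^esub>" unfolding G.l_inv[OF g] by (rule h.hom_one)
    finally have "k \<in> H" unfolding kerH[symmetric] kernel_def using kT by blast
    then have "R k x = x" using \<open>x \<in> W\<close> W by (auto simp: V0_def fixed_space_def)
    moreover have "lift (\<Psi> g) = g \<otimes>\<^bsub>torus d\<^esub> k" using g lift[OF gP] by (simp add: k_def G.m_assoc[symmetric])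
    ultimately show "R (lift (\<Psi> g)) x = R g x" using g kT by (simp add: mult)
  qed
  define \<rho>1 where "\<rho>1 p = restrict (R (lift p)) V1" for p
  define \<rho>2 where "\<rho>2 p = restrict (R (lift p)) V2" for p
  have \<rho>1: "\<rho>1 (\<Psi> g) = restrict (R g) V1" if "g \<in> T" for g
    unfolding \<rho>1_def by (rule R_lift[OF that V10])
  have \<rho>2: "\<rho>2 (\<Psi> g) = restrict (R g) V2" if "g \<in> T" for g
    unfolding \<rho>2_def by (rule R_lift[OF that V20])
  have rep1: "SO_representation ?P ?Y V1 \<rho>1"
    by (rule SO_representation_quotient[OF inv1 \<Psi>hom \<Psi>surj \<Psi>quot \<rho>1])
  have rep2: "SO_representation ?P ?Y V2 \<rho>2"
    by (rule SO_representation_quotient[OF inv2 \<Psi>hom \<Psi>surj \<Psi>quot \<rho>2])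
  have one_SO: "\<one>\<^bsub>SO W\<^esub> = restrict (\<lambda>x. x) W" for W :: "'a set" by (simp add: SO_def BijGroup_def)
  have ker1: "{\<one>\<^bsub>circle_group\<^esub>} \<times> carrier ?T2 \<subseteq> kernel ?P (SO V1) \<rho>1"
  proof
    fix p assume p: "p \<in> {\<one>\<^bsub>circle_group\<^esub>} \<times> carrier ?T2"
    then have pP: "p \<in> carrier ?P" by auto
    have "character d q (lift p) = 1" using lift(2)[OF pP] p by (auto simp: \<Psi>_def one_C)
    then have "\<rho>1 p = \<one>\<^bsub>SO V1\<^esub>"
      unfolding one_SO \<rho>1_def using trivial_on_V1[OF lift(1)[OF pP]] by (intro restrict_ext) blast
    then show "p \<in> kernel ?P (SO V1) \<rho>1" using pP by (simp add: kernel_def)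
  qed
  have ker2: "carrier circle_group \<times> {\<one>\<^bsub>?T2\<^esub>} \<subseteq> kernel ?P (SO V2) \<rho>2"
  proof
    fix p assume p: "p \<in> carrier circle_group \<times> {\<one>\<^bsub>?T2\<^esub>}"
    then have pP: "p \<in> carrier ?P" by auto
    have "torus_map d (d - 2) f (lift p) = \<one>\<^bsub>?T2\<^esub>" using lift(2)[OF pP] p by (auto simp: \<Psi>_def)
    then have "lift p \<in> N" using lift(1)[OF pP] by (simp add: N_def one_T2)
    then have "\<rho>2 p = \<one>\<^bsub>SO V2\<^esub>"
      unfolding one_SO \<rho>2_def by (intro restrict_ext) (simp add: V2_def fixed_space_def)
    then show "p \<in> kernel ?P (SO V2) \<rho>2" using pP by (simp add: kernel_def)
  qed
  have sum: "induced_representation R H C (x + y) = \<rho>1 (\<phi> C) x + \<rho>2 (\<phi> C) y"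
    if C: "C \<in> carrier ?Q" and x: "x \<in> V1" and y: "y \<in> V2" for C x y
  proof -
    obtain g where g: "g \<in> T" "C = \<pi> g" using C unfolding \<pi>surj[symmetric] by blast
    have "x + y \<in> V0" using x y V10 V20 s0 by (auto intro: subspace_add)
    then show ?thesis
      using x y g(1) unfolding g(2) induced[OF g(1)] \<phi>\<pi>[OF g(1)] \<rho>1[OF g(1)] \<rho>2[OF g(1)]
      by (simp add: linear_add[OF lin])
  qed
  have closed: "closed_subgroup (torus d) ?X H"
    using subH closedH by (simp add: closed_subgroup_def)
  have sum': "\<forall>C\<in>carrier ?Q. \<forall>x\<in>V1. \<forall>y\<in>V2.
      induced_representation R H C (x + y) = \<rho>1 (\<phi> C) x + \<rho>2 (\<phi> C) y"
    by (intro ballI sum)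
  show ?thesis
    by (rule exI[of _ H], intro conjI closed dim1 faithfulQ[unfolded V0_def], rule exI[of _ \<phi>],
        rule exI[of _ V1], rule exI[of _ V2], rule exI[of _ \<rho>1], rule exI[of _ \<rho>2],
        intro conjI \<phi>top decomp[unfolded V0_def] rep1 rep2 ker1 ker2 sum')
qed

end

theorem theoremF:
  fixes \<rho> :: "(nat \<Rightarrow> complex) \<Rightarrow> 'a::euclidean_space \<Rightarrow> 'a" and d :: nat
  assumes "d \<ge> 3"
    and "faithful_representation (torus d) (torus_topology d) UNIV \<rho>"
  shows "\<exists>H. closed_subgroup (torus d) (torus_topology d) H \<and>
    locally_Euclidean 1 (subtopology (torus_topology d) H) \<and>
    faithful_representation (torus d Mod H) (quotient_topology (torus d) (torus_topology d) H)
      (fixed_space \<rho> H) (induced_representation \<rho> H) \<and>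
    (\<exists>\<phi> V1 V2 \<rho>1 \<rho>2.
      topological_group_iso
        (torus d Mod H) (quotient_topology (torus d) (torus_topology d) H)
        (circle_group \<times>\<times> torus (d - 2)) (prod_topology circle_topology (torus_topology (d - 2))) \<phi> \<and>
      orthogonal_decomposition (fixed_space \<rho> H) V1 V2 \<and>
      SO_representation (circle_group \<times>\<times> torus (d - 2))
        (prod_topology circle_topology (torus_topology (d - 2))) V1 \<rho>1 \<and>
      SO_representation (circle_group \<times>\<times> torus (d - 2))
        (prod_topology circle_topology (torus_topology (d - 2))) V2 \<rho>2 \<and>
      {\<one>\<^bsub>circle_group\<^esub>} \<times> carrier (torus (d - 2))
        \<subseteq> kernel (circle_group \<times>\<times> torus (d - 2)) (SO V1) \<rho>1 \<and>
      carrier circle_group \<times> {\<one>\<^bsub>torus (d - 2)\<^esub>}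
        \<subseteq> kernel (circle_group \<times>\<times> torus (d - 2)) (SO V2) \<rho>2 \<and>
      (\<forall>C\<in>carrier (torus d Mod H). \<forall>x\<in>V1. \<forall>y\<in>V2.
        induced_representation \<rho> H C (x + y) = \<rho>1 (\<phi> C) x + \<rho>2 (\<phi> C) y))"
proof -
  have rep: "SO_representation (torus d) (torus_topology d) UNIV \<rho>" and inj: "inj_on \<rho> (carrier (torus d))"
    using assms(2) by (auto simp: faithful_representation_def)
  interpret torus_action d \<rho> by (rule torus_action_of_representation[OF rep])
  obtain B wt where "weighted_torus_action d \<rho> B wt" using exists_weight_basis by blast
  then interpret weighted_torus_action d \<rho> B wt .
  interpret faithful_weighted_torus_action d \<rho> B wt
  proof
    fix g assume g: "g \<in> T" "\<And>x. \<rho> g x = x"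
    then have "\<rho> g = \<rho> \<one>\<^bsub>torus d\<^esub>" by (simp add: fun_eq_iff one)
    then show "g = \<one>\<^bsub>torus d\<^esub>" by (rule inj_onD[OF inj _ g(1) G.one_closed])
  qed
  have d: "d \<ge> 2" using assms(1) by simp
  have hom: "\<rho> \<in> hom (torus d) (SO UNIV)" using rep by (simp add: SO_representation_def)
  show ?thesis by (rule exists_product_quotient[OF d hom])
qed

end
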